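(* Let $B\subset\mathbb{R}^3$ be a Platonic body inscribed in a sphere with center $O$, and let $B^*$ be obtained from $B$ by building (outward) on every face $F$ of $B$, or by excavating (inward) from every face $F$, a regular pyramid with base $F$ and apex $O_F$, all these pyramids having the same height. Let $\mathcal S$ be the set of segments joining $O$ with the vertices of $B$, $\mathcal O^*$ the set of segments $OO_F$, $\mathcal E$ the set of edges of $B$, and $\mathcal D^*$ the set of segments joining each $O_F$ with the vertices of $F$. Let $f\colon B^*\to\mathbb{R}$ be a function whose restriction to every tetrahedron with vertices $O$, $O_F$ and two adjacent vertices of a face $F$ is convex. Then $$\operatorname{Avg}(f,B^* )\le\frac14f(O)+\frac34\operatorname{Avg}(f,\partial B^* ),$$ $$\operatorname{Avg}(f,B^* )\le\frac12\operatorname{Avg}(f,\mathcal O^* )+\frac12\operatorname{Avg}(f,\mathcal E),$$ $$\operatorname{Avg}(f,B^* )\le\frac12\operatorname{Avg}(f,\mathcal S)+\frac12\operatorname{Avg}(f,\mathcal D^* ),$$ $$\operatorname{Avg}(f,\partial h_O^{3/4}(B^* ))\le\operatorname{Avg}(f,B^* ).$$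
   Context: A regular pyramid over a face $F$ has its apex on the line through the center of $F$ perpendicular to $F$; in the excavated case the common height is less than the distance from $O$ to the faces of $B$. $\operatorname{Avg}(f,B^* )$ is the average over $B^*$ with respect to volume; $\operatorname{Avg}(f,\partial X)$ is the average over the boundary surface with respect to area; for a finite set of segments, $\operatorname{Avg}(f,\cdot)$ is the average over their union with respect to length. $h_O^\lambda(\mathbf x)=O+\lambda(\mathbf x-O)$. *)

theory Defs
  imports "HOL-Analysis.Analysis"
begin

definition golden :: real where "golden = (1 + sqrt 5) / 2"

definition pm1 :: "real set" where "pm1 = {-1, 1}"

definition tetra_verts :: "(real^3) set" where
  "tetra_verts = {vector [1,1,1], vector [1,-1,-1], vector [-1,1,-1], vector [-1,-1,1]}"

definition cube_verts :: "(real^3) set" where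
  "cube_verts = {vector [a,b,c] | a b c. a \<in> pm1 \<and> b \<in> pm1 \<and> c \<in> pm1}"

definition octa_verts :: "(real^3) set" where
  "octa_verts = {vector [a,0,0] | a. a \<in> pm1} \<union> {vector [0,a,0] | a. a \<in> pm1}
                \<union> {vector [0,0,a] | a. a \<in> pm1}"

definition icosa_verts :: "(real^3) set" where
  "icosa_verts = {vector [0, a, b * golden] | a b. a \<in> pm1 \<and> b \<in> pm1}
               \<union> {vector [a, b * golden, 0] | a b. a \<in> pm1 \<and> b \<in> pm1}
               \<union> {vector [a * golden, 0, b] | a b. a \<in> pm1 \<and> b \<in> pm1}"

definition dodeca_verts :: "(real^3) set" where
  "dodeca_verts = cube_verts
               \<union> {vector [0, a / golden, b * golden] | a b. a \<in> pm1 \<and> b \<in> pm1}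
               \<union> {vector [a / golden, b * golden, 0] | a b. a \<in> pm1 \<and> b \<in> pm1}
               \<union> {vector [a * golden, 0, b / golden] | a b. a \<in> pm1 \<and> b \<in> pm1}"

definition platonic_body :: "(real^3) set \<Rightarrow> real^3 \<Rightarrow> bool" where
  "platonic_body B C \<longleftrightarrow>
     (\<exists>P \<in> {tetra_verts, cube_verts, octa_verts, dodeca_verts, icosa_verts}.
        \<exists>r > 0. \<exists>T. orthogonal_transformation T \<and>
          B = convex hull ((\<lambda>x. C + r *\<^sub>R T x) ` P))"

definition vertices_of :: "(real^3) set \<Rightarrow> (real^3) set" where
  "vertices_of F = {v. v extreme_point_of F}"

definition face_center :: "(real^3) set \<Rightarrow> real^3" where
  "face_center F = (1 / real (card (vertices_of F))) *\<^sub>R (\<Sum>v\<in>vertices_of F. v)"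

definition regular_pyramids ::
  "(real^3) set \<Rightarrow> real^3 \<Rightarrow> bool \<Rightarrow> real \<Rightarrow> ((real^3) set \<Rightarrow> real^3) \<Rightarrow> bool" where
  "regular_pyramids B C build h apex \<longleftrightarrow> h > 0 \<and>
     (\<forall>F. F facet_of B \<longrightarrow>
        (\<forall>x\<in>F. \<forall>y\<in>F. (apex F - face_center F) \<bullet> (x - y) = 0) \<and>
        norm (apex F - face_center F) = h \<and>
        (if build then (apex F - face_center F) \<bullet> (face_center F - C) > 0
         else (apex F - face_center F) \<bullet> (face_center F - C) < 0 \<and> h < infdist C F))"

definition pyramid :: "((real^3) set \<Rightarrow> real^3) \<Rightarrow> (real^3) set \<Rightarrow> (real^3) set" where
  "pyramid apex F = convex hull (insert (apex F) F)"

definition star_body ::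
  "(real^3) set \<Rightarrow> bool \<Rightarrow> ((real^3) set \<Rightarrow> real^3) \<Rightarrow> (real^3) set" where
  "star_body B build apex =
     (if build then B \<union> \<Union>{pyramid apex F | F. F facet_of B}
      else closure (B - \<Union>{pyramid apex F | F. F facet_of B}))"

definition homothety :: "real^3 \<Rightarrow> real \<Rightarrow> real^3 \<Rightarrow> real^3" where
  "homothety C t x = C + t *\<^sub>R (x - C)"

definition avg_vol :: "(real^3 \<Rightarrow> real) \<Rightarrow> (real^3) set \<Rightarrow> real" where
  "avg_vol f X = integral X f / measure lebesgue X"

text \<open>Area (2-dimensional) measure on sets contained in finitely many planes: every affine
  plane is parametrised isometrically by R^2; the area integral over S is the sum, over the
  planes meeting S in positive area, of the planar Lebesgue integrals.\<close>
definition plane_param :: "real^3 \<Rightarrow> real^3 \<Rightarrow> real^3 \<Rightarrow> real^2 \<Rightarrow> real^3" where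
  "plane_param p u v z = p + (z $ 1) *\<^sub>R u + (z $ 2) *\<^sub>R v"

definition is_plane :: "(real^3) set \<Rightarrow> bool" where
  "is_plane P \<longleftrightarrow> (\<exists>p u v. norm u = 1 \<and> norm v = 1 \<and> u \<bullet> v = 0 \<and> P = range (plane_param p u v))"

definition plane_chart :: "(real^3) set \<Rightarrow> real^2 \<Rightarrow> real^3" where
  "plane_chart P = (SOME g. \<exists>p u v. norm u = 1 \<and> norm v = 1 \<and> u \<bullet> v = 0 \<and>
                      g = plane_param p u v \<and> P = range g)"

definition planar_integral :: "(real^3) set \<Rightarrow> (real^3) set \<Rightarrow> (real^3 \<Rightarrow> real) \<Rightarrow> real" where
  "planar_integral S P f = integral {z. plane_chart P z \<in> S} (\<lambda>z. f (plane_chart P z))"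

definition planar_area :: "(real^3) set \<Rightarrow> (real^3) set \<Rightarrow> real" where
  "planar_area S P = measure lebesgue {z. plane_chart P z \<in> S}"

definition area_planes :: "(real^3) set \<Rightarrow> (real^3) set set" where
  "area_planes S = {P. is_plane P \<and> planar_area S P > 0}"

definition surface_integral :: "(real^3 \<Rightarrow> real) \<Rightarrow> (real^3) set \<Rightarrow> real" where
  "surface_integral f S = (\<Sum>P\<in>area_planes S. planar_integral S P f)"

definition surface_area :: "(real^3) set \<Rightarrow> real" where
  "surface_area S = (\<Sum>P\<in>area_planes S. planar_area S P)"

definition avg_surf :: "(real^3 \<Rightarrow> real) \<Rightarrow> (real^3) set \<Rightarrow> real" where
  "avg_surf f S = surface_integral f S / surface_area S"

text \<open>Line integral over a segment (given as a point set; independent of orientation).\<close>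
definition seg_ends :: "(real^3) set \<Rightarrow> (real^3) \<times> (real^3)" where
  "seg_ends s = (SOME ab. s = closed_segment (fst ab) (snd ab))"

definition seg_integral :: "(real^3 \<Rightarrow> real) \<Rightarrow> (real^3) set \<Rightarrow> real" where
  "seg_integral f s = (case seg_ends s of (a, b) \<Rightarrow>
      dist a b * integral {0..1} (\<lambda>t::real. f (a + t *\<^sub>R (b - a))))"

text \<open>Average with respect to length over the union of a finite set of segments
  (the segments of each family meet only in finitely many points).\<close>
definition avg_segs :: "(real^3 \<Rightarrow> real) \<Rightarrow> (real^3) set set \<Rightarrow> real" where
  "avg_segs f \<S> = (\<Sum>s\<in>\<S>. seg_integral f s) / (\<Sum>s\<in>\<S>. seg_integral (\<lambda>_. 1) s)"

end

theory Submission
  imports Defs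
begin

text \<open>
  Up to similarity the body is one of five solids whose symmetry group contains the reflections in the
  walls of the cone \<open>D\<close> spanned by a vertex \<open>v\<close>, the midpoint of an edge at \<open>v\<close> and the centre \<open>c\<close> of a
  face at that edge. Every point can be moved into \<open>D\<close> by a symmetry, so that vertices, edges, faces and
  incident face-vertex pairs each form a single orbit. All apices are \<open>\<kappa> g c\<close> with one factor \<open>\<kappa>\<close>,
  and the star body is the union of the images of the tetrahedron with vertices \<open>O\<close>, \<open>\<kappa> c\<close>, \<open>v\<close>, \<open>w\<close>, where
  \<open>v w\<close> is the edge above; these images do not overlap. Every average in the theorem is therefore the mean,
  over the group, of the corresponding average on one tetrahedron.

  On a tetrahedron a uniformly distributed point is \<open>(1 - s) p + s q\<close> with \<open>s\<close> independent of \<open>p\<close> and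
  \<open>q\<close>, where either \<open>p\<close> is a vertex and \<open>q\<close> is uniform on the opposite triangle, and then
  \<open>s\<close> has mean 3/4, or \<open>p\<close> and \<open>q\<close> are uniform on two opposite edges, and then \<open>s\<close> has mean 1/2.
  Convexity gives the upper bounds, Jensen's inequality on the rays from \<open>O\<close> the lower one.
\<close>

subsection \<open>Reflections, faces and convex combinations\<close>

text \<open>The solids enter only through a short list of relations between a vertex, an edge
  midpoint, a face centre and three roots; faces are derived from these and never enumerated. Three
  obstacles shape the rest. The star body is in general not convex, so its closure and frontier are
  read off a positively homogeneous invariant function, whose sublevel and level sets are the body
  and its boundary; building and excavating then differ only in the side of 1 on which \<kappa>
  lies. Areas are defined plane by plane through arbitrarily chosen charts, and triangles of
  different pyramids may be coplanar (over a cube, a suitable height yields the rhombic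
  dodecahedron), so surface integrals must be recovered from non-overlapping triangles that may
  share a plane. Finally, sums over segments, triangles and tetrahedra run over sets, in which
  images under different group elements may coincide; all fibres of the map from the group to such
  an orbit have the same size, which cancels in every quotient. The function may jump on the
  boundaries of the tetrahedra and of the triangles; these are negligible in the respective
  dimension.\<close>

definition reflection :: "real^3 \<Rightarrow> real^3 \<Rightarrow> real^3" where
  "reflection a x = x - (2 * (x \<bullet> a) / (a \<bullet> a)) *\<^sub>R a"

lemma linear_reflection: "linear (reflection a)"
  unfolding reflection_def
  by (intro linearI) (auto simp: algebra_simps add_divide_distrib inner_simps)

text \<open>For a = 0 the quotient in \<open>reflection\<close> is 0 by convention and the map is
  the identity; this is the case settled last.\<close>

lemma inner_reflection_reflection: "reflection a x \<bullet> reflection a y = x \<bullet> y"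
proof (cases "a = 0")
  case False
  then have "a \<bullet> a \<noteq> 0" by simp
  then show ?thesis
    unfolding reflection_def by (simp add: inner_simps inner_commute field_simps)
qed (simp add: reflection_def)

lemma orthogonal_transformation_reflection: "orthogonal_transformation (reflection a)"
  unfolding orthogonal_transformation_def using linear_reflection inner_reflection_reflection by blast

lemma reflection_reflection [simp]: "reflection a (reflection a x) = x"
proof (cases "a = 0")
  case False
  then have "a \<bullet> a \<noteq> 0" by simp
  then show ?thesis
    unfolding reflection_def by (simp add: inner_simps algebra_simps)
qed (simp add: reflection_def)

lemma reflection_orthogonal: "x \<bullet> a = 0 \<Longrightarrow> reflection a x = x"
  by (simp add: reflection_def)

lemma reflection_fixed_iff: "reflection a x = x \<longleftrightarrow> x \<bullet> a = 0"
  by (auto simp: reflection_def)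

lemma inj_reflection: "inj_on (reflection a) X"
  by (metis inj_onI reflection_reflection)

text \<open>The reflection permutes \<open>X\<close> and therefore fixes the sum; its fixed vectors
  are those orthogonal to \<open>a\<close>. This places centroids of symmetric point sets on the
  walls of the chamber.\<close>

lemma sum_orthogonal_root:
  assumes "reflection a ` X = X" "inj_on (reflection a) X"
  shows "(\<Sum>x\<in>X. x) \<bullet> a = 0"
proof -
  have "reflection a (\<Sum>x\<in>X. x) = (\<Sum>x\<in>X. reflection a x)"
    using linear_sum[OF linear_reflection] .
  also have "\<dots> = (\<Sum>x\<in>reflection a ` X. x)"
    using sum.reindex[OF assms(2), of "\<lambda>x. x"] by (simp add: o_def)
  finally show ?thesis
    using assms(1) reflection_fixed_iff by metis
qed

lemma orthogonal_transformation_inner: "orthogonal_transformation g \<Longrightarrow> g x \<bullet> g y = x \<bullet> y"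
  by (simp add: orthogonal_transformation_def)

lemma orthogonal_transformation_adjoint_inv:
  fixes g :: "'a::euclidean_space \<Rightarrow> 'a"
  assumes "orthogonal_transformation g"
  shows "g x \<bullet> y = x \<bullet> inv g y"
  by (metis assms orthogonal_transformation_inner orthogonal_transformation_surj surj_f_inv_f)

lemma translation_eq_iff: "(+) (C :: 'a::group_add) ` X = (+) C ` Y \<longleftrightarrow> X = Y"
  by (rule inj_image_eq_iff) (simp add: inj_def)

text \<open>Faces are defined through open segments. In the degenerate cases t = 0 and x = y there
  is no such segment around the given point, but then that point is \<open>x\<close> itself.\<close>

lemma face_of_convex_combination:
  assumes K: "K face_of S" and S: "convex S" "x \<in> S" "y \<in> S"
    and u: "0 < u" "0 \<le> t" "u + t = 1" and z: "u *\<^sub>R x + t *\<^sub>R y \<in> K"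
  shows "x \<in> K"
proof (cases "t = 0 \<or> x = y")
  case True
  then show ?thesis
    using z u by (auto simp: scaleR_add_left[symmetric])
next
  case False
  have "u *\<^sub>R x + t *\<^sub>R y \<in> open_segment x y"
    unfolding in_segment using False u
    by (intro conjI exI[of _ t]) (auto simp: eq_diff_eq[THEN iffD2, OF \<open>u + t = 1\<close>])
  then show ?thesis
    using face_ofD[OF K] S z by blast
qed

lemma convex_combination3:
  assumes S: "convex S" "q1 \<in> S" "q2 \<in> S" "q3 \<in> S"
    and t: "0 \<le> t1" "0 \<le> t2" "0 \<le> t3" "t1 + t2 + t3 = t" "0 < t"
  obtains y where "y \<in> S" "t *\<^sub>R y = t1 *\<^sub>R q1 + t2 *\<^sub>R q2 + t3 *\<^sub>R q3"
proof
  let ?y = "(t1/t) *\<^sub>R q1 + (t2/t) *\<^sub>R q2 + (t3/t) *\<^sub>R q3"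
  have "t1/t + t2/t + t3/t = 1"
    using t by (simp add: add_divide_distrib[symmetric])
  moreover have "0 \<le> t1/t" "0 \<le> t2/t" "0 \<le> t3/t"
    using t by auto
  ultimately have "?y \<in> convex hull {q1, q2, q3}"
    unfolding convex_hull_3 by blast
  then show "?y \<in> S"
    using hull_minimal[of "{q1, q2, q3}" S convex] S by blast
  show "t *\<^sub>R ?y = t1 *\<^sub>R q1 + t2 *\<^sub>R q2 + t3 *\<^sub>R q3"
    using t by (simp add: scaleR_add_right)
qed

text \<open>The last three points are merged into one point of \<open>S\<close> by normalising their
  weights, which reduces the claim to a combination of two points. For u = 1 there is no weight left
  to normalise.\<close>

lemma face_of_convex_combination4:
  assumes K: "K face_of S" and S: "convex S" and "p \<in> S" "q1 \<in> S" "q2 \<in> S" "q3 \<in> S"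
    and u: "0 < u" "0 \<le> t1" "0 \<le> t2" "0 \<le> t3" "u + t1 + t2 + t3 = 1"
    and z: "u *\<^sub>R p + t1 *\<^sub>R q1 + t2 *\<^sub>R q2 + t3 *\<^sub>R q3 \<in> K"
  shows "p \<in> K"
proof (cases "u = 1")
  case True
  then have "t1 = 0 \<and> t2 = 0 \<and> t3 = 0"
    using u by linarith
  then show ?thesis
    using z True by simp
next
  case False
  then have t: "t1 + t2 + t3 = 1 - u" "0 < 1 - u"
    using u by linarith+
  obtain y where "y \<in> S" "(1 - u) *\<^sub>R y = t1 *\<^sub>R q1 + t2 *\<^sub>R q2 + t3 *\<^sub>R q3"
    using convex_combination3[OF S assms(4-6) u(2-4) t] by blast
  then show ?thesis
    using face_of_convex_combination[OF K S \<open>p \<in> S\<close> \<open>y \<in> S\<close> \<open>0 < u\<close>, of "1 - u"] t z by (simp add: add.assoc)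
qed

text \<open>Strictly positive weights on all points put a combination into the relative interior,
  even if the points are affinely dependent; here the weights are equal.\<close>

lemma average_in_rel_interior_convex_hull:
  fixes X :: "'a::euclidean_space set"
  assumes "finite X" "X \<noteq> {}"
  shows "(1 / real (card X)) *\<^sub>R (\<Sum>x\<in>X. x) \<in> rel_interior (convex hull X)"
proof -
  have "(1 / real (card X)) *\<^sub>R (\<Sum>x\<in>X. x) \<in>
      {y. \<exists>u. (\<forall>x\<in>X. 0 < u x) \<and> sum u X = 1 \<and> (\<Sum>x\<in>X. u x *\<^sub>R x) = y}"
    using assms by (intro CollectI exI[of _ "\<lambda>_. 1 / real (card X)"]) (simp add: scaleR_sum_right card_gt_0_iff)
  then show ?thesis
    by (rule subsetD[OF explicit_subset_rel_interior_convex_hull_minimal[OF assms(1)]])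
qed

lemma linear_extreme_point_of_image:
  assumes "linear g" "inj g"
  shows "g x extreme_point_of g ` S \<longleftrightarrow> x extreme_point_of S"
  using face_of_linear_image[OF assms, of "{x}" S] by (simp add: face_of_singleton)

lemma linear_image_extreme_points:
  assumes "linear g" "inj g"
  shows "{x. x extreme_point_of g ` S} = g ` {x. x extreme_point_of S}"
proof -
  have "x \<in> g ` S" if "x extreme_point_of g ` S" for x
    using that by (simp add: extreme_point_of_def)
  then show ?thesis
    using linear_extreme_point_of_image[OF assms] by blast
qed

subsection \<open>Regular solids and their chambers\<close>

text \<open>The reflections in \<open>a0\<close>, \<open>a1\<close>, \<open>a2\<close> generate the symmetry group of the solid with vertex
  set \<open>V\<close>. A vertex \<open>v\<close>, the midpoint \<open>m\<close> of an edge at \<open>v\<close> and the centre \<open>c\<close> of a face at that edge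
  are dual to these roots, that is, they span a fundamental chamber.\<close>

locale regular_solid =
  fixes V :: "(real^3) set" and v m c a0 a1 a2 :: "real^3"
  assumes finite_V: "finite V" and v_in_V: "v \<in> V"
    and refl_V: "\<And>a. a \<in> {a0, a1, a2} \<Longrightarrow> reflection a ` V \<subseteq> V"
    and refl_v: "reflection a0 v = 2 *\<^sub>R m - v"
    and dual0: "v \<bullet> a0 > 0" "m \<bullet> a0 = 0" "c \<bullet> a0 = 0"
    and dual1: "v \<bullet> a1 = 0" "m \<bullet> a1 > 0" "c \<bullet> a1 = 0"
    and dual2: "v \<bullet> a2 = 0" "m \<bullet> a2 = 0" "c \<bullet> a2 > 0"
    and cc_eq_cv: "c \<bullet> c = c \<bullet> v"
    and c_support: "\<And>p. p \<in> V \<Longrightarrow> c \<bullet> p \<le> c \<bullet> v"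
    and m_support: "\<And>p. p \<in> V \<Longrightarrow> m \<bullet> p \<le> m \<bullet> v"
    and m_support_eq: "\<And>p. p \<in> V \<Longrightarrow> m \<bullet> p = m \<bullet> v \<Longrightarrow> p = v \<or> p = 2 *\<^sub>R m - v"
begin

text \<open>The second end of the edge with midpoint \<open>m\<close>; by \<open>refl_v\<close> it
  is the mirror image of \<open>v\<close> in the wall of \<open>a0\<close>.\<close>

definition w :: "real^3" where "w = 2 *\<^sub>R m - v"

definition B :: "(real^3) set" where "B = convex hull V"

text \<open>Cutting with the supporting plane orthogonal to \<open>c\<close> makes \<open>F\<close>
  an exposed face at once, without listing its vertices.\<close>

definition F :: "(real^3) set" where "F = B \<inter> {x. c \<bullet> x = c \<bullet> c}"

text \<open>All linear isometries preserving \<open>V\<close>, instead of words in the three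
  reflections: closure under composition and inversion is then immediate.\<close>

definition G :: "(real^3 \<Rightarrow> real^3) set" where
  "G = {g. orthogonal_transformation g \<and> g ` V = V}"

section \<open>Coordinates dual to the roots and metric relations\<close>

lemma coords_unique:
  assumes "\<alpha> *\<^sub>R v + \<beta> *\<^sub>R m + \<gamma> *\<^sub>R c = \<alpha>' *\<^sub>R v + \<beta>' *\<^sub>R m + \<gamma>' *\<^sub>R c"
  shows "\<alpha> = \<alpha>'" "\<beta> = \<beta>'" "\<gamma> = \<gamma>'"
proof -
  have "(\<alpha> *\<^sub>R v + \<beta> *\<^sub>R m + \<gamma> *\<^sub>R c) \<bullet> a = (\<alpha>' *\<^sub>R v + \<beta>' *\<^sub>R m + \<gamma>' *\<^sub>R c) \<bullet> a" for a
    using assms by simp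
  from this[of a0] this[of a1] this[of a2] show "\<alpha> = \<alpha>'" "\<beta> = \<beta>'" "\<gamma> = \<gamma>'"
    using dual0 dual1 dual2 by (auto simp: inner_simps)
qed

lemma distinct_vmc: "v \<noteq> m" "v \<noteq> c" "m \<noteq> c"
  using dual0 dual1 dual2 by auto

lemma independent_vmc: "independent {v, m, c}"
proof -
  have 1: "x = 0 \<and> y = 0 \<and> z = 0" if "x *\<^sub>R v + y *\<^sub>R m + z *\<^sub>R c = 0" for x y z
    using coords_unique[of x y z 0 0 0] that by auto
  show ?thesis
  proof
    assume "dependent {v, m, c}"
    then obtain u where "\<exists>x\<in>{v, m, c}. u x \<noteq> 0" "(\<Sum>x\<in>{v, m, c}. u x *\<^sub>R x) = 0"
      using dependent_finite[of "{v,m,c}"] by auto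
    then show False
      using 1[of "u v" "u m" "u c"] distinct_vmc by (auto simp: add.assoc)
  qed
qed

lemma span_vmc: "span {v, m, c} = UNIV"
proof -
  have "card {v,m,c} = 3"
    using distinct_vmc by simp
  then have "UNIV \<subseteq> span {v,m,c}"
    using card_ge_dim_independent[of "{v,m,c}" UNIV] independent_vmc by simp
  then show ?thesis by auto
qed

text \<open>Up to positive factors the roots form the basis dual to \<open>v\<close>,
  \<open>m\<close>, \<open>c\<close>, so pairing with a root reads off one coordinate. Nonnegative
  pairings with all roots therefore describe the chamber.\<close>

lemma coords:
  "x = (x \<bullet> a0 / (v \<bullet> a0)) *\<^sub>R v + (x \<bullet> a1 / (m \<bullet> a1)) *\<^sub>R m + (x \<bullet> a2 / (c \<bullet> a2)) *\<^sub>R c"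
proof -
  have "x \<in> span {v,m,c}"
    using span_vmc by simp
  then obtain k1 k2 k3 where "x = k1 *\<^sub>R v + k2 *\<^sub>R m + k3 *\<^sub>R c"
    by (auto simp: span_breakdown_eq algebra_simps eq_diff_eq)
  then show ?thesis
    using dual0 dual1 dual2 by (simp add: inner_simps)
qed

text \<open>\<open>m\<close> is the midpoint of \<open>v\<close> and its mirror image, hence the
  foot of the perpendicular from \<open>v\<close> to the wall of \<open>a0\<close>. Since
  \<open>c\<close> and \<open>m\<close> lie in this wall, they have the same inner product with
  \<open>v\<close> as with \<open>m\<close>, which gives the relations that follow.\<close>

lemma m_eq: "m = v - (v \<bullet> a0 / (a0 \<bullet> a0)) *\<^sub>R a0"
proof -
  have "2 *\<^sub>R m = 2 *\<^sub>R (v - (v \<bullet> a0 / (a0 \<bullet> a0)) *\<^sub>R a0)"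
    using refl_v unfolding reflection_def by (simp add: algebra_simps scaleR_2)
  then show ?thesis by simp
qed

lemma c_m: "c \<bullet> m = c \<bullet> c"
  by (subst m_eq) (simp add: inner_simps dual0 cc_eq_cv)

lemma m_v: "m \<bullet> v = m \<bullet> m"
proof -
  have "m \<bullet> m = m \<bullet> (v - (v \<bullet> a0 / (a0 \<bullet> a0)) *\<^sub>R a0)"
    using m_eq by simp
  then show ?thesis by (simp add: inner_simps dual0)
qed

lemma c_w: "c \<bullet> w = c \<bullet> c" and m_w: "m \<bullet> w = m \<bullet> m"
  by (simp_all add: w_def inner_simps c_m m_v cc_eq_cv[symmetric])

lemma m_mid: "m = (1/2) *\<^sub>R v + (1/2) *\<^sub>R w"
  by (simp add: w_def algebra_simps)

lemma v_m_eq_v_w: "\<alpha> *\<^sub>R v + \<beta> *\<^sub>R m = (\<alpha> + \<beta>/2) *\<^sub>R v + (\<beta>/2) *\<^sub>R w"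
  by (subst m_mid) (simp add: algebra_simps)

lemma c_pos: "0 < c \<bullet> c"
  using dual2 by auto

text \<open>By \<open>c_m\<close> the vector m - c is orthogonal to \<open>c\<close>, so Pythagoras
  expresses the difference as the squared length of m - c. Its strict positivity is what later
  permits dividing by it.\<close>

lemma c_less_m: "c \<bullet> c < m \<bullet> m"
proof -
  have "0 < (m - c) \<bullet> (m - c)"
    using distinct_vmc by simp
  then show ?thesis
    using c_m by (simp add: inner_simps inner_commute)
qed

section \<open>The symmetry group\<close>

lemma refl_in_G: "a \<in> {a0,a1,a2} \<Longrightarrow> reflection a \<in> G"
proof -
  assume a: "a \<in> {a0,a1,a2}"
  have "inj_on (reflection a) V"
    by (metis inj_onI reflection_reflection)
  then have "reflection a ` V = V"
    using refl_V[OF a] finite_V by (simp add: endo_inj_surj)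
  then show ?thesis
    by (simp add: G_def orthogonal_transformation_reflection)
qed

lemma id_in_G: "id \<in> G"
  by (simp add: G_def orthogonal_transformation_def linear_id id_def[symmetric])

lemma G_comp: "g \<in> G \<Longrightarrow> h \<in> G \<Longrightarrow> g \<circ> h \<in> G"
  unfolding G_def by (metis (mono_tags) image_comp mem_Collect_eq orthogonal_transformation_compose)

lemma G_orth: "g \<in> G \<Longrightarrow> orthogonal_transformation g"
  and G_V: "g \<in> G \<Longrightarrow> g ` V = V"
  by (simp_all add: G_def)

lemma G_linear: "g \<in> G \<Longrightarrow> linear g"
  and G_inj: "g \<in> G \<Longrightarrow> inj g"
  and G_surj: "g \<in> G \<Longrightarrow> surj g"
  using G_orth orthogonal_transformation_linear orthogonal_transformation_inj
    orthogonal_transformation_surj by blast+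

lemma G_inner: "g \<in> G \<Longrightarrow> g x \<bullet> g y = x \<bullet> y"
  using G_orth orthogonal_transformation_inner by blast

lemma G_inv: "g \<in> G \<Longrightarrow> inv g \<in> G"
proof -
  assume g: "g \<in> G"
  have "inv g ` V = inv g ` g ` V"
    using g G_V by simp
  also have "\<dots> = V"
    using G_inj[OF g] by (simp add: image_inv_f_f)
  finally show ?thesis
    using G_orth[OF g] by (simp add: G_def orthogonal_transformation_inv)
qed

lemma G_inv_f [simp]: "g \<in> G \<Longrightarrow> inv g (g x) = x" "g \<in> G \<Longrightarrow> g (inv g x) = x"
  by (simp_all add: G_inj G_surj surj_f_inv_f)

lemma G_adjoint: "g \<in> G \<Longrightarrow> g x \<bullet> y = x \<bullet> inv g y"
  using G_orth orthogonal_transformation_adjoint_inv by blast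

lemma G_B: "g \<in> G \<Longrightarrow> g ` B = B"
  unfolding B_def using convex_hull_linear_image[of g V] G_linear G_V by simp

lemma G_in_B: "g \<in> G \<Longrightarrow> x \<in> B \<Longrightarrow> g x \<in> B"
  using G_B by blast

section \<open>The body, its distinguished face and the supporting planes\<close>

lemma convex_B: "convex B" and compact_B: "compact B" and polytope_B: "polytope B"
  unfolding B_def using finite_V by (auto simp: finite_imp_compact_convex_hull polytope_convex_hull)

lemma w_in_V: "w \<in> V"
  using refl_V[of a0] v_in_V refl_v unfolding w_def by auto

lemma v_in_B: "v \<in> B" and w_in_B: "w \<in> B"
  unfolding B_def using v_in_V w_in_V by (auto simp: hull_inc)

lemma m_in_B: "m \<in> B"
  using m_mid convexD[OF convex_B v_in_B w_in_B, of "1/2" "1/2"] by simp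

lemma B_support_c: "x \<in> B \<Longrightarrow> c \<bullet> x \<le> c \<bullet> c"
proof -
  assume "x \<in> B"
  moreover have "V \<subseteq> {x. c \<bullet> x \<le> c \<bullet> c}"
    using c_support cc_eq_cv by auto
  then have "B \<subseteq> {x. c \<bullet> x \<le> c \<bullet> c}"
    unfolding B_def by (intro hull_minimal convex_halfspace_le)
  ultimately show ?thesis by blast
qed

lemma B_support_m: "x \<in> B \<Longrightarrow> m \<bullet> x \<le> m \<bullet> m"
proof -
  assume "x \<in> B"
  moreover have "V \<subseteq> {x. m \<bullet> x \<le> m \<bullet> m}"
    using m_support m_v by auto
  then have "B \<subseteq> {x. m \<bullet> x \<le> m \<bullet> m}"
    unfolding B_def by (intro hull_minimal convex_halfspace_le)
  ultimately show ?thesis by blast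
qed

lemma F_face: "F face_of B"
  unfolding F_def using convex_B B_support_c by (intro face_of_Int_supporting_hyperplane_le) auto

lemma convex_F: "convex F" and compact_F: "compact F" and polytope_F: "polytope F"
  using face_of_imp_convex[OF F_face] face_of_imp_compact[OF convex_B compact_B F_face]
    face_of_polytope_polytope[OF polytope_B F_face] by auto

lemma v_in_F: "v \<in> F" and w_in_F: "w \<in> F" and m_in_F: "m \<in> F"
  unfolding F_def using v_in_B w_in_B m_in_B cc_eq_cv c_w c_m by auto

lemma G_fix_c_F:
  assumes "g \<in> G" "g c = c"
  shows "g ` F = F"
proof -
  have 1: "g x \<in> F" if "g \<in> G" "g c = c" "x \<in> F" for g x
    using that G_in_B G_inner[of g c x] unfolding F_def by auto
  have "inv g c = c"
    by (metis G_inv_f(1) assms)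
  then have "inv g x \<in> F" if "x \<in> F" for x
    using 1[of "inv g"] that assms G_inv by blast
  then have "F \<subseteq> g ` F"
    using G_inv_f(2)[OF assms(1)] by (auto intro!: image_eqI[of _ g "inv g _"])
  then show ?thesis
    using 1 assms by blast
qed

lemma finite_extreme_F: "finite (vertices_of F)"
  unfolding vertices_of_def
  using polytope_F polytope_imp_polyhedron finite_polyhedron_extreme_points by blast

lemma F_hull: "F = convex hull (vertices_of F)"
  unfolding vertices_of_def using Krein_Milman_Minkowski compact_F convex_F by blast

lemma G_vertices_of: "g \<in> G \<Longrightarrow> vertices_of (g ` S) = g ` vertices_of S"
  unfolding vertices_of_def using linear_image_extreme_points G_linear G_inj by blast

text \<open>The vertex centroid of \<open>F\<close> is fixed by the reflections in \<open>a0\<close>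
  and \<open>a1\<close>, which fix \<open>c\<close> and hence preserve \<open>F\<close>. It is thus
  a multiple of \<open>c\<close>, and the plane of \<open>F\<close> makes the factor 1.\<close>

lemma face_center_F: "face_center F = c"
proof -
  let ?X = "vertices_of F"
  have ne: "?X \<noteq> {}"
    using F_hull v_in_F by auto
  have rel: "face_center F \<in> F"
    using average_in_rel_interior_convex_hull[OF finite_extreme_F ne] F_hull rel_interior_subset
    unfolding face_center_def by blast
  have "reflection a ` ?X = ?X" if "a \<in> {a0,a1}" for a
  proof -
    have "reflection a c = c"
      using that dual0 dual1 by (auto simp: reflection_orthogonal)
    then show ?thesis
      using G_vertices_of[of "reflection a" F] G_fix_c_F refl_in_G[of a] that by auto
  qed
  then have "face_center F \<bullet> a0 = 0" "face_center F \<bullet> a1 = 0"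
    unfolding face_center_def using sum_orthogonal_root[OF _ inj_reflection] by auto
  then have *: "face_center F = (face_center F \<bullet> a2 / (c \<bullet> a2)) *\<^sub>R c" (is "_ = ?k *\<^sub>R c")
    using coords[of "face_center F"] by simp
  have "c \<bullet> face_center F = c \<bullet> c"
    using rel unfolding F_def by simp
  then have "?k * (c \<bullet> c) = c \<bullet> c"
    by (metis * inner_scaleR_right)
  then have "?k = 1"
    using c_pos by (metis less_irrefl mult_cancel_right1)
  then show ?thesis
    using * by simp
qed

lemma c_rel_interior_F: "c \<in> rel_interior F"
proof -
  have "vertices_of F \<noteq> {}"
    using F_hull v_in_F by auto
  then show ?thesis
    using average_in_rel_interior_convex_hull[OF finite_extreme_F] face_center_F F_hull
    unfolding face_center_def by auto
qed

lemma c_in_F: "c \<in> F" and c_in_B: "c \<in> B"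
  using c_rel_interior_F rel_interior_subset F_def by auto

text \<open>The sum of the vertices is fixed by all three reflections, hence orthogonal to all
  roots, hence zero: the origin is the centroid of \<open>V\<close>.\<close>

lemma zero_rel_interior_B: "0 \<in> rel_interior B"
proof -
  have "reflection a ` V = V" if "a \<in> {a0,a1,a2}" for a
    using refl_in_G[OF that] G_V by auto
  then have "(\<Sum>x\<in>V. x) \<bullet> a0 = 0" "(\<Sum>x\<in>V. x) \<bullet> a1 = 0" "(\<Sum>x\<in>V. x) \<bullet> a2 = 0"
    using sum_orthogonal_root[OF _ inj_reflection] by auto
  then have "(\<Sum>x\<in>V. x) = 0"
    using coords[of "\<Sum>x\<in>V. x"] by simp
  then show ?thesis
    using average_in_rel_interior_convex_hull[OF finite_V] v_in_V unfolding B_def by auto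
qed

lemma zero_in_B: "0 \<in> B"
  using zero_rel_interior_B rel_interior_subset by auto

lemma span_V: "span V = UNIV"
proof -
  have "V \<subseteq> span V" by (rule span_superset)
  then have "B \<subseteq> span V"
    unfolding B_def by (intro hull_minimal subspace_imp_convex subspace_span)
  then have "{v,m,c} \<subseteq> span V"
    using v_in_B m_in_B c_in_B by auto
  then show ?thesis
    using span_mono[of "{v,m,c}" "span V"] span_vmc by (auto simp: span_span)
qed

text \<open>\<open>V\<close> spans the space, so a linear symmetry is determined by its restriction
  to \<open>V\<close>, a map from a finite set to itself.\<close>

lemma finite_G: "finite G"
proof (rule finite_imageD)
  show "finite ((\<lambda>g. restrict g V) ` G)"
  proof (rule finite_subset)
    show "(\<lambda>g. restrict g V) ` G \<subseteq> V \<rightarrow>\<^sub>E V"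
    proof
      fix h assume "h \<in> (\<lambda>g. restrict g V) ` G"
      then obtain g where "g \<in> G" "h = restrict g V"
        by blast
      then show "h \<in> V \<rightarrow>\<^sub>E V"
        using G_V[of g] by auto
    qed
    show "finite (V \<rightarrow>\<^sub>E V)"
      using finite_V by (simp add: finite_PiE)
  qed
  show "inj_on (\<lambda>g. restrict g V) G"
  proof (rule inj_onI)
    fix g h assume gh: "g \<in> G" "h \<in> G" and eq: "restrict g V = restrict h V"
    have "g x = h x" if "x \<in> V" for x
      using fun_cong[OF eq, of x] that by simp
    then have "g x = h x" for x
      using linear_eq_on_span[of g h V x] span_V gh G_linear by auto
    then show "g = h" by auto
  qed
qed

text \<open>The subset \<open>H\<close> and the roots \<open>A\<close> are left open because two
  cases occur: the whole group with all roots, and the stabiliser of \<open>c\<close> with the two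
  roots orthogonal to \<open>c\<close>.\<close>

lemma chamber:
  assumes H: "H \<subseteq> G" "id \<in> H" and A: "A \<subseteq> {a0,a1,a2}"
    and cl: "\<And>a h. a \<in> A \<Longrightarrow> h \<in> H \<Longrightarrow> reflection a \<circ> h \<in> H"
  obtains h where "h \<in> H" "\<And>a. a \<in> A \<Longrightarrow> 0 \<le> h x \<bullet> a"
proof -
  \<comment> \<open>The point of the orbit closest to a point inside the chamber lies in the chamber.\<close>
  define \<rho> where "\<rho> = v + m + c"
  have \<rho>: "\<rho> \<bullet> a > 0" if "a \<in> A" for a
    using that A dual0 dual1 dual2 unfolding \<rho>_def by (auto simp: inner_simps)
  have "finite H"
    using H finite_G finite_subset by blast
  then have "Max ((\<lambda>h. h x \<bullet> \<rho>) ` H) \<in> (\<lambda>h. h x \<bullet> \<rho>) ` H"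
    using H by (intro Max_in) auto
  then obtain h where h: "h \<in> H" and hmax: "h x \<bullet> \<rho> = Max ((\<lambda>h. h x \<bullet> \<rho>) ` H)"
    by auto
  have max: "h' x \<bullet> \<rho> \<le> h x \<bullet> \<rho>" if "h' \<in> H" for h'
    unfolding hmax using \<open>finite H\<close> that by (intro Max_ge) auto
  have "0 \<le> h x \<bullet> a" if "a \<in> A" for a
  proof -
    have "reflection a (h x) \<bullet> \<rho> \<le> h x \<bullet> \<rho>"
      using max[OF cl[OF that h]] by simp
    then have "0 \<le> (2 * (h x \<bullet> a) / (a \<bullet> a)) * (\<rho> \<bullet> a)"
      unfolding reflection_def by (simp add: inner_simps inner_commute)
    moreover have "0 < a \<bullet> a"
      using \<rho>[OF that] by auto
    ultimately show ?thesis
      using \<rho>[OF that] by (simp add: zero_le_mult_iff zero_le_divide_iff)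
  qed
  then show ?thesis
    using that h by blast
qed

lemma to_chamber:
  obtains g \<alpha> \<beta> \<gamma> where "g \<in> G" "0 \<le> \<alpha>" "0 \<le> \<beta>" "0 \<le> \<gamma>" "g x = \<alpha> *\<^sub>R v + \<beta> *\<^sub>R m + \<gamma> *\<^sub>R c"
proof -
  obtain h where h: "h \<in> G" "\<And>a. a \<in> {a0,a1,a2} \<Longrightarrow> 0 \<le> h x \<bullet> a"
    using chamber[of G "{a0,a1,a2}" x] id_in_G G_comp refl_in_G by blast
  show ?thesis
    by (rule that[OF h(1) _ _ _ coords]) (use h(2) dual0 dual1 dual2 in auto)
qed

text \<open>Only the reflections in \<open>a0\<close> and \<open>a1\<close> are known to fix
  \<open>c\<close> and keep \<open>y\<close> in \<open>F\<close>; they yield the signs of \<alpha>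
  and \<beta>. The sign of \<gamma> comes from the half-space
  \<open>m \<bullet> x \<le> m \<bullet> m\<close> containing the body: with \<alpha> + \<beta> +
  \<gamma> = 1 it reads \<gamma> (|m|^2 - |c|^2) \<ge> 0.\<close>

lemma F_to_chamber:
  assumes "y \<in> F"
  obtains g \<alpha> \<beta> \<gamma> where "g \<in> G" "g c = c" "0 \<le> \<alpha>" "0 \<le> \<beta>" "0 \<le> \<gamma>" "\<alpha> + \<beta> + \<gamma> = 1"
    "g y = \<alpha> *\<^sub>R v + \<beta> *\<^sub>R m + \<gamma> *\<^sub>R c"
proof -
  let ?H = "{g \<in> G. g c = c}"
  have "reflection a \<in> ?H" if "a \<in> {a0,a1}" for a
    using that refl_in_G[of a] dual0 dual1 by (auto simp: reflection_orthogonal)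
  then obtain h where h: "h \<in> ?H" "\<And>a. a \<in> {a0,a1} \<Longrightarrow> 0 \<le> h y \<bullet> a"
    using chamber[of ?H "{a0,a1}" y] id_in_G G_comp by auto
  define \<alpha> \<beta> \<gamma> where "\<alpha> = h y \<bullet> a0 / (v \<bullet> a0)" and "\<beta> = h y \<bullet> a1 / (m \<bullet> a1)"
    and "\<gamma> = h y \<bullet> a2 / (c \<bullet> a2)"
  have hy: "h y = \<alpha> *\<^sub>R v + \<beta> *\<^sub>R m + \<gamma> *\<^sub>R c"
    unfolding \<alpha>_def \<beta>_def \<gamma>_def by (rule coords)
  have hF: "h y \<in> F"
    using G_fix_c_F h assms by blast
  then have "c \<bullet> h y = c \<bullet> c"
    by (simp add: F_def)
  then have "(\<alpha> + \<beta> + \<gamma>) * (c \<bullet> c) = c \<bullet> c"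
    unfolding hy by (simp add: inner_simps c_m cc_eq_cv[symmetric] algebra_simps)
  then have 1: "\<alpha> + \<beta> + \<gamma> = 1"
    using c_pos by simp
  have "m \<bullet> h y \<le> m \<bullet> m"
    using hF B_support_m F_def by auto
  then have "(\<alpha> + \<beta>) * (m \<bullet> m) + \<gamma> * (c \<bullet> c) \<le> m \<bullet> m"
    unfolding hy by (simp add: inner_simps c_m m_v inner_commute[of m c] algebra_simps)
  moreover have "\<alpha> + \<beta> = 1 - \<gamma>"
    using 1 by simp
  ultimately have "0 \<le> \<gamma> * (m \<bullet> m - c \<bullet> c)"
    by (simp add: algebra_simps)
  then have "0 \<le> \<gamma>"
    using c_less_m by (simp add: zero_le_mult_iff)
  moreover have "0 \<le> \<alpha>" "0 \<le> \<beta>"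
    using h dual0 dual1 unfolding \<alpha>_def \<beta>_def by auto
  ultimately show ?thesis
    using that hy 1 h by blast
qed

section \<open>Faces of the body that meet the chamber\<close>

lemma face_of_B_zero: "K face_of B \<Longrightarrow> 0 \<in> K \<Longrightarrow> K = B"
  using subset_of_face_of[of K B B] zero_rel_interior_B face_of_imp_subset by blast

text \<open>The plane orthogonal to \<open>m\<close> through \<open>m\<close> supports the body. The
  face it cuts out is the hull of some points of \<open>V\<close>, and by
  \<open>m_support_eq\<close> only the two ends of the edge qualify.\<close>

lemma E_face: "closed_segment v w face_of B"
proof -
  let ?K = "B \<inter> {x. m \<bullet> x = m \<bullet> m}"
  have K: "?K face_of B"
    using convex_B B_support_m by (intro face_of_Int_supporting_hyperplane_le) auto
  then obtain S where S: "S \<subseteq> V" "?K = convex hull S"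
    using face_of_convex_hull_subset finite_V finite_imp_compact unfolding B_def by metis
  have "S \<subseteq> {v, w}"
  proof
    fix p assume "p \<in> S"
    then have "p \<in> V" "m \<bullet> p = m \<bullet> v"
      using S(1) S(2)[symmetric] hull_subset[of S convex] m_v by auto
    then show "p \<in> {v, w}"
      using m_support_eq by (auto simp: w_def)
  qed
  then have "?K \<subseteq> convex hull {v,w}"
    using S hull_mono by metis
  moreover have "{v,w} \<subseteq> ?K"
    using v_in_B w_in_B m_v m_w by auto
  then have "convex hull {v,w} \<subseteq> ?K"
    using K face_of_imp_convex by (intro hull_minimal) auto
  ultimately show ?thesis
    using K by (simp add: segment_convex_hull)
qed

lemma v_neq_w: "v \<noteq> w"
proof -
  have "w \<bullet> a0 = - (v \<bullet> a0)"
    by (simp add: w_def inner_simps dual0)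
  then show ?thesis
    using dual0 by auto
qed

text \<open>A face contains every point that has positive weight in one of its elements. The origin
  is excluded because it is a relative interior point of the body, so its weight 1 - (\<alpha> +
  \<beta> + \<gamma>) must vanish. \<open>c\<close> and \<open>m\<close> are relative interior
  points of \<open>F\<close> and of the edge, so once one of them belongs to \<open>K\<close>, its
  whole face does.\<close>

lemma face_chamber:
  assumes K: "K face_of B" "K \<noteq> B" and z: "\<alpha> *\<^sub>R v + \<beta> *\<^sub>R m + \<gamma> *\<^sub>R c \<in> K"
    and nn: "0 \<le> \<alpha>" "0 \<le> \<beta>" "0 \<le> \<gamma>"
  shows "\<alpha> + \<beta> + \<gamma> = 1" "0 < \<gamma> \<Longrightarrow> F \<subseteq> K" "0 < \<beta> \<Longrightarrow> closed_segment v w \<subseteq> K"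
proof -
  let ?z = "\<alpha> *\<^sub>R v + \<beta> *\<^sub>R m + \<gamma> *\<^sub>R c"
  have zB: "?z \<in> B"
    using z K face_of_imp_subset by blast
  have "(\<alpha> + \<beta> + \<gamma>) * (c \<bullet> c) \<le> 1 * (c \<bullet> c)"
    using B_support_c[OF zB] by (simp add: inner_simps c_m cc_eq_cv[symmetric] algebra_simps)
  then have le: "\<alpha> + \<beta> + \<gamma> \<le> 1"
    using c_pos by (meson mult_le_cancel_right_pos)
  show 1: "\<alpha> + \<beta> + \<gamma> = 1"
  proof (rule ccontr)
    assume "\<alpha> + \<beta> + \<gamma> \<noteq> 1"
    then have "0 \<in> K"
      using face_of_convex_combination4[OF K(1) convex_B zero_in_B v_in_B m_in_B c_in_B,
          of "1 - (\<alpha> + \<beta> + \<gamma>)" \<alpha> \<beta> \<gamma>] le nn z by auto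
    then show False
      using face_of_B_zero K by blast
  qed
  show "F \<subseteq> K" if "0 < \<gamma>"
  proof -
    have "c \<in> K"
      using face_of_convex_combination4[OF K(1) convex_B c_in_B v_in_B m_in_B zero_in_B,
          of \<gamma> \<alpha> \<beta> 0] that nn z 1 by (simp add: add_ac)
    then show ?thesis
      using subset_of_face_of[OF K(1), of F] c_rel_interior_F F_def by blast
  qed
  show "closed_segment v w \<subseteq> K" if "0 < \<beta>"
  proof -
    have "m \<in> K"
      using face_of_convex_combination4[OF K(1) convex_B m_in_B v_in_B c_in_B zero_in_B,
          of \<beta> \<alpha> \<gamma> 0] that nn z 1 by (simp add: add_ac)
    moreover have "m \<in> rel_interior (closed_segment v w)"
      using v_neq_w m_mid
      by (auto simp: rel_interior_closed_segment in_segment intro!: exI[of _ "1/2"])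
    moreover have "closed_segment v w \<subseteq> B"
      using E_face face_of_imp_subset by blast
    ultimately show ?thesis
      using subset_of_face_of[OF K(1), of "closed_segment v w"] by blast
  qed
qed

lemma aff_dim_B: "aff_dim B = 3"
proof -
  have "dim {v,m,c} = 3"
    using dim_eq_card_independent[OF independent_vmc] distinct_vmc by simp
  then have "int (dim B) \<ge> 3"
    using dim_subset[of "{v,m,c}" B] v_in_B m_in_B c_in_B by simp
  moreover have "aff_dim B = int (dim B)"
    using zero_in_B by (intro aff_dim_zero hull_inc)
  ultimately show ?thesis
    using aff_dim_le_DIM[of B] by simp
qed

lemma affine_independent_vmc: "\<not> affine_dependent {v,m,c}"
  using independent_vmc affine_dependent_imp_dependent by blast

lemma aff_dim_F: "aff_dim F = 2"
proof -
  have "aff_dim {v,m,c} = 2"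
    using aff_dim_affine_independent[OF affine_independent_vmc] distinct_vmc by simp
  then have "2 \<le> aff_dim F"
    using aff_dim_subset[of "{v,m,c}" F] v_in_F m_in_F c_in_F by simp
  moreover have "F \<noteq> B"
  proof -
    have "0 \<notin> F"
      using c_pos unfolding F_def by auto
    then show ?thesis
      using zero_in_B by blast
  qed
  then have "aff_dim F < 3"
    using face_of_aff_dim_lt[OF convex_B F_face] aff_dim_B by simp
  ultimately show ?thesis by simp
qed

lemma aff_dim_E: "aff_dim (closed_segment v w) = 1"
  using v_neq_w by (simp add: segment_convex_hull aff_dim_convex_hull aff_dim_2)

lemma F_facet: "F facet_of B"
  using F_face aff_dim_F aff_dim_B v_in_F unfolding facet_of_def by auto

section \<open>Transitivity on facets, edges and vertices\<close>

lemma G_face: "g \<in> G \<Longrightarrow> g ` K face_of B \<longleftrightarrow> K face_of B"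
  using face_of_linear_image[of g K B] G_linear G_inj G_B by simp

lemma G_aff_dim: "g \<in> G \<Longrightarrow> aff_dim (g ` K) = aff_dim K"
  using aff_dim_injective_linear_image G_linear G_inj by blast

lemma G_facet: "g \<in> G \<Longrightarrow> g ` F facet_of B"
  using F_facet G_face G_aff_dim unfolding facet_of_def by auto

lemma G_inv_image: "g \<in> G \<Longrightarrow> g ` K = K' \<Longrightarrow> K = inv g ` K'"
  using G_inj by (auto simp: image_inv_f_f)

lemma face_eq:
  assumes "K face_of B" "K' face_of B" "K \<subseteq> K'" "aff_dim K = aff_dim K'"
  shows "K = K'"
proof (rule ccontr)
  assume "K \<noteq> K'"
  moreover have "K face_of K'"
    using assms face_of_face by blast
  ultimately show False
    using face_of_aff_dim_lt[of K' K] assms face_of_imp_convex by force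
qed

text \<open>A relative interior point of the facet is moved into the chamber. By
  \<open>face_chamber\<close> its weights add up to 1, which puts it in the plane of
  \<open>F\<close>; the moved facet is then contained in \<open>F\<close>, and equal dimensions make
  the two faces coincide.\<close>

lemma facets_orbit: "K facet_of B \<longleftrightarrow> (\<exists>g\<in>G. K = g ` F)"
proof
  assume K: "K facet_of B"
  then have Kf: "K face_of B" "aff_dim K = 2" "K \<noteq> {}" "convex K"
    unfolding facet_of_def using aff_dim_B face_of_imp_convex by auto
  then obtain y where y: "y \<in> rel_interior K"
    using rel_interior_eq_empty by blast
  obtain g \<alpha> \<beta> \<gamma> where g: "g \<in> G" "0 \<le> \<alpha>" "0 \<le> \<beta>" "0 \<le> \<gamma>"
    "g y = \<alpha> *\<^sub>R v + \<beta> *\<^sub>R m + \<gamma> *\<^sub>R c"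
    using to_chamber by blast
  let ?K = "g ` K"
  have gK: "?K face_of B" "aff_dim ?K = 2"
    using Kf g by (auto simp: G_face G_aff_dim)
  have ri: "g y \<in> rel_interior ?K"
    using rel_interior_injective_linear_image[OF linear_conv_bounded_linear[THEN iffD1, OF G_linear[OF g(1)]] G_inj[OF g(1)], of K] y by auto
  then have "g y \<in> ?K"
    using rel_interior_subset by blast
  moreover have "?K \<noteq> B"
    using gK aff_dim_B by auto
  ultimately have "\<alpha> + \<beta> + \<gamma> = 1"
    using face_chamber(1)[OF gK(1)] g by auto
  then have "c \<bullet> g y = c \<bullet> c"
    using g by (simp add: inner_simps c_m cc_eq_cv[symmetric]) (metis distrib_right mult_1)
  moreover have "g y \<in> B"
    using \<open>g y \<in> ?K\<close> gK face_of_imp_subset by blast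
  ultimately have "g y \<in> F"
    by (simp add: F_def)
  then have "?K \<subseteq> F"
    using subset_of_face_of[OF F_face, of ?K] ri gK face_of_imp_subset by blast
  then have "?K = F"
    using face_eq[OF gK(1) F_face] gK aff_dim_F by simp
  then show "\<exists>g\<in>G. K = g ` F"
    using G_inv_image g G_inv by blast
next
  assume "\<exists>g\<in>G. K = g ` F"
  then show "K facet_of B" using G_facet by blast
qed

text \<open>As for facets, but the moved point must lie on the edge: a positive weight of
  \<open>c\<close> would force the two-dimensional \<open>F\<close> into a face of dimension
  one.\<close>

lemma edges_orbit: "K face_of B \<and> aff_dim K = 1 \<longleftrightarrow> (\<exists>g\<in>G. K = g ` closed_segment v w)"
proof
  assume K: "K face_of B \<and> aff_dim K = 1"
  then have "K \<noteq> {}" "convex K"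
    using face_of_imp_convex by auto
  then obtain y where y: "y \<in> rel_interior K"
    using rel_interior_eq_empty by blast
  obtain g \<alpha> \<beta> \<gamma> where g: "g \<in> G" "0 \<le> \<alpha>" "0 \<le> \<beta>" "0 \<le> \<gamma>"
    "g y = \<alpha> *\<^sub>R v + \<beta> *\<^sub>R m + \<gamma> *\<^sub>R c"
    using to_chamber by blast
  let ?K = "g ` K"
  have gK: "?K face_of B" "aff_dim ?K = 1"
    using K g by (auto simp: G_face G_aff_dim)
  have ri: "g y \<in> rel_interior ?K"
    using rel_interior_injective_linear_image[OF linear_conv_bounded_linear[THEN iffD1, OF G_linear[OF g(1)]] G_inj[OF g(1)], of K] y by auto
  then have "g y \<in> ?K"
    using rel_interior_subset by blast
  moreover have "?K \<noteq> B"
    using gK aff_dim_B by auto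
  ultimately have 1: "\<alpha> + \<beta> + \<gamma> = 1" and "0 < \<gamma> \<Longrightarrow> F \<subseteq> ?K"
    using face_chamber[OF gK(1), of \<alpha> \<beta> \<gamma>] g by auto
  then have "\<gamma> = 0"
    using aff_dim_subset[of F ?K] gK aff_dim_F g by force
  then have "g y = (1 - \<beta>/2) *\<^sub>R v + (\<beta>/2) *\<^sub>R w"
  proof -
    have "\<alpha> = 1 - \<beta>"
      using 1 \<open>\<gamma> = 0\<close> by simp
    then show ?thesis
      using g \<open>\<gamma> = 0\<close> v_m_eq_v_w[of \<alpha> \<beta>] by simp
  qed
  then have "g y \<in> closed_segment v w"
    unfolding in_segment using g 1 \<open>\<gamma> = 0\<close> by (auto intro!: exI[of _ "\<beta>/2"])
  then have "?K \<subseteq> closed_segment v w"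
    using subset_of_face_of[OF E_face, of ?K] ri gK face_of_imp_subset by blast
  then have "?K = closed_segment v w"
    using face_eq[OF gK(1) E_face] gK aff_dim_E by simp
  then show "\<exists>g\<in>G. K = g ` closed_segment v w"
    using G_inv_image g G_inv by blast
next
  assume "\<exists>g\<in>G. K = g ` closed_segment v w"
  then show "K face_of B \<and> aff_dim K = 1"
    using E_face aff_dim_E by (auto simp: G_face G_aff_dim)
qed

lemma extreme_chamber:
  assumes "x extreme_point_of B" "x = \<alpha> *\<^sub>R v + \<beta> *\<^sub>R m + \<gamma> *\<^sub>R c"
    and nn: "0 \<le> \<alpha>" "0 \<le> \<beta>" "0 \<le> \<gamma>"
  shows "x = v"
proof -
  have K: "{x} face_of B"
    using assms by (simp add: face_of_singleton)
  moreover have "{x} \<noteq> B"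
    using v_in_B w_in_B v_neq_w by (metis singletonD)
  ultimately have 1: "\<alpha> + \<beta> + \<gamma> = 1" "0 < \<gamma> \<Longrightarrow> F \<subseteq> {x}" "0 < \<beta> \<Longrightarrow> closed_segment v w \<subseteq> {x}"
    using face_chamber[OF K, of \<alpha> \<beta> \<gamma>] assms by auto
  have "\<not> F \<subseteq> {x}" "\<not> closed_segment v w \<subseteq> {x}"
    using v_in_F w_in_F v_neq_w by auto
  then have "\<gamma> = 0" "\<beta> = 0"
    using 1 nn by (auto simp: order_less_le)
  then have "\<alpha> = 1"
    using 1 by simp
  with \<open>\<gamma> = 0\<close> \<open>\<beta> = 0\<close> show ?thesis
    using assms by simp
qed

lemma G_extreme: "g \<in> G \<Longrightarrow> g x extreme_point_of B \<longleftrightarrow> x extreme_point_of B"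
  using linear_extreme_point_of_image[of g x B] G_linear G_inj G_B by simp

lemma ends_extreme: "v extreme_point_of B" "w extreme_point_of B"
proof -
  have "{v} face_of closed_segment v w" "{w} face_of closed_segment v w"
    by (auto simp: face_of_singleton extreme_point_of_segment)
  then have "{v} face_of B" "{w} face_of B"
    using E_face face_of_trans by blast+
  then show "v extreme_point_of B" "w extreme_point_of B"
    by (auto simp: face_of_singleton)
qed

lemma vertices_orbit: "x extreme_point_of B \<longleftrightarrow> (\<exists>g\<in>G. x = g v)"
proof
  assume x: "x extreme_point_of B"
  obtain g \<alpha> \<beta> \<gamma> where g: "g \<in> G" "0 \<le> \<alpha>" "0 \<le> \<beta>" "0 \<le> \<gamma>"
    "g x = \<alpha> *\<^sub>R v + \<beta> *\<^sub>R m + \<gamma> *\<^sub>R c"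
    using to_chamber by blast
  then have "g x = v"
    using extreme_chamber[of "g x"] G_extreme x by blast
  then show "\<exists>g\<in>G. x = g v"
    using G_inv g G_inv_f by metis
next
  assume "\<exists>g\<in>G. x = g v"
  then show "x extreme_point_of B"
    using G_extreme ends_extreme by blast
qed

lemma extreme_point_of_F: "x extreme_point_of F \<longleftrightarrow> x \<in> F \<and> x extreme_point_of B"
  using extreme_point_of_face[OF F_face] by blast

text \<open>Moving the vertex into the chamber within the stabiliser of \<open>c\<close> leads to
  \<open>v\<close>; the reflection in \<open>a0\<close>, which fixes \<open>c\<close> and exchanges
  \<open>v\<close> and \<open>w\<close>, corrects this to \<open>w\<close>. The end \<open>w\<close>
  is wanted because the segment from the apex to \<open>w\<close> is the one opposite to the segment
  from the centre to \<open>v\<close>.\<close>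

lemma vertex_of_F:
  assumes "x extreme_point_of F"
  obtains g where "g \<in> G" "g c = c" "x = g w"
proof -
  obtain g \<alpha> \<beta> \<gamma> where g: "g \<in> G" "g c = c" "0 \<le> \<alpha>" "0 \<le> \<beta>" "0 \<le> \<gamma>"
    "g x = \<alpha> *\<^sub>R v + \<beta> *\<^sub>R m + \<gamma> *\<^sub>R c"
    using F_to_chamber assms extreme_point_of_F by metis
  then have gx: "g x = v"
    using extreme_chamber[of "g x"] G_extreme assms extreme_point_of_F by blast
  have s: "reflection a0 \<in> G" "reflection a0 c = c"
    using refl_in_G dual0 by (auto simp: reflection_orthogonal)
  have "reflection a0 w = v"
    using refl_v w_def reflection_reflection by metis
  show ?thesis
  proof (rule that[of "inv g \<circ> reflection a0"])
    show "inv g \<circ> reflection a0 \<in> G"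
      using g s G_comp G_inv by blast
    have "inv g c = c"
      by (metis G_inv_f(1) g(1,2))
    then show "(inv g \<circ> reflection a0) c = c"
      using s by simp
    show "x = (inv g \<circ> reflection a0) w"
      using gx g \<open>reflection a0 w = v\<close> by (metis G_inv_f(1) comp_apply)
  qed
qed

end

section \<open>Maxima of finite families and convex combinations\<close>

lemma continuous_on_Max_family:
  assumes "finite I" "I \<noteq> {}" "\<And>i. i \<in> I \<Longrightarrow> continuous_on S (\<phi> i)"
  shows "continuous_on S (\<lambda>x. Max ((\<lambda>i. \<phi> i x :: real) ` I))"
  using assms
proof (induction I rule: finite_ne_induct)
  case (insert i I)
  then have "(\<lambda>x. Max ((\<lambda>i. \<phi> i x) ` insert i I)) = (\<lambda>x. max (\<phi> i x) (Max ((\<lambda>i. \<phi> i x) ` I)))"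
    by auto
  then show ?case
    using insert by (simp add: continuous_on_max)
qed simp

lemma convex_combination4:
  assumes S: "convex S" and "p \<in> S" "q1 \<in> S" "q2 \<in> S" "q3 \<in> S"
    and u: "0 \<le> u" "0 \<le> t1" "0 \<le> t2" "0 \<le> t3" "u + t1 + t2 + t3 = 1"
  shows "u *\<^sub>R p + t1 *\<^sub>R q1 + t2 *\<^sub>R q2 + t3 *\<^sub>R q3 \<in> S"
proof (cases "u = 1")
  case True
  then have "t1 = 0 \<and> t2 = 0 \<and> t3 = 0"
    using u by linarith
  then show ?thesis
    using True \<open>p \<in> S\<close> by simp
next
  case False
  then have t: "t1 + t2 + t3 = 1 - u" "0 < 1 - u"
    using u by linarith+
  obtain y where "y \<in> S" "(1 - u) *\<^sub>R y = t1 *\<^sub>R q1 + t2 *\<^sub>R q2 + t3 *\<^sub>R q3"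
    using convex_combination3[OF S assms(3-5) u(2-4) t] by blast
  then show ?thesis
    using convexD[OF S \<open>p \<in> S\<close> \<open>y \<in> S\<close>, of u "1 - u"] u t by (simp add: add.assoc)
qed

lemma convex_hull_zero_3:
  "convex hull {0, p, q, r} =
    {\<alpha> *\<^sub>R p + \<beta> *\<^sub>R q + \<gamma> *\<^sub>R r | \<alpha> \<beta> \<gamma>. 0 \<le> \<alpha> \<and> 0 \<le> \<beta> \<and> 0 \<le> \<gamma> \<and> \<alpha> + \<beta> + \<gamma> \<le> 1}"
  (is "_ = ?R")
proof
  have "x \<in> ?R" if "x \<in> convex hull {0, p, q, r}" for x
  proof -
    have "x \<in> convex hull (insert 0 {p,q,r})"
      using that by simp
    then obtain u t y where "0 \<le> u" "0 \<le> t" "u + t = 1" "y \<in> convex hull {p,q,r}" and x: "x = t *\<^sub>R y"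
      using convex_hull_insert[of "{p,q,r}" 0] by auto
    moreover from this obtain \<alpha> \<beta> \<gamma> where "0 \<le> \<alpha>" "0 \<le> \<beta>" "0 \<le> \<gamma>" "\<alpha> + \<beta> + \<gamma> = 1"
      and y: "y = \<alpha> *\<^sub>R p + \<beta> *\<^sub>R q + \<gamma> *\<^sub>R r"
      unfolding convex_hull_3 by auto
    moreover have "t * \<alpha> + t * \<beta> + t * \<gamma> = t"
      using \<open>\<alpha> + \<beta> + \<gamma> = 1\<close> by (metis distrib_left mult.right_neutral)
    ultimately have "x = (t*\<alpha>) *\<^sub>R p + (t*\<beta>) *\<^sub>R q + (t*\<gamma>) *\<^sub>R r \<and> 0 \<le> t*\<alpha> \<and> 0 \<le> t*\<beta> \<and> 0 \<le> t*\<gamma>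
        \<and> t*\<alpha> + t*\<beta> + t*\<gamma> \<le> 1"
      by (auto simp: x y scaleR_add_right)
    then show ?thesis
      by blast
  qed
  then show "convex hull {0, p, q, r} \<subseteq> ?R" by blast
  have "\<alpha> *\<^sub>R p + \<beta> *\<^sub>R q + \<gamma> *\<^sub>R r \<in> convex hull {0, p, q, r}"
    if "0 \<le> \<alpha> \<and> 0 \<le> \<beta> \<and> 0 \<le> \<gamma> \<and> \<alpha> + \<beta> + \<gamma> \<le> 1" for \<alpha> \<beta> \<gamma>
    using convex_combination4[of "convex hull {0,p,q,r}" 0 p q r "1 - (\<alpha>+\<beta>+\<gamma>)" \<alpha> \<beta> \<gamma>] that
    by (auto simp: hull_inc)
  then show "?R \<subseteq> convex hull {0, p, q, r}" by blast
qed

subsection \<open>The gauge of the star body\<close>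

context regular_solid
begin

text \<open>The support function of the orbit of \<open>u\<close>. For u = c it is
  \<open>c \<bullet> c\<close> times the gauge of the body.\<close>

definition orbit_max :: "real^3 \<Rightarrow> real^3 \<Rightarrow> real" where
  "orbit_max u x = Max ((\<lambda>g. g u \<bullet> x) ` G)"

lemma orbit_max_invariant:
  assumes "h \<in> G"
  shows "orbit_max u (h x) = orbit_max u x"
proof -
  have "(\<lambda>g. g u \<bullet> h x) ` G = (\<lambda>g. g u \<bullet> x) ` G"
  proof (intro equalityI subsetI)
    fix y assume "y \<in> (\<lambda>g. g u \<bullet> h x) ` G"
    then obtain g where g: "g \<in> G" "y = g u \<bullet> h x" by blast
    then have "y = (inv h \<circ> g) u \<bullet> x"
      using G_adjoint[OF assms, of x "g u"] by (simp add: inner_commute)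
    then show "y \<in> (\<lambda>g. g u \<bullet> x) ` G"
      using G_comp[OF G_inv[OF assms] g(1)] by blast
  next
    fix y assume "y \<in> (\<lambda>g. g u \<bullet> x) ` G"
    then obtain g where g: "g \<in> G" "y = g u \<bullet> x" by blast
    then have "y = (h \<circ> g) u \<bullet> h x"
      using G_inner[OF assms] by simp
    then show "y \<in> (\<lambda>g. g u \<bullet> h x) ` G"
      using G_comp[OF assms g(1)] by blast
  qed
  then show ?thesis
    by (simp add: orbit_max_def)
qed

lemma continuous_orbit_max: "continuous_on UNIV (orbit_max u)"
proof -
  have "continuous_on UNIV (\<lambda>x. Max ((\<lambda>g. g u \<bullet> x) ` G))"
    using finite_G id_in_G by (intro continuous_on_Max_family continuous_intros) auto
  then show ?thesis
    by (simp add: orbit_max_def[abs_def])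
qed

lemma orbit_max_eqI:
  assumes "\<And>g. g \<in> G \<Longrightarrow> g u \<bullet> x \<le> u \<bullet> x"
  shows "orbit_max u x = u \<bullet> x"
  unfolding orbit_max_def
proof (rule Max_eqI)
  show "u \<bullet> x \<in> (\<lambda>g. g u \<bullet> x) ` G"
    using id_in_G by (auto intro!: image_eqI[of _ _ id])
qed (use finite_G assms in auto)

lemma G_c_le: "g \<in> G \<Longrightarrow> p \<in> B \<Longrightarrow> g c \<bullet> p \<le> c \<bullet> c"
  using G_adjoint B_support_c G_in_B G_inv by simp

lemma G_m_le: "g \<in> G \<Longrightarrow> p \<in> B \<Longrightarrow> g m \<bullet> p \<le> m \<bullet> m"
  using G_adjoint B_support_m G_in_B G_inv by simp

text \<open>The maximum is attained at the identity for each of the generators \<open>c\<close>,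
  \<open>v\<close>, \<open>w\<close> of the cone, hence linearly on the whole cone. Most of these
  bounds say that \<open>c\<close> and \<open>m\<close> support the body; for \<open>m\<close> at
  the generator \<open>c\<close> the bound is instead that \<open>c\<close> supports the body at the
  images of \<open>m\<close>.\<close>

lemma orbit_max_sector:
  assumes "0 \<le> \<alpha>" "0 \<le> \<beta>" "0 \<le> \<gamma>" and x: "x = \<alpha> *\<^sub>R c + \<beta> *\<^sub>R v + \<gamma> *\<^sub>R w"
  shows "orbit_max c x = (\<alpha> + \<beta> + \<gamma>) * (c \<bullet> c)"
    and "orbit_max m x = \<alpha> * (c \<bullet> c) + (\<beta> + \<gamma>) * (m \<bullet> m)"
proof -
  have cx: "c \<bullet> x = (\<alpha> + \<beta> + \<gamma>) * (c \<bullet> c)"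
    unfolding x by (simp add: inner_simps c_w cc_eq_cv[symmetric] algebra_simps)
  have mx: "m \<bullet> x = \<alpha> * (c \<bullet> c) + (\<beta> + \<gamma>) * (m \<bullet> m)"
    unfolding x by (simp add: inner_simps m_w m_v inner_commute[of m c] c_m algebra_simps)
  have "g c \<bullet> x \<le> c \<bullet> x" if "g \<in> G" for g
  proof -
    have "g c \<bullet> x = \<alpha> * (g c \<bullet> c) + \<beta> * (g c \<bullet> v) + \<gamma> * (g c \<bullet> w)"
      unfolding x by (simp add: inner_simps)
    also have "\<dots> \<le> \<alpha> * (c \<bullet> c) + \<beta> * (c \<bullet> c) + \<gamma> * (c \<bullet> c)"
      using assms G_c_le[OF that] c_in_B v_in_B w_in_B by (intro add_mono mult_left_mono) auto
    finally show ?thesis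
      using cx by (simp add: algebra_simps)
  qed
  then show "orbit_max c x = (\<alpha> + \<beta> + \<gamma>) * (c \<bullet> c)"
    using orbit_max_eqI cx by metis
  have "g m \<bullet> x \<le> m \<bullet> x" if "g \<in> G" for g
  proof -
    have "g m \<bullet> x = \<alpha> * (c \<bullet> g m) + \<beta> * (g m \<bullet> v) + \<gamma> * (g m \<bullet> w)"
      unfolding x by (simp add: inner_simps inner_commute)
    also have "\<dots> \<le> \<alpha> * (c \<bullet> c) + \<beta> * (m \<bullet> m) + \<gamma> * (m \<bullet> m)"
      using assms G_m_le[OF that] B_support_c[OF G_in_B[OF that m_in_B]] v_in_B w_in_B
      by (intro add_mono mult_left_mono) auto
    finally show ?thesis
      using mx by (simp add: algebra_simps)
  qed
  then show "orbit_max m x = \<alpha> * (c \<bullet> c) + (\<beta> + \<gamma>) * (m \<bullet> m)"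
    using orbit_max_eqI mx by metis
qed

text \<open>The cone over \<open>c\<close>, \<open>v\<close>, \<open>w\<close> is the chamber
  together with its mirror image in \<open>a0\<close>. Passing to it replaces the midpoint
  \<open>m\<close> by the two ends of the edge, which are corners of the tetrahedra.\<close>

lemma to_sector:
  obtains g \<alpha> \<beta> \<gamma> where "g \<in> G" "0 \<le> \<alpha>" "0 \<le> \<beta>" "0 \<le> \<gamma>" "g x = \<alpha> *\<^sub>R c + \<beta> *\<^sub>R v + \<gamma> *\<^sub>R w"
proof -
  obtain g \<alpha> \<beta> \<gamma> where g: "g \<in> G" "0 \<le> \<alpha>" "0 \<le> \<beta>" "0 \<le> \<gamma>" "g x = \<alpha> *\<^sub>R v + \<beta> *\<^sub>R m + \<gamma> *\<^sub>R c"
    using to_chamber by blast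
  show ?thesis
    using that[of g \<gamma> "\<alpha> + \<beta>/2" "\<beta>/2"] g v_m_eq_v_w[of \<alpha> \<beta>] by (simp add: add_ac)
qed

text \<open>On the cone over the triangle \<open>c, v, w\<close> the two orbit maxima are linear, and \<open>star_gauge \<kappa>\<close> is
  the linear functional equal to 1 at \<open>\<kappa> c\<close>, \<open>v\<close> and \<open>w\<close>. It is thus the star_gauge of the star body
  with apices \<open>\<kappa> g c\<close>.\<close>

definition star_gauge :: "real \<Rightarrow> real^3 \<Rightarrow> real" where
  "star_gauge \<kappa> x = (let s = (orbit_max m x - orbit_max c x) / (m \<bullet> m - c \<bullet> c)
    in (orbit_max c x / (c \<bullet> c) - s) / \<kappa> + s)"

lemma gauge_invariant: "g \<in> G \<Longrightarrow> star_gauge \<kappa> (g x) = star_gauge \<kappa> x"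
  by (simp add: star_gauge_def orbit_max_invariant)

text \<open>The two orbit maxima agree at \<open>c\<close> and differ by |m|^2 - |c|^2 at
  \<open>v\<close> and \<open>w\<close>. Their normalised difference is therefore \<beta> +
  \<gamma>, and subtracting it from the gauge of the body leaves \<alpha>.\<close>

lemma gauge_sector:
  assumes "0 \<le> \<alpha>" "0 \<le> \<beta>" "0 \<le> \<gamma>" and x: "x = \<alpha> *\<^sub>R c + \<beta> *\<^sub>R v + \<gamma> *\<^sub>R w"
  shows "star_gauge \<kappa> x = \<alpha> / \<kappa> + \<beta> + \<gamma>"
proof -
  have "orbit_max m x - orbit_max c x = (\<beta> + \<gamma>) * (m \<bullet> m - c \<bullet> c)"
    using orbit_max_sector[OF assms] by (simp add: algebra_simps)
  then have "(orbit_max m x - orbit_max c x) / (m \<bullet> m - c \<bullet> c) = \<beta> + \<gamma>"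
    using c_less_m by simp
  moreover have "orbit_max c x / (c \<bullet> c) = \<alpha> + \<beta> + \<gamma>"
    using orbit_max_sector[OF assms] c_pos by simp
  ultimately show ?thesis
    by (simp add: star_gauge_def)
qed

lemma gauge_apex_sector:
  assumes "0 < \<kappa>" "0 \<le> \<alpha>" "0 \<le> \<beta>" "0 \<le> \<gamma>"
  shows "star_gauge \<kappa> (\<alpha> *\<^sub>R (\<kappa> *\<^sub>R c) + \<beta> *\<^sub>R v + \<gamma> *\<^sub>R w) = \<alpha> + \<beta> + \<gamma>"
  using gauge_sector[of "\<alpha> * \<kappa>" \<beta> \<gamma> _ \<kappa>] assms by simp

lemma continuous_gauge: "continuous_on UNIV (star_gauge \<kappa>)"
  unfolding star_gauge_def[abs_def] Let_def divide_inverse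
  using continuous_orbit_max by (intro continuous_intros) (auto simp: continuous_on_eq_continuous_at)

lemma gauge_scaleR:
  assumes "0 \<le> t"
  shows "star_gauge \<kappa> (t *\<^sub>R x) = t * star_gauge \<kappa> x"
proof -
  obtain g \<alpha> \<beta> \<gamma> where g: "g \<in> G" "0 \<le> \<alpha>" "0 \<le> \<beta>" "0 \<le> \<gamma>"
    "g x = \<alpha> *\<^sub>R c + \<beta> *\<^sub>R v + \<gamma> *\<^sub>R w"
    using to_sector by blast
  have "star_gauge \<kappa> (t *\<^sub>R x) = star_gauge \<kappa> (g (t *\<^sub>R x))"
    using gauge_invariant g by simp
  also have "g (t *\<^sub>R x) = (t*\<alpha>) *\<^sub>R c + (t*\<beta>) *\<^sub>R v + (t*\<gamma>) *\<^sub>R w"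
    using G_linear[OF g(1)] g(5) by (simp add: linear_scale scaleR_add_right)
  also have "star_gauge \<kappa> \<dots> = t*\<alpha> / \<kappa> + t*\<beta> + t*\<gamma>"
    using g assms by (intro gauge_sector) auto
  also have "\<dots> = t * star_gauge \<kappa> (g x)"
    using gauge_sector[OF g(2-5)] by (simp add: algebra_simps)
  finally show ?thesis
    using gauge_invariant[OF g(1), of \<kappa> x] by simp
qed

section \<open>Sublevel and level sets of the gauge\<close>

lemma closed_gauge_le: "closed {x. star_gauge \<kappa> x \<le> t}"
  and open_gauge_less: "open {x. star_gauge \<kappa> x < t}"
  using continuous_gauge[of \<kappa>] by (auto intro!: closed_Collect_le open_Collect_less continuous_intros)

text \<open>Homogeneity along rays takes the place of convexity: a point at level at most t is the
  limit of its multiples by factors below 1, and these lie strictly below level t.\<close>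

lemma closure_gauge_less:
  assumes "0 < t"
  shows "closure {x. star_gauge \<kappa> x < t} = {x. star_gauge \<kappa> x \<le> t}"
proof
  show "closure {x. star_gauge \<kappa> x < t} \<subseteq> {x. star_gauge \<kappa> x \<le> t}"
    by (rule closure_minimal) (auto simp: closed_gauge_le)
  show "{x. star_gauge \<kappa> x \<le> t} \<subseteq> closure {x. star_gauge \<kappa> x < t}"
  proof
    fix x assume x: "x \<in> {x. star_gauge \<kappa> x \<le> t}"
    have "(\<lambda>n. (1 - inverse (real (Suc n))) *\<^sub>R x) \<longlonglongrightarrow> (1 - 0) *\<^sub>R x"
      by (intro tendsto_intros LIMSEQ_inverse_real_of_nat)
    moreover have "star_gauge \<kappa> ((1 - inverse (real (Suc n))) *\<^sub>R x) < t" for n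
    proof -
      let ?r = "1 - inverse (real (Suc n))"
      have r: "0 \<le> ?r" "?r < 1"
        by (auto simp: inverse_le_1_iff)
      have "?r * star_gauge \<kappa> x \<le> ?r * t"
        using r x by (intro mult_left_mono) auto
      also have "\<dots> < 1 * t"
        using r assms by (intro mult_strict_right_mono) auto
      finally show ?thesis
        using gauge_scaleR[OF r(1)] by simp
    qed
    ultimately show "x \<in> closure {x. star_gauge \<kappa> x < t}"
      unfolding closure_sequential by (intro exI[of _ "\<lambda>n. (1 - inverse (real (Suc n))) *\<^sub>R x"]) auto
  qed
qed

text \<open>A point at level t > 0 is not interior, since its multiples by factors slightly above 1
  exceed the level.\<close>

lemma frontier_gauge_le:
  assumes "0 < t"
  shows "frontier {x. star_gauge \<kappa> x \<le> t} = {x. star_gauge \<kappa> x = t}"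
proof -
  have "interior {x. star_gauge \<kappa> x \<le> t} = {x. star_gauge \<kappa> x < t}"
  proof
    show "{x. star_gauge \<kappa> x < t} \<subseteq> interior {x. star_gauge \<kappa> x \<le> t}"
      by (rule interior_maximal) (auto simp: open_gauge_less)
    show "interior {x. star_gauge \<kappa> x \<le> t} \<subseteq> {x. star_gauge \<kappa> x < t}"
    proof
      fix x assume x: "x \<in> interior {x. star_gauge \<kappa> x \<le> t}"
      have "(\<lambda>n. (1 + inverse (real (Suc n))) *\<^sub>R x) \<longlonglongrightarrow> (1 + 0) *\<^sub>R x"
        by (intro tendsto_intros LIMSEQ_inverse_real_of_nat)
      then have "eventually (\<lambda>n. (1 + inverse (real (Suc n))) *\<^sub>R x \<in> interior {x. star_gauge \<kappa> x \<le> t}) sequentially"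
        using x topological_tendstoD[OF _ open_interior] by force
      then obtain n where "(1 + inverse (real (Suc n))) *\<^sub>R x \<in> interior {x. star_gauge \<kappa> x \<le> t}"
        using eventually_happens trivial_limit_sequentially by blast
      then have "star_gauge \<kappa> ((1 + inverse (real (Suc n))) *\<^sub>R x) \<le> t"
        using interior_subset by blast
      then have le: "(1 + inverse (real (Suc n))) * star_gauge \<kappa> x \<le> t"
        by (subst (asm) gauge_scaleR) auto
      have "star_gauge \<kappa> x \<noteq> t"
        using le assms by (auto simp: distrib_right mult_le_0_iff)
      moreover have "star_gauge \<kappa> x \<le> t"
        using x interior_subset by blast
      ultimately show "x \<in> {x. star_gauge \<kappa> x < t}" by auto
    qed
  qed
  then show ?thesis
    using closed_gauge_le[of \<kappa> t] by (auto simp: frontier_def closure_closed)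
qed

section \<open>The pyramids and the star body\<close>

definition pyr :: "real \<Rightarrow> (real^3) set" where
  "pyr \<kappa> = convex hull (insert (\<kappa> *\<^sub>R c) F)"

text \<open>The symmetry that moves the base point into the chamber is taken in the stabiliser of
  \<open>c\<close>, so it fixes the apex as well. The gauge becomes u + t (\<gamma> / \<kappa> +
  \<alpha> + \<beta>) with \<alpha> + \<beta> + \<gamma> = 1, and the comparison with 1 is that of
  \<gamma> / \<kappa> with \<gamma>.\<close>

lemma pyr_gauge:
  assumes "0 < \<kappa>" "x \<in> pyr \<kappa>"
  shows "1 \<le> \<kappa> \<Longrightarrow> star_gauge \<kappa> x \<le> 1" "\<kappa> \<le> 1 \<Longrightarrow> 1 \<le> star_gauge \<kappa> x"
proof -
  obtain u t y where ut: "0 \<le> u" "0 \<le> t" "u + t = 1" and y: "y \<in> F" and x: "x = u *\<^sub>R (\<kappa> *\<^sub>R c) + t *\<^sub>R y"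
  proof -
    have "convex hull F = F" "F \<noteq> {}"
      using convex_F v_in_F by (auto simp: hull_same)
    then show ?thesis
      using assms(2) that convex_hull_insert[of F "\<kappa> *\<^sub>R c"] unfolding pyr_def by auto
  qed
  obtain g \<alpha> \<beta> \<gamma> where g: "g \<in> G" "g c = c" "0 \<le> \<alpha>" "0 \<le> \<beta>" "0 \<le> \<gamma>" "\<alpha> + \<beta> + \<gamma> = 1"
    "g y = \<alpha> *\<^sub>R v + \<beta> *\<^sub>R m + \<gamma> *\<^sub>R c"
    using F_to_chamber[OF y] by blast
  have "g x = (u * \<kappa>) *\<^sub>R g c + t *\<^sub>R g y"
    using G_linear[OF g(1)] by (simp add: x linear_add linear_scale)
  also have "\<dots> = (u * \<kappa> + t * \<gamma>) *\<^sub>R c + (t * (\<alpha> + \<beta>/2)) *\<^sub>R v + (t * (\<beta>/2)) *\<^sub>R w"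
    unfolding g(2) g(7) v_m_eq_v_w by (simp add: algebra_simps)
  finally have "star_gauge \<kappa> (g x) = (u * \<kappa> + t * \<gamma>) / \<kappa> + t * (\<alpha> + \<beta>/2) + t * (\<beta>/2)"
    using g ut assms by (intro gauge_sector) auto
  also have "\<dots> = u + t * (\<gamma> / \<kappa> + (\<alpha> + \<beta>))"
    using assms by (simp add: add_divide_distrib algebra_simps)
  finally have eq: "star_gauge \<kappa> x = u + t * (\<gamma> / \<kappa> + (\<alpha> + \<beta>))"
    using gauge_invariant g by simp
  show "star_gauge \<kappa> x \<le> 1" if "1 \<le> \<kappa>"
  proof -
    have "\<gamma> / \<kappa> \<le> \<gamma>"
      using that g by (simp add: divide_le_eq mult_le_cancel_left1)
    then have "t * (\<gamma> / \<kappa> + (\<alpha> + \<beta>)) \<le> t * 1"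
      using g ut by (intro mult_left_mono) auto
    then show ?thesis
      using eq ut by simp
  qed
  show "1 \<le> star_gauge \<kappa> x" if "\<kappa> \<le> 1"
  proof -
    have "\<gamma> \<le> \<gamma> / \<kappa>"
      using that g assms by (simp add: le_divide_eq mult_left_le)
    then have "t * 1 \<le> t * (\<gamma> / \<kappa> + (\<alpha> + \<beta>))"
      using g ut by (intro mult_left_mono) auto
    then show ?thesis
      using eq ut by simp
  qed
qed

text \<open>\<mu> is the weight of the apex. The weights of apex, face centre, \<open>v\<close> and
  \<open>w\<close> are to add up to 1, so the face centre receives 1 - \<beta> - \<gamma> -
  \<mu>.\<close>

lemma sector_in_pyr:
  assumes nn: "0 \<le> \<beta>" "0 \<le> \<gamma>" and x: "x = \<alpha> *\<^sub>R c + \<beta> *\<^sub>R v + \<gamma> *\<^sub>R w"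
    and \<mu>: "0 \<le> \<mu>" "\<mu> \<le> 1 - \<beta> - \<gamma>" "\<alpha> = \<mu> * \<kappa> + (1 - \<beta> - \<gamma> - \<mu>)"
  shows "x \<in> pyr \<kappa>"
proof -
  have "x = \<mu> *\<^sub>R (\<kappa> *\<^sub>R c) + (1 - \<beta> - \<gamma> - \<mu>) *\<^sub>R c + \<beta> *\<^sub>R v + \<gamma> *\<^sub>R w"
    unfolding x \<mu>(3) by (simp add: scaleR_add_left)
  also have "\<dots> \<in> pyr \<kappa>"
    using assms c_in_F v_in_F w_in_F unfolding pyr_def
    by (intro convex_combination4) (auto simp: hull_inc)
  finally show ?thesis .
qed

lemma sector_in_B:
  assumes nn: "0 \<le> \<alpha>" "0 \<le> \<beta>" "0 \<le> \<gamma>" and x: "x = \<alpha> *\<^sub>R c + \<beta> *\<^sub>R v + \<gamma> *\<^sub>R w"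
  shows "x \<in> B \<longleftrightarrow> \<alpha> + \<beta> + \<gamma> \<le> 1"
proof
  assume "x \<in> B"
  then have "(\<alpha> + \<beta> + \<gamma>) * (c \<bullet> c) \<le> c \<bullet> c"
    using B_support_c[of x] unfolding x
    by (simp add: inner_simps c_w cc_eq_cv[symmetric] algebra_simps)
  then show "\<alpha> + \<beta> + \<gamma> \<le> 1"
    using c_pos by simp
next
  assume "\<alpha> + \<beta> + \<gamma> \<le> 1"
  then show "x \<in> B"
    using convex_combination4[OF convex_B zero_in_B c_in_B v_in_B w_in_B, of "1 - (\<alpha>+\<beta>+\<gamma>)" \<alpha> \<beta> \<gamma>] nn x
    by simp
qed

lemma G_mem_B: "g \<in> G \<Longrightarrow> g x \<in> B \<longleftrightarrow> x \<in> B"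
  using G_B G_inj by (metis inj_image_mem_iff)

lemma star_build:
  assumes "1 < \<kappa>"
  shows "B \<union> (\<Union>g\<in>G. g ` pyr \<kappa>) = {x. star_gauge \<kappa> x \<le> 1}"
proof (intro equalityI subsetI)
  fix x assume "x \<in> B \<union> (\<Union>g\<in>G. g ` pyr \<kappa>)"
  then consider "x \<in> B" | g y where "g \<in> G" "x = g y" "y \<in> pyr \<kappa>"
    by blast
  then show "x \<in> {x. star_gauge \<kappa> x \<le> 1}"
  proof cases
    case 1
    obtain g \<alpha> \<beta> \<gamma> where g: "g \<in> G" "0 \<le> \<alpha>" "0 \<le> \<beta>" "0 \<le> \<gamma>"
      "g x = \<alpha> *\<^sub>R c + \<beta> *\<^sub>R v + \<gamma> *\<^sub>R w"
      using to_sector by blast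
    have "\<alpha> + \<beta> + \<gamma> \<le> 1"
      using sector_in_B[OF g(2-5)] 1 G_mem_B g by blast
    moreover have "\<alpha> / \<kappa> \<le> \<alpha>"
      using assms g by (simp add: divide_le_eq mult_le_cancel_left1)
    ultimately show ?thesis
      using gauge_sector[OF g(2-5), of \<kappa>] gauge_invariant[OF g(1)] by simp
  next
    case 2
    then show ?thesis
      using pyr_gauge(1)[of \<kappa> y] assms gauge_invariant by simp
  qed
next
  fix x assume "x \<in> {x. star_gauge \<kappa> x \<le> 1}"
  then have x: "star_gauge \<kappa> x \<le> 1" by simp
  obtain g \<alpha> \<beta> \<gamma> where g: "g \<in> G" "0 \<le> \<alpha>" "0 \<le> \<beta>" "0 \<le> \<gamma>"
    "g x = \<alpha> *\<^sub>R c + \<beta> *\<^sub>R v + \<gamma> *\<^sub>R w"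
    using to_sector by blast
  have le: "\<alpha> / \<kappa> + \<beta> + \<gamma> \<le> 1"
    using x gauge_sector[OF g(2-5), of \<kappa>] gauge_invariant[OF g(1)] by simp
  show "x \<in> B \<union> (\<Union>g\<in>G. g ` pyr \<kappa>)"
  proof (cases "\<alpha> + \<beta> + \<gamma> \<le> 1")
    case True
    then show ?thesis
      using sector_in_B[OF g(2-5)] G_mem_B g by blast
  next
    case False
    \<comment> \<open>The solution of \<alpha> = \<mu> \<kappa> + (1 - \<beta> - \<gamma> - \<mu>).
      Being outside the body makes it nonnegative, and gauge at most 1 makes it at most 1 - \<beta>
      - \<gamma>.\<close>
    define \<mu> where "\<mu> = (\<alpha> - (1 - \<beta> - \<gamma>)) / (\<kappa> - 1)"
    have \<mu>\<kappa>: "\<mu> * (\<kappa> - 1) = \<alpha> - (1 - \<beta> - \<gamma>)"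
      using assms by (simp add: \<mu>_def)
    have "\<alpha> / \<kappa> \<le> 1 - \<beta> - \<gamma>"
      using le by simp
    then have "\<alpha> \<le> (1 - \<beta> - \<gamma>) * \<kappa>"
      using assms by (simp add: divide_le_eq)
    then have "\<mu> * (\<kappa> - 1) \<le> (1 - \<beta> - \<gamma>) * (\<kappa> - 1)"
      unfolding \<mu>\<kappa> by (simp add: right_diff_distrib)
    then have "\<mu> \<le> 1 - \<beta> - \<gamma>"
      using assms by simp
    moreover have "0 \<le> \<mu>"
      using False assms by (simp add: \<mu>_def)
    ultimately have "g x \<in> pyr \<kappa>"
      using sector_in_pyr[OF g(3,4,5), of \<mu> \<kappa>] \<mu>\<kappa> by (simp add: algebra_simps)
    then have "x \<in> inv g ` pyr \<kappa>"
      using g by (metis G_inv_f(1) image_eqI)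
    then show ?thesis
      using g G_inv by blast
  qed
qed

text \<open>The removed pyramids include their boundaries, so the difference is not closed. It is
  squeezed between the points of gauge less than 1 and those of gauge at most 1, and the former set
  has the latter as its closure.\<close>

lemma star_excavate:
  assumes "0 < \<kappa>" "\<kappa> < 1"
  shows "closure (B - (\<Union>g\<in>G. g ` pyr \<kappa>)) = {x. star_gauge \<kappa> x \<le> 1}"
proof
  let ?X = "B - (\<Union>g\<in>G. g ` pyr \<kappa>)"
  have "star_gauge \<kappa> x \<le> 1" if "x \<in> ?X" for x
  proof (rule ccontr)
    assume x: "\<not> star_gauge \<kappa> x \<le> 1"
    obtain g \<alpha> \<beta> \<gamma> where g: "g \<in> G" "0 \<le> \<alpha>" "0 \<le> \<beta>" "0 \<le> \<gamma>"
      "g x = \<alpha> *\<^sub>R c + \<beta> *\<^sub>R v + \<gamma> *\<^sub>R w"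
      using to_sector by blast
    have gt: "1 < \<alpha> / \<kappa> + \<beta> + \<gamma>"
      using x gauge_sector[OF g(2-5), of \<kappa>] gauge_invariant[OF g(1)] by simp
    have le: "\<alpha> + \<beta> + \<gamma> \<le> 1"
      using that sector_in_B[OF g(2-5)] G_mem_B g by blast
    \<comment> \<open>The same weight of the apex as for built pyramids, with both signs changed
      because now \<kappa> < 1. Here membership in the body gives nonnegativity, and gauge above 1
      gives the upper bound.\<close>
    define \<mu> where "\<mu> = (1 - \<beta> - \<gamma> - \<alpha>) / (1 - \<kappa>)"
    have \<mu>\<kappa>: "\<mu> * (1 - \<kappa>) = 1 - \<beta> - \<gamma> - \<alpha>"
      using assms by (simp add: \<mu>_def)
    have "1 - \<beta> - \<gamma> \<le> \<alpha> / \<kappa>"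
      using gt by simp
    then have "(1 - \<beta> - \<gamma>) * \<kappa> \<le> \<alpha>"
      using assms by (simp add: le_divide_eq)
    then have "\<mu> * (1 - \<kappa>) \<le> (1 - \<beta> - \<gamma>) * (1 - \<kappa>)"
      unfolding \<mu>\<kappa> by (simp add: right_diff_distrib)
    then have "\<mu> \<le> 1 - \<beta> - \<gamma>"
      using assms by simp
    moreover have "0 \<le> \<mu>"
      using le assms by (simp add: \<mu>_def)
    ultimately have "g x \<in> pyr \<kappa>"
      using sector_in_pyr[OF g(3,4,5), of \<mu> \<kappa>] \<mu>\<kappa> by (simp add: algebra_simps)
    then have "x \<in> inv g ` pyr \<kappa>"
      using g by (metis G_inv_f(1) image_eqI)
    then show False
      using that g G_inv by blast
  qed
  then show "closure ?X \<subseteq> {x. star_gauge \<kappa> x \<le> 1}"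
    by (intro closure_minimal closed_gauge_le) auto
  have "x \<in> ?X" if "star_gauge \<kappa> x < 1" for x
  proof -
    obtain g \<alpha> \<beta> \<gamma> where g: "g \<in> G" "0 \<le> \<alpha>" "0 \<le> \<beta>" "0 \<le> \<gamma>"
      "g x = \<alpha> *\<^sub>R c + \<beta> *\<^sub>R v + \<gamma> *\<^sub>R w"
      using to_sector by blast
    have "\<alpha> / \<kappa> + \<beta> + \<gamma> < 1"
      using that gauge_sector[OF g(2-5), of \<kappa>] gauge_invariant[OF g(1)] by simp
    moreover have "\<alpha> \<le> \<alpha> / \<kappa>"
      using assms g by (simp add: le_divide_eq mult_left_le)
    ultimately have "\<alpha> + \<beta> + \<gamma> \<le> 1"
      by linarith
    then have "x \<in> B"
      using sector_in_B[OF g(2-5)] G_mem_B g by blast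
    moreover have "x \<notin> g ` pyr \<kappa>" if "g \<in> G" for g
      using pyr_gauge(2)[of \<kappa>] assms gauge_invariant[OF that, of \<kappa>] \<open>star_gauge \<kappa> x < 1\<close> by fastforce
    ultimately show ?thesis by blast
  qed
  then have "closure {x. star_gauge \<kappa> x < 1} \<subseteq> closure ?X"
    by (intro closure_mono) auto
  then show "{x. star_gauge \<kappa> x \<le> 1} \<subseteq> closure ?X"
    by (simp add: closure_gauge_less)
qed

section \<open>Tiling by tetrahedra and their outer triangles\<close>

definition tet :: "real \<Rightarrow> (real^3) set" where
  "tet \<kappa> = convex hull {0, \<kappa> *\<^sub>R c, v, w}"

definition tri :: "real \<Rightarrow> real \<Rightarrow> (real^3) set" where
  "tri \<kappa> t = convex hull {t *\<^sub>R (\<kappa> *\<^sub>R c), t *\<^sub>R v, t *\<^sub>R w}"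

lemma gauge_le_eq_Union_tet:
  assumes "0 < \<kappa>"
  shows "{x. star_gauge \<kappa> x \<le> 1} = (\<Union>g\<in>G. g ` tet \<kappa>)"
proof (intro equalityI subsetI)
  fix x assume "x \<in> {x. star_gauge \<kappa> x \<le> 1}"
  then have x: "star_gauge \<kappa> x \<le> 1" by simp
  obtain g \<alpha> \<beta> \<gamma> where g: "g \<in> G" "0 \<le> \<alpha>" "0 \<le> \<beta>" "0 \<le> \<gamma>"
    "g x = \<alpha> *\<^sub>R c + \<beta> *\<^sub>R v + \<gamma> *\<^sub>R w"
    using to_sector by blast
  have "\<alpha> / \<kappa> + \<beta> + \<gamma> \<le> 1"
    using x gauge_sector[OF g(2-5), of \<kappa>] gauge_invariant[OF g(1)] by simp
  then have "g x \<in> tet \<kappa>"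
    unfolding tet_def convex_hull_zero_3 using g assms
    by (intro CollectI exI[of _ "\<alpha>/\<kappa>"] exI[of _ \<beta>] exI[of _ \<gamma>]) auto
  then have "x \<in> inv g ` tet \<kappa>"
    using g by (metis G_inv_f(1) image_eqI)
  then show "x \<in> (\<Union>g\<in>G. g ` tet \<kappa>)"
    using g G_inv by blast
next
  fix x assume "x \<in> (\<Union>g\<in>G. g ` tet \<kappa>)"
  then obtain g y where "g \<in> G" "x = g y" "y \<in> tet \<kappa>" by blast
  then show "x \<in> {x. star_gauge \<kappa> x \<le> 1}"
    unfolding tet_def convex_hull_zero_3 using gauge_apex_sector[OF assms] gauge_invariant by auto
qed

lemma gauge_eq_eq_Union_tri:
  assumes "0 < \<kappa>" "0 < t"
  shows "{x. star_gauge \<kappa> x = t} = (\<Union>g\<in>G. g ` tri \<kappa> t)"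
proof (intro equalityI subsetI)
  fix x assume "x \<in> {x. star_gauge \<kappa> x = t}"
  then have x: "star_gauge \<kappa> x = t" by simp
  obtain g \<alpha> \<beta> \<gamma> where g: "g \<in> G" "0 \<le> \<alpha>" "0 \<le> \<beta>" "0 \<le> \<gamma>"
    "g x = \<alpha> *\<^sub>R c + \<beta> *\<^sub>R v + \<gamma> *\<^sub>R w"
    using to_sector by blast
  have "\<alpha> / \<kappa> + \<beta> + \<gamma> = t"
    using x gauge_sector[OF g(2-5), of \<kappa>] gauge_invariant[OF g(1)] by simp
  then have "(\<alpha> / \<kappa>) / t + \<beta> / t + \<gamma> / t = 1"
    using assms(2) by (simp add: add_divide_distrib[symmetric] del: divide_divide_eq_left)
  then have "g x \<in> tri \<kappa> t"
    unfolding tri_def convex_hull_3 using g assms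
    by (intro CollectI exI[of _ "\<alpha>/\<kappa>/t"] exI[of _ "\<beta>/t"] exI[of _ "\<gamma>/t"]) auto
  then have "x \<in> inv g ` tri \<kappa> t"
    using g by (metis G_inv_f(1) image_eqI)
  then show "x \<in> (\<Union>g\<in>G. g ` tri \<kappa> t)"
    using g G_inv by blast
next
  fix x assume "x \<in> (\<Union>g\<in>G. g ` tri \<kappa> t)"
  then obtain g y where g: "g \<in> G" "x = g y" "y \<in> tri \<kappa> t" by blast
  then obtain \<alpha> \<beta> \<gamma> where nn: "0 \<le> \<alpha>" "0 \<le> \<beta>" "0 \<le> \<gamma>" "\<alpha> + \<beta> + \<gamma> = 1"
    and y: "y = (\<alpha>*t) *\<^sub>R (\<kappa> *\<^sub>R c) + (\<beta>*t) *\<^sub>R v + (\<gamma>*t) *\<^sub>R w"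
    unfolding tri_def convex_hull_3 by auto
  have "star_gauge \<kappa> y = \<alpha>*t + \<beta>*t + \<gamma>*t"
    unfolding y using nn assms by (intro gauge_apex_sector) auto
  also have "\<dots> = t"
    using nn by (metis distrib_right mult_1)
  finally show "x \<in> {x. star_gauge \<kappa> x = t}"
    using g gauge_invariant by simp
qed

text \<open>Two invariant functions show that the point has the same total weight and the same
  weight of the face centre in both descriptions. Scaled into \<open>F\<close>, it is a combination
  of \<open>g c\<close>, \<open>g v\<close>, \<open>g w\<close> in which \<open>g c\<close> has
  positive weight, so \<open>g c\<close> lies in \<open>F\<close>; two vectors of equal length on
  the plane orthogonal to \<open>c\<close> through \<open>c\<close> then leave only g c = c. After
  removing the multiple of \<open>c\<close>, a relative interior point of the edge lies on its
  image, and the two edges coincide.\<close>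

lemma sector_overlap:
  assumes g: "g \<in> G" and pos: "0 < \<alpha>" "0 < \<beta>" "0 < \<gamma>" and nn: "0 \<le> \<alpha>'" "0 \<le> \<beta>'" "0 \<le> \<gamma>'"
    and eq: "\<alpha> *\<^sub>R c + \<beta> *\<^sub>R v + \<gamma> *\<^sub>R w = g (\<alpha>' *\<^sub>R c + \<beta>' *\<^sub>R v + \<gamma>' *\<^sub>R w)"
  shows "g c = c" "g ` {v, w} = {v, w}"
proof -
  let ?x = "\<alpha> *\<^sub>R c + \<beta> *\<^sub>R v + \<gamma> *\<^sub>R w" and ?y = "\<alpha>' *\<^sub>R c + \<beta>' *\<^sub>R v + \<gamma>' *\<^sub>R w"
  have "(\<alpha> + \<beta> + \<gamma>) * (c \<bullet> c) = (\<alpha>' + \<beta>' + \<gamma>') * (c \<bullet> c)"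
    using orbit_max_sector(1)[of \<alpha> \<beta> \<gamma> ?x] orbit_max_sector(1)[of \<alpha>' \<beta>' \<gamma>' ?y] pos nn eq
      orbit_max_invariant[OF g, of c ?y] by auto
  then have sum: "\<alpha> + \<beta> + \<gamma> = \<alpha>' + \<beta>' + \<gamma>'"
    using c_pos by simp
  \<comment> \<open>For \<kappa> = 2 the gauge counts the weight of \<open>c\<close> by half and
    those of \<open>v\<close> and \<open>w\<close> fully, so together with the total weight it
    determines \<alpha>.\<close>
  have "star_gauge 2 ?x = \<alpha>/2 + \<beta> + \<gamma>" "star_gauge 2 ?y = \<alpha>'/2 + \<beta>' + \<gamma>'"
    using pos nn by (auto intro!: gauge_sector)
  then have \<alpha>: "\<alpha> = \<alpha>'"
    using sum eq gauge_invariant[OF g, of 2 ?y] by simp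
  define S where "S = \<alpha> + \<beta> + \<gamma>"
  have S: "0 < S" using pos by (simp add: S_def)
  have geq: "g ?y = \<alpha>' *\<^sub>R g c + \<beta>' *\<^sub>R g v + \<gamma>' *\<^sub>R g w"
    using G_linear[OF g] by (simp add: linear_add linear_scale)
  have "(\<alpha>/S) *\<^sub>R c + (\<beta>/S) *\<^sub>R v + (\<gamma>/S) *\<^sub>R w \<in> F"
    using hull_minimal[of "{c,v,w}" F convex] convex_F c_in_F v_in_F w_in_F pos S
    unfolding convex_hull_3 by (force simp: S_def add_divide_distrib[symmetric])
  moreover have "(\<alpha>/S) *\<^sub>R c + (\<beta>/S) *\<^sub>R v + (\<gamma>/S) *\<^sub>R w = (1/S) *\<^sub>R ?x"
    by (simp add: scaleR_add_right)
  moreover have "(1/S) *\<^sub>R ?x = (\<alpha>'/S) *\<^sub>R g c + (\<beta>'/S) *\<^sub>R g v + (\<gamma>'/S) *\<^sub>R g w"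
    unfolding eq geq by (simp add: scaleR_add_right)
  ultimately have inF: "(\<alpha>'/S) *\<^sub>R g c + (\<beta>'/S) *\<^sub>R g v + (\<gamma>'/S) *\<^sub>R g w \<in> F"
    by simp
  have "\<alpha>'/S + \<beta>'/S + \<gamma>'/S = 1"
    using S sum by (simp add: S_def add_divide_distrib[symmetric])
  then have "g c \<in> F"
    using face_of_convex_combination4[OF F_face convex_B, of "g c" "g v" "g w" 0 "\<alpha>'/S" "\<beta>'/S" "\<gamma>'/S" 0]
      inF G_in_B[OF g] c_in_B v_in_B w_in_B zero_in_B S pos nn \<alpha> by auto
  then have "c \<bullet> g c = c \<bullet> c"
    by (simp add: F_def)
  then have "(g c - c) \<bullet> (g c - c) = 0"
    using G_inner[OF g] by (simp add: inner_simps inner_commute)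
  then show gc: "g c = c" by simp
  define e where "e = \<beta> + \<gamma>"
  have e: "0 < e" "e = \<beta>' + \<gamma>'"
    using pos \<alpha> sum by (auto simp: e_def)
  have "\<beta> *\<^sub>R v + \<gamma> *\<^sub>R w = \<beta>' *\<^sub>R g v + \<gamma>' *\<^sub>R g w"
    using eq unfolding geq gc \<alpha> by (simp add: add.assoc)
  then have "(1/e) *\<^sub>R (\<beta> *\<^sub>R v + \<gamma> *\<^sub>R w) = (1/e) *\<^sub>R (\<beta>' *\<^sub>R g v + \<gamma>' *\<^sub>R g w)"
    by simp
  then have eq2: "(\<beta>/e) *\<^sub>R v + (\<gamma>/e) *\<^sub>R w = (\<beta>'/e) *\<^sub>R g v + (\<gamma>'/e) *\<^sub>R g w"
    by (simp add: scaleR_add_right)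
  have b: "\<beta>/e = 1 - \<gamma>/e" "\<beta>'/e = 1 - \<gamma>'/e"
    using e by (auto simp: e_def field_simps)
  have "(\<beta>/e) *\<^sub>R v + (\<gamma>/e) *\<^sub>R w \<in> open_segment v w"
    unfolding in_segment b using v_neq_w e pos by (intro conjI exI[of _ "\<gamma>/e"]) (auto simp: e_def)
  then have ri: "(\<beta>/e) *\<^sub>R v + (\<gamma>/e) *\<^sub>R w \<in> rel_interior (closed_segment v w)"
    using v_neq_w by (simp add: rel_interior_closed_segment)
  have seg: "g ` closed_segment v w = closed_segment (g v) (g w)"
    using closed_segment_linear_image[OF G_linear[OF g]] by simp
  have "(\<beta>'/e) *\<^sub>R g v + (\<gamma>'/e) *\<^sub>R g w \<in> closed_segment (g v) (g w)"
    unfolding in_segment b using e nn by (intro exI[of _ "\<gamma>'/e"]) auto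
  then have inter: "g ` closed_segment v w \<inter> rel_interior (closed_segment v w) \<noteq> {}"
    using ri eq2 seg by auto
  have gE: "g ` closed_segment v w face_of B" "aff_dim (g ` closed_segment v w) = 1"
    using E_face aff_dim_E g by (simp_all add: G_face G_aff_dim)
  have "closed_segment v w \<subseteq> g ` closed_segment v w"
    using subset_of_face_of[OF gE(1) face_of_imp_subset[OF E_face]] inter by blast
  then have "closed_segment v w = g ` closed_segment v w"
    using face_eq[OF E_face gE(1)] gE(2) aff_dim_E by simp
  then have "{g v, g w} = {v, w}"
    unfolding seg by auto
  then show "g ` {v, w} = {v, w}" by (simp only: image_insert image_empty)
qed

lemma independent_cvw:
  assumes "0 < \<kappa>"
  shows "independent {\<kappa> *\<^sub>R c, v, w}" "card {\<kappa> *\<^sub>R c, v, w} = 3"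
proof -
  have 1: "x = 0 \<and> y = 0 \<and> z = 0" if "x *\<^sub>R \<kappa> *\<^sub>R c + y *\<^sub>R v + z *\<^sub>R w = 0" for x y z
  proof -
    have "x *\<^sub>R \<kappa> *\<^sub>R c + y *\<^sub>R v + z *\<^sub>R w = (y - z) *\<^sub>R v + (2*z) *\<^sub>R m + (x * \<kappa>) *\<^sub>R c"
      by (simp add: w_def algebra_simps)
    then have "(y - z) *\<^sub>R v + (2*z) *\<^sub>R m + (x * \<kappa>) *\<^sub>R c = 0 *\<^sub>R v + 0 *\<^sub>R m + 0 *\<^sub>R c"
      unfolding that by simp
    from coords_unique[OF this] show ?thesis
      using assms by auto
  qed
  have ne: "\<kappa> *\<^sub>R c \<noteq> v" "\<kappa> *\<^sub>R c \<noteq> w" "v \<noteq> w"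
    using 1[of 1 "-1" 0] 1[of 1 0 "-1"] v_neq_w by auto
  show "card {\<kappa> *\<^sub>R c, v, w} = 3"
    using ne by simp
  show "independent {\<kappa> *\<^sub>R c, v, w}"
  proof
    assume "dependent {\<kappa> *\<^sub>R c, v, w}"
    then obtain u where "\<exists>x\<in>{\<kappa> *\<^sub>R c, v, w}. u x \<noteq> 0" "(\<Sum>x\<in>{\<kappa> *\<^sub>R c, v, w}. u x *\<^sub>R x) = 0"
      using dependent_finite[of "{\<kappa> *\<^sub>R c, v, w}"] by auto
    then show False
      using 1[of "u (\<kappa> *\<^sub>R c)" "u v" "u w"] ne by (auto simp: add.assoc)
  qed
qed

lemma rel_interior_tet:
  assumes "0 < \<kappa>" "x \<in> rel_interior (tet \<kappa>)"
  obtains \<alpha> \<beta> \<gamma> where "0 < \<alpha>" "0 < \<beta>" "0 < \<gamma>" "x = \<alpha> *\<^sub>R c + \<beta> *\<^sub>R v + \<gamma> *\<^sub>R w"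
proof -
  have ne: "0 \<notin> {\<kappa> *\<^sub>R c, v, w}"
    using independent_cvw(1)[OF assms(1)] dependent_zero[of "{\<kappa> *\<^sub>R c, v, w}"] by meson
  then have nd: "\<not> affine_dependent {0, \<kappa> *\<^sub>R c, v, w}"
    using affine_dependent_iff_dependent[OF ne] independent_cvw(1)[OF assms(1)] by simp
  then obtain u where u: "\<forall>x\<in>{0, \<kappa> *\<^sub>R c, v, w}. 0 < u x"
    and x: "(\<Sum>x\<in>{0, \<kappa> *\<^sub>R c, v, w}. u x *\<^sub>R x) = x"
    using assms(2) unfolding tet_def rel_interior_convex_hull_explicit[OF nd] by blast
  have "\<kappa> *\<^sub>R c \<noteq> v" "\<kappa> *\<^sub>R c \<noteq> w" "v \<noteq> w"
    using independent_cvw(2)[OF assms(1)] by (auto simp: card_insert_if split: if_splits)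
  then have "x = (u (\<kappa> *\<^sub>R c) * \<kappa>) *\<^sub>R c + u v *\<^sub>R v + u w *\<^sub>R w"
    using x ne by (auto simp: add.assoc)
  then show ?thesis
    using that[of "u (\<kappa> *\<^sub>R c) * \<kappa>" "u v" "u w"] u assms(1) by auto
qed

text \<open>The element \<open>g\<close> may differ from the identity: the reflection in
  \<open>a0\<close> exchanges \<open>v\<close> and \<open>w\<close> and preserves the tetrahedron.
  Hence two images either coincide or do not overlap.\<close>

lemma tet_overlap:
  assumes "0 < \<kappa>" "g \<in> G" "x \<in> rel_interior (tet \<kappa>)" "x \<in> g ` tet \<kappa>"
  shows "g ` tet \<kappa> = tet \<kappa>"
proof -
  obtain \<alpha> \<beta> \<gamma> where 1: "0 < \<alpha>" "0 < \<beta>" "0 < \<gamma>" "x = \<alpha> *\<^sub>R c + \<beta> *\<^sub>R v + \<gamma> *\<^sub>R w"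
    using rel_interior_tet assms by blast
  obtain \<alpha>' \<beta>' \<gamma>' where 2: "0 \<le> \<alpha>'" "0 \<le> \<beta>'" "0 \<le> \<gamma>'" "x = g (\<alpha>' *\<^sub>R \<kappa> *\<^sub>R c + \<beta>' *\<^sub>R v + \<gamma>' *\<^sub>R w)"
    using assms(4) unfolding tet_def convex_hull_zero_3 by auto
  have "g c = c" "g ` {v,w} = {v,w}"
    using sector_overlap[OF assms(2) 1(1-3), of "\<alpha>' * \<kappa>" \<beta>' \<gamma>'] 1 2 assms(1) by auto
  moreover have "g ` tet \<kappa> = convex hull (g ` {0, \<kappa> *\<^sub>R c, v, w})"
    unfolding tet_def using convex_hull_linear_image G_linear assms(2) by metis
  ultimately show ?thesis
    using G_linear[OF assms(2)] by (simp add: tet_def linear_0 linear_scale)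
qed

lemma tri_overlap:
  assumes "0 < \<kappa>" "0 < t" "g \<in> G" "x \<in> rel_interior (tri \<kappa> t)" "x \<in> g ` tri \<kappa> t"
  shows "g ` tri \<kappa> t = tri \<kappa> t"
proof -
  have ind: "independent ((\<lambda>x. t *\<^sub>R x) ` {\<kappa> *\<^sub>R c, v, w})"
    using independent_cvw(1)[OF assms(1)] assms(2)
    by (intro linear_independent_injective_image linear_scaleR inj_onI) auto
  then have nd: "\<not> affine_dependent {t *\<^sub>R \<kappa> *\<^sub>R c, t *\<^sub>R v, t *\<^sub>R w}"
    using affine_dependent_imp_dependent by (metis (no_types) image_empty image_insert)
  then obtain u where u: "\<forall>x\<in>{t *\<^sub>R \<kappa> *\<^sub>R c, t *\<^sub>R v, t *\<^sub>R w}. 0 < u x"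
    and x: "(\<Sum>x\<in>{t *\<^sub>R \<kappa> *\<^sub>R c, t *\<^sub>R v, t *\<^sub>R w}. u x *\<^sub>R x) = x"
    using assms(4) unfolding tri_def rel_interior_convex_hull_explicit[OF nd] by blast
  have "\<kappa> *\<^sub>R c \<noteq> v" "\<kappa> *\<^sub>R c \<noteq> w" "v \<noteq> w"
    using independent_cvw(2)[OF assms(1)] by (auto simp: card_insert_if split: if_splits)
  then have "t *\<^sub>R \<kappa> *\<^sub>R c \<noteq> t *\<^sub>R v" "t *\<^sub>R \<kappa> *\<^sub>R c \<noteq> t *\<^sub>R w" "t *\<^sub>R v \<noteq> t *\<^sub>R w"
    using assms(2) scaleR_cancel_left[of t] by (simp_all del: scaleR_scaleR)
  then have 1: "x = (u (t *\<^sub>R \<kappa> *\<^sub>R c) * t * \<kappa>) *\<^sub>R c + (u (t *\<^sub>R v) * t) *\<^sub>R v + (u (t *\<^sub>R w) * t) *\<^sub>R w"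
    using x by (auto simp: add.assoc mult.assoc)
  obtain \<alpha> \<beta> \<gamma> where 2: "0 \<le> \<alpha>" "0 \<le> \<beta>" "0 \<le> \<gamma>"
    "x = g (\<alpha> *\<^sub>R t *\<^sub>R \<kappa> *\<^sub>R c + \<beta> *\<^sub>R t *\<^sub>R v + \<gamma> *\<^sub>R t *\<^sub>R w)"
    using assms(5) unfolding tri_def convex_hull_3 by auto
  have "g c = c" "g ` {v,w} = {v,w}"
    using sector_overlap[OF assms(3), of "u (t *\<^sub>R \<kappa> *\<^sub>R c) * t * \<kappa>" "u (t *\<^sub>R v) * t" "u (t *\<^sub>R w) * t"
      "\<alpha> * t * \<kappa>" "\<beta> * t" "\<gamma> * t"] 1 2 u assms(1,2) by (auto simp: mult.assoc)
  moreover have "g ` tri \<kappa> t = convex hull (g ` {t *\<^sub>R \<kappa> *\<^sub>R c, t *\<^sub>R v, t *\<^sub>R w})"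
    unfolding tri_def using convex_hull_linear_image G_linear assms(3) by metis
  moreover have "g ` {t *\<^sub>R \<kappa> *\<^sub>R c, t *\<^sub>R v, t *\<^sub>R w} = (\<lambda>x. t *\<^sub>R x) ` insert (\<kappa> *\<^sub>R g c) (g ` {v, w})"
    using G_linear[OF assms(3)] by (simp add: linear_scale)
  ultimately show ?thesis
    by (simp add: tri_def)
qed

end

subsection \<open>The five Platonic solids\<close>

lemma inner_vector3: "(vector [a, b, c] :: real^3) \<bullet> vector [x, y, z] = a * x + b * y + c * z"
  by (simp add: inner_vec_def sum_3)

lemma reflection_vector3:
  "reflection (vector [a, b, c]) (vector [x, y, z]) =
    vector [x - 2 * (x * a + y * b + z * c) / (a * a + b * b + c * c) * a,
      y - 2 * (x * a + y * b + z * c) / (a * a + b * b + c * c) * b,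
      z - 2 * (x * a + y * b + z * c) / (a * a + b * b + c * c) * c]"
  by (simp add: reflection_def inner_vector3 vec_eq_iff forall_3)

text \<open>A root of squared length 4 turns the reflection formula into polynomial equations free
  of division, which can be checked by rewriting even when the coordinates involve the golden
  ratio.\<close>

lemma reflection_vector3I:
  assumes "a * a + b * b + c * c = 4" "2 * (x - x') = (x * a + y * b + z * c) * a"
    "2 * (y - y') = (x * a + y * b + z * c) * b" "2 * (z - z') = (x * a + y * b + z * c) * c"
  shows "reflection (vector [a, b, c]) (vector [x, y, z]) = vector [x', y', z']"
proof -
  define s where "s = x * a + y * b + z * c"
  show ?thesis
    unfolding reflection_vector3 assms(1) s_def[symmetric] using assms(2-4)[folded s_def]
    by (simp add: vec_eq_iff forall_3)
qed

lemma pm1_image: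
  "{\<phi> a | a. a \<in> pm1} = {\<phi> 1, \<phi> (-1)}"
  "{\<phi>' a b | a b. a \<in> pm1 \<and> b \<in> pm1} = {\<phi>' 1 1, \<phi>' 1 (-1), \<phi>' (-1) 1, \<phi>' (-1) (-1)}"
  "{\<phi>'' a b c | a b c. a \<in> pm1 \<and> b \<in> pm1 \<and> c \<in> pm1} =
    {\<phi>'' 1 1 1, \<phi>'' 1 1 (-1), \<phi>'' 1 (-1) 1, \<phi>'' 1 (-1) (-1),
     \<phi>'' (-1) 1 1, \<phi>'' (-1) 1 (-1), \<phi>'' (-1) (-1) 1, \<phi>'' (-1) (-1) (-1)}"
  unfolding pm1_def by blast+

lemma reflection_similarity:
  assumes T: "orthogonal_transformation T"
  shows "reflection (T a) (r *\<^sub>R T x) = r *\<^sub>R T (reflection a x)"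
  using orthogonal_transformation_linear[OF T]
  by (simp add: reflection_def orthogonal_transformation_inner[OF T] linear_diff linear_scale scaleR_diff_right)

text \<open>The roots are only rotated, not scaled by r: a reflection depends on the direction of
  its root alone.\<close>

lemma regular_solid_similarity:
  assumes S: "regular_solid V v m c a0 a1 a2" and T: "orthogonal_transformation T" and r: "0 < r"
  shows "regular_solid ((\<lambda>x. r *\<^sub>R T x) ` V) (r *\<^sub>R T v) (r *\<^sub>R T m) (r *\<^sub>R T c) (T a0) (T a1) (T a2)"
proof -
  interpret regular_solid V v m c a0 a1 a2 by fact
  note Ti = orthogonal_transformation_inner[OF T] and Tl = orthogonal_transformation_linear[OF T]
  show ?thesis
  proof unfold_locales
    show "reflection a ` (\<lambda>x. r *\<^sub>R T x) ` V \<subseteq> (\<lambda>x. r *\<^sub>R T x) ` V" if "a \<in> {T a0, T a1, T a2}" for a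
      using that refl_V reflection_similarity[OF T] by (fastforce simp: image_subset_iff)
    show "reflection (T a0) (r *\<^sub>R T v) = 2 *\<^sub>R r *\<^sub>R T m - r *\<^sub>R T v"
      using refl_v reflection_similarity[OF T] Tl by (simp add: linear_diff linear_scale scaleR_diff_right mult.commute)
    show "r *\<^sub>R T c \<bullet> p \<le> r *\<^sub>R T c \<bullet> r *\<^sub>R T v" if "p \<in> (\<lambda>x. r *\<^sub>R T x) ` V" for p
      using that c_support r by (auto simp: Ti)
    show "r *\<^sub>R T m \<bullet> p \<le> r *\<^sub>R T m \<bullet> r *\<^sub>R T v" if "p \<in> (\<lambda>x. r *\<^sub>R T x) ` V" for p
      using that m_support r by (auto simp: Ti)
    show "p = r *\<^sub>R T v \<or> p = 2 *\<^sub>R r *\<^sub>R T m - r *\<^sub>R T v"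
      if "p \<in> (\<lambda>x. r *\<^sub>R T x) ` V" "r *\<^sub>R T m \<bullet> p = r *\<^sub>R T m \<bullet> r *\<^sub>R T v" for p
    proof -
      from that(1) obtain x where x: "x \<in> V" "p = r *\<^sub>R T x"
        by blast
      then have "m \<bullet> x = m \<bullet> v"
        using that r by (simp add: Ti)
      then have "x = v \<or> x = 2 *\<^sub>R m - v"
        using m_support_eq x by blast
      then show ?thesis
        using x Tl by (auto simp: linear_diff linear_scale scaleR_diff_right mult.commute)
    qed
  qed (use finite_V v_in_V dual0 dual1 dual2 cc_eq_cv r in \<open>auto simp: Ti\<close>)
qed

section \<open>The five vertex sets and their chambers\<close>

lemma tetra_verts_eq: "tetra_verts = {vector [1, 1, 1], vector [1, -1, -1], vector [-1, 1, -1],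
    vector [-1, -1, 1]}"
  by (simp add: tetra_verts_def pm1_image)

text \<open>The edge joins (1,1,1) to (1,-1,-1), and the third vertex of the face is
  (-1,1,-1).\<close>

lemma regular_solid_tetra:
  "regular_solid tetra_verts (vector [1, 1, 1]) (vector [1, 0, 0])
    (vector [1/3, 1/3, -1/3]) (vector [0, 1, 1]) (vector [1, -1, 0]) (vector [0, 1, -1])"
proof -
  have r0: "reflection (vector [0, 1, 1]) ` tetra_verts \<subseteq> tetra_verts"
    unfolding tetra_verts_eq by (simp add: reflection_vector3)
  have r1: "reflection (vector [1, -1, 0]) ` tetra_verts \<subseteq> tetra_verts"
    unfolding tetra_verts_eq by (simp add: reflection_vector3)
  have r2: "reflection (vector [0, 1, -1]) ` tetra_verts \<subseteq> tetra_verts"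
    unfolding tetra_verts_eq by (simp add: reflection_vector3)
  show ?thesis
  proof unfold_locales
    show "finite (tetra_verts)" "vector [1, 1, 1] \<in> tetra_verts"
      by (simp_all add: tetra_verts_eq)
    show "reflection a ` tetra_verts \<subseteq> tetra_verts"
      if "a \<in> {vector [0, 1, 1], vector [1, -1, 0], vector [0, 1, -1]}" for a
      using that r0 r1 r2 by auto
    show "(vector [1/3, 1/3, -1/3] :: real^3) \<bullet> p \<le> (vector [1/3, 1/3, -1/3] :: real^3) \<bullet> vector [1, 1, 1]"
      if "p \<in> tetra_verts" for p
      using that unfolding tetra_verts_eq by (auto simp: inner_vector3 field_simps)
    show "(vector [1, 0, 0] :: real^3) \<bullet> p \<le> (vector [1, 0, 0] :: real^3) \<bullet> vector [1, 1, 1]" if "p \<in> tetra_verts" for p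
      using that unfolding tetra_verts_eq by (auto simp: inner_vector3 algebra_simps)
    have w: "2 *\<^sub>R vector [1, 0, 0] - vector [1, 1, 1] = (vector [1, -1, -1] :: real^3)"
      by (simp add: vec_eq_iff forall_3)
    show "p = vector [1, 1, 1] \<or> p = 2 *\<^sub>R vector [1, 0, 0] - vector [1, 1, 1]"
      if "p \<in> tetra_verts" "(vector [1, 0, 0] :: real^3) \<bullet> p = (vector [1, 0, 0] :: real^3) \<bullet> vector [1, 1, 1]" for p
      using that(1) unfolding w tetra_verts_eq
      by (elim insertE emptyE) (use that(2) in \<open>auto simp: inner_vector3 algebra_simps\<close>)
  qed (simp_all add: inner_vector3 reflection_vector3 vec_eq_iff forall_3)
qed

lemma cube_verts_eq: "cube_verts = {vector [1, 1, 1], vector [1, 1, -1], vector [1, -1, 1],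
    vector [1, -1, -1], vector [-1, 1, 1], vector [-1, 1, -1],
    vector [-1, -1, 1], vector [-1, -1, -1]}"
  by (simp add: cube_verts_def pm1_image)

text \<open>The edge joins (1,1,1) to (-1,1,1) in the face z = 1.\<close>

lemma regular_solid_cube:
  "regular_solid cube_verts (vector [1, 1, 1]) (vector [0, 1, 1])
    (vector [0, 0, 1]) (vector [1, 0, 0]) (vector [-1, 1, 0]) (vector [0, -1, 1])"
proof -
  have r0: "reflection (vector [1, 0, 0]) ` cube_verts \<subseteq> cube_verts"
    unfolding cube_verts_eq by (simp add: reflection_vector3)
  have r1: "reflection (vector [-1, 1, 0]) ` cube_verts \<subseteq> cube_verts"
    unfolding cube_verts_eq by (simp add: reflection_vector3)
  have r2: "reflection (vector [0, -1, 1]) ` cube_verts \<subseteq> cube_verts"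
    unfolding cube_verts_eq by (simp add: reflection_vector3)
  show ?thesis
  proof unfold_locales
    show "finite (cube_verts)" "vector [1, 1, 1] \<in> cube_verts"
      by (simp_all add: cube_verts_eq)
    show "reflection a ` cube_verts \<subseteq> cube_verts"
      if "a \<in> {vector [1, 0, 0], vector [-1, 1, 0], vector [0, -1, 1]}" for a
      using that r0 r1 r2 by auto
    show "(vector [0, 0, 1] :: real^3) \<bullet> p \<le> (vector [0, 0, 1] :: real^3) \<bullet> vector [1, 1, 1]"
      if "p \<in> cube_verts" for p
      using that unfolding cube_verts_eq by (auto simp: inner_vector3 field_simps)
    show "(vector [0, 1, 1] :: real^3) \<bullet> p \<le> (vector [0, 1, 1] :: real^3) \<bullet> vector [1, 1, 1]" if "p \<in> cube_verts" for p
      using that unfolding cube_verts_eq by (auto simp: inner_vector3 algebra_simps)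
    have w: "2 *\<^sub>R vector [0, 1, 1] - vector [1, 1, 1] = (vector [-1, 1, 1] :: real^3)"
      by (simp add: vec_eq_iff forall_3)
    show "p = vector [1, 1, 1] \<or> p = 2 *\<^sub>R vector [0, 1, 1] - vector [1, 1, 1]"
      if "p \<in> cube_verts" "(vector [0, 1, 1] :: real^3) \<bullet> p = (vector [0, 1, 1] :: real^3) \<bullet> vector [1, 1, 1]" for p
      using that(1) unfolding w cube_verts_eq
      by (elim insertE emptyE) (use that(2) in \<open>auto simp: inner_vector3 algebra_simps\<close>)
  qed (simp_all add: inner_vector3 reflection_vector3 vec_eq_iff forall_3)
qed

lemma octa_verts_eq: "octa_verts = {vector [0, 0, 1], vector [0, 0, -1], vector [0, 1, 0],
    vector [0, -1, 0], vector [1, 0, 0], vector [-1, 0, 0]}"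
  by (simp add: octa_verts_def pm1_image)

text \<open>The edge joins (1,0,0) to (0,1,0) in the face x + y + z = 1.\<close>

lemma regular_solid_octa:
  "regular_solid octa_verts (vector [1, 0, 0]) (vector [1/2, 1/2, 0])
    (vector [1/3, 1/3, 1/3]) (vector [1, -1, 0]) (vector [0, 1, -1]) (vector [0, 0, 1])"
proof -
  have r0: "reflection (vector [1, -1, 0]) ` octa_verts \<subseteq> octa_verts"
    unfolding octa_verts_eq by (simp add: reflection_vector3)
  have r1: "reflection (vector [0, 1, -1]) ` octa_verts \<subseteq> octa_verts"
    unfolding octa_verts_eq by (simp add: reflection_vector3)
  have r2: "reflection (vector [0, 0, 1]) ` octa_verts \<subseteq> octa_verts"
    unfolding octa_verts_eq by (simp add: reflection_vector3)
  show ?thesis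
  proof unfold_locales
    show "finite (octa_verts)" "vector [1, 0, 0] \<in> octa_verts"
      by (simp_all add: octa_verts_eq)
    show "reflection a ` octa_verts \<subseteq> octa_verts"
      if "a \<in> {vector [1, -1, 0], vector [0, 1, -1], vector [0, 0, 1]}" for a
      using that r0 r1 r2 by auto
    show "(vector [1/3, 1/3, 1/3] :: real^3) \<bullet> p \<le> (vector [1/3, 1/3, 1/3] :: real^3) \<bullet> vector [1, 0, 0]"
      if "p \<in> octa_verts" for p
      using that unfolding octa_verts_eq by (auto simp: inner_vector3 field_simps)
    show "(vector [1/2, 1/2, 0] :: real^3) \<bullet> p \<le> (vector [1/2, 1/2, 0] :: real^3) \<bullet> vector [1, 0, 0]" if "p \<in> octa_verts" for p
      using that unfolding octa_verts_eq by (auto simp: inner_vector3 algebra_simps)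
    have w: "2 *\<^sub>R vector [1/2, 1/2, 0] - vector [1, 0, 0] = (vector [0, 1, 0] :: real^3)"
      by (simp add: vec_eq_iff forall_3)
    show "p = vector [1, 0, 0] \<or> p = 2 *\<^sub>R vector [1/2, 1/2, 0] - vector [1, 0, 0]"
      if "p \<in> octa_verts" "(vector [1/2, 1/2, 0] :: real^3) \<bullet> p = (vector [1/2, 1/2, 0] :: real^3) \<bullet> vector [1, 0, 0]" for p
      using that(1) unfolding w octa_verts_eq
      by (elim insertE emptyE) (use that(2) in \<open>auto simp: inner_vector3 algebra_simps\<close>)
  qed (simp_all add: inner_vector3 reflection_vector3 vec_eq_iff forall_3)
qed

text \<open>The golden ratio is replaced by a variable of which only g^2 = g + 1 and 1 < g < 2 will
  be known, so that no square root enters the computations.\<close>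

definition icosa_set :: "real \<Rightarrow> (real^3) set" where
  "icosa_set g = {vector [g, 0, 1], vector [g, 0, -1], vector [-g, 0, 1],
    vector [-g, 0, -1], vector [1, g, 0], vector [1, -g, 0],
    vector [-1, g, 0], vector [-1, -g, 0], vector [0, 1, g],
    vector [0, 1, -g], vector [0, -1, g], vector [0, -1, -g]}"

text \<open>The face has the vertices (0,1,g), (0,-1,g) and (g,0,1). The roots \<open>a0\<close> and
  \<open>a2\<close> are coordinate directions, which leaves a single reflection to be tabulated
  vertex by vertex.\<close>

lemma regular_solid_icosa:
  assumes g: "g * g = g + 1" "1 < g" "g < 2"
  shows "regular_solid (icosa_set g) (vector [0, 1, g]) (vector [0, 0, g])
    (vector [1/3*g, 0, 1/3 + 2/3*g]) (vector [0, 1, 0]) (vector [-g, -1, g - 1]) (vector [1, 0, 0])"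
proof -
  let ?a = "vector [-g, -1, g - 1] :: real^3"
  \<comment> \<open>The equation for g in a form that also reduces squares inside longer
    products.\<close>
  have gg: "g * (g * x) = g * x + x" for x
    using g(1) by algebra
  have N: "(-g) * (-g) + (-1) * (-1) + (g - 1) * (g - 1) = 4"
    using g(1) by algebra
  have eqs: "reflection ?a (vector [g, 0, 1]) = vector [0, -1, g]"
    "reflection ?a (vector [g, 0, -1]) = vector [-1, -g, 0]"
    "reflection ?a (vector [-g, 0, 1]) = vector [1, g, 0]"
    "reflection ?a (vector [-g, 0, -1]) = vector [0, 1, -g]"
    "reflection ?a (vector [1, g, 0]) = vector [-g, 0, 1]"
    "reflection ?a (vector [1, -g, 0]) = vector [1, -g, 0]"
    "reflection ?a (vector [-1, g, 0]) = vector [-1, g, 0]"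
    "reflection ?a (vector [-1, -g, 0]) = vector [g, 0, -1]"
    "reflection ?a (vector [0, 1, g]) = vector [0, 1, g]"
    "reflection ?a (vector [0, 1, -g]) = vector [-g, 0, -1]"
    "reflection ?a (vector [0, -1, g]) = vector [g, 0, 1]"
    "reflection ?a (vector [0, -1, -g]) = vector [0, -1, -g]"
    by (rule reflection_vector3I[OF N]; simp add: algebra_simps g(1) gg)+
  have r0: "reflection (vector [0, 1, 0]) ` icosa_set g \<subseteq> icosa_set g"
    unfolding icosa_set_def by (simp add: reflection_vector3)
  have r1: "reflection (vector [-g, -1, g - 1]) ` icosa_set g \<subseteq> icosa_set g"
    unfolding icosa_set_def by (simp only: image_insert image_empty eqs) blast
  have r2: "reflection (vector [1, 0, 0]) ` icosa_set g \<subseteq> icosa_set g"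
    unfolding icosa_set_def by (simp add: reflection_vector3)
  show ?thesis
  proof unfold_locales
    show "finite (icosa_set g)" "vector [0, 1, g] \<in> icosa_set g"
      by (simp_all add: icosa_set_def)
    show "reflection a ` icosa_set g \<subseteq> icosa_set g"
      if "a \<in> {vector [0, 1, 0], vector [-g, -1, g - 1], vector [1, 0, 0]}" for a
      using that r0 r1 r2 by auto
    show "(vector [1/3*g, 0, 1/3 + 2/3*g] :: real^3) \<bullet> p \<le> (vector [1/3*g, 0, 1/3 + 2/3*g] :: real^3) \<bullet> vector [0, 1, g]"
      if "p \<in> icosa_set g" for p
      using that g unfolding icosa_set_def by (auto simp: inner_vector3 field_simps gg)
    show "(vector [0, 0, g] :: real^3) \<bullet> p \<le> (vector [0, 0, g] :: real^3) \<bullet> vector [0, 1, g]" if "p \<in> icosa_set g" for p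
      using that g unfolding icosa_set_def by (auto simp: inner_vector3 algebra_simps gg)
    have w: "2 *\<^sub>R vector [0, 0, g] - vector [0, 1, g] = (vector [0, -1, g] :: real^3)"
      by (simp add: vec_eq_iff forall_3)
    show "p = vector [0, 1, g] \<or> p = 2 *\<^sub>R vector [0, 0, g] - vector [0, 1, g]"
      if "p \<in> icosa_set g" "(vector [0, 0, g] :: real^3) \<bullet> p = (vector [0, 0, g] :: real^3) \<bullet> vector [0, 1, g]" for p
      using that(1) unfolding w icosa_set_def
      by (elim insertE emptyE) (use that(2) g in \<open>auto simp: inner_vector3 algebra_simps gg\<close>)
  qed (use g in \<open>simp_all add: inner_vector3 reflection_vector3 vec_eq_iff forall_3 field_simps gg\<close>)
qed

text \<open>The reciprocal of the golden ratio is written as g - 1, so that all coordinates are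
  polynomials in g.\<close>

definition dodeca_set :: "real \<Rightarrow> (real^3) set" where
  "dodeca_set g = {vector [g, 0, g - 1], vector [g, 0, 1 - g], vector [-g, 0, g - 1],
    vector [-g, 0, 1 - g], vector [g - 1, g, 0], vector [g - 1, -g, 0],
    vector [1 - g, g, 0], vector [1 - g, -g, 0], vector [0, g - 1, g],
    vector [0, g - 1, -g], vector [0, 1 - g, g], vector [0, 1 - g, -g],
    vector [1, 1, 1], vector [1, 1, -1], vector [1, -1, 1],
    vector [1, -1, -1], vector [-1, 1, 1], vector [-1, 1, -1],
    vector [-1, -1, 1], vector [-1, -1, -1]}"

text \<open>The pentagon has the vertices (0,g-1,g), (0,1-g,g), (1,1,1), (1,-1,1) and (g,0,g-1); its
  centre is one fifth of their sum.\<close>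

lemma regular_solid_dodeca:
  assumes g: "g * g = g + 1" "1 < g" "g < 2"
  shows "regular_solid (dodeca_set g) (vector [0, g - 1, g]) (vector [0, 0, g])
    (vector [2/5 + 1/5*g, 0, 1/5 + 3/5*g]) (vector [0, 1, 0]) (vector [-1, -g, g - 1]) (vector [1, 0, 0])"
proof -
  let ?a = "vector [-1, -g, g - 1] :: real^3"
  have gg: "g * (g * x) = g * x + x" for x
    using g(1) by algebra
  have N: "(-1) * (-1) + (-g) * (-g) + (g - 1) * (g - 1) = 4"
    using g(1) by algebra
  have eqs: "reflection ?a (vector [g, 0, g - 1]) = vector [1, -1, 1]"
    "reflection ?a (vector [g, 0, 1 - g]) = vector [g - 1, -g, 0]"
    "reflection ?a (vector [-g, 0, g - 1]) = vector [1 - g, g, 0]"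
    "reflection ?a (vector [-g, 0, 1 - g]) = vector [-1, 1, -1]"
    "reflection ?a (vector [g - 1, g, 0]) = vector [-1, -1, 1]"
    "reflection ?a (vector [g - 1, -g, 0]) = vector [g, 0, 1 - g]"
    "reflection ?a (vector [1 - g, g, 0]) = vector [-g, 0, g - 1]"
    "reflection ?a (vector [1 - g, -g, 0]) = vector [1, 1, -1]"
    "reflection ?a (vector [0, g - 1, g]) = vector [0, g - 1, g]"
    "reflection ?a (vector [0, g - 1, -g]) = vector [-1, -1, -1]"
    "reflection ?a (vector [0, 1 - g, g]) = vector [1, 1, 1]"
    "reflection ?a (vector [0, 1 - g, -g]) = vector [0, 1 - g, -g]"
    "reflection ?a (vector [1, 1, 1]) = vector [0, 1 - g, g]"
    "reflection ?a (vector [1, 1, -1]) = vector [1 - g, -g, 0]"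
    "reflection ?a (vector [1, -1, 1]) = vector [g, 0, g - 1]"
    "reflection ?a (vector [1, -1, -1]) = vector [1, -1, -1]"
    "reflection ?a (vector [-1, 1, 1]) = vector [-1, 1, 1]"
    "reflection ?a (vector [-1, 1, -1]) = vector [-g, 0, 1 - g]"
    "reflection ?a (vector [-1, -1, 1]) = vector [g - 1, g, 0]"
    "reflection ?a (vector [-1, -1, -1]) = vector [0, g - 1, -g]"
    by (rule reflection_vector3I[OF N]; simp add: algebra_simps g(1) gg)+
  have r0: "reflection (vector [0, 1, 0]) ` dodeca_set g \<subseteq> dodeca_set g"
    unfolding dodeca_set_def by (simp add: reflection_vector3)
  have r1: "reflection (vector [-1, -g, g - 1]) ` dodeca_set g \<subseteq> dodeca_set g"
    unfolding dodeca_set_def by (simp only: image_insert image_empty eqs) blast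
  have r2: "reflection (vector [1, 0, 0]) ` dodeca_set g \<subseteq> dodeca_set g"
    unfolding dodeca_set_def by (simp add: reflection_vector3)
  show ?thesis
  proof unfold_locales
    show "finite (dodeca_set g)" "vector [0, g - 1, g] \<in> dodeca_set g"
      by (simp_all add: dodeca_set_def)
    show "reflection a ` dodeca_set g \<subseteq> dodeca_set g"
      if "a \<in> {vector [0, 1, 0], vector [-1, -g, g - 1], vector [1, 0, 0]}" for a
      using that r0 r1 r2 by auto
    show "(vector [2/5 + 1/5*g, 0, 1/5 + 3/5*g] :: real^3) \<bullet> p \<le> (vector [2/5 + 1/5*g, 0, 1/5 + 3/5*g] :: real^3) \<bullet> vector [0, g - 1, g]"
      if "p \<in> dodeca_set g" for p
      using that g unfolding dodeca_set_def by (auto simp: inner_vector3 field_simps gg)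
    show "(vector [0, 0, g] :: real^3) \<bullet> p \<le> (vector [0, 0, g] :: real^3) \<bullet> vector [0, g - 1, g]" if "p \<in> dodeca_set g" for p
      using that g unfolding dodeca_set_def by (auto simp: inner_vector3 algebra_simps gg)
    have w: "2 *\<^sub>R vector [0, 0, g] - vector [0, g - 1, g] = (vector [0, 1 - g, g] :: real^3)"
      by (simp add: vec_eq_iff forall_3)
    show "p = vector [0, g - 1, g] \<or> p = 2 *\<^sub>R vector [0, 0, g] - vector [0, g - 1, g]"
      if "p \<in> dodeca_set g" "(vector [0, 0, g] :: real^3) \<bullet> p = (vector [0, 0, g] :: real^3) \<bullet> vector [0, g - 1, g]" for p
      using that(1) unfolding w dodeca_set_def
      by (elim insertE emptyE) (use that(2) g in \<open>auto simp: inner_vector3 algebra_simps gg\<close>)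
  qed (use g in \<open>simp_all add: inner_vector3 reflection_vector3 vec_eq_iff forall_3 field_simps gg\<close>)
qed

lemma golden_facts: "golden * golden = golden + 1" "1 < golden" "golden < 2"
proof -
  have s: "sqrt 5 * sqrt 5 = 5" by simp
  have "golden * golden = (1 + 2 * sqrt 5 + sqrt 5 * sqrt 5) / 4"
    by (simp add: golden_def algebra_simps)
  then show "golden * golden = golden + 1"
    unfolding s by (simp add: golden_def)
  have "sqrt 1 < sqrt 5" "sqrt 5 < sqrt 9"
    by (simp_all only: real_sqrt_less_iff)
  moreover have "sqrt 9 = 3"
    using real_sqrt_abs[of 3] by simp
  ultimately show "1 < golden" "golden < 2"
    by (simp_all add: golden_def)
qed

lemma icosa_verts_eq: "icosa_verts = icosa_set golden"
  by (simp add: icosa_verts_def icosa_set_def pm1_image)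

lemma divide_golden: "1 / golden = golden - 1" "-1 / golden = 1 - golden"
  using golden_facts by (simp_all add: field_simps)

lemma dodeca_verts_eq: "dodeca_verts = dodeca_set golden"
proof -
  have "a / golden = a * (golden - 1)" for a
    using divide_golden by (metis times_divide_eq_right mult.right_neutral)
  then show ?thesis
    by (simp add: dodeca_verts_def dodeca_set_def cube_verts_eq pm1_image)
qed

lemma platonic_body_regular_solid:
  assumes "platonic_body B C"
  obtains V v m c a0 a1 a2 where "regular_solid V v m c a0 a1 a2" "B = (+) C ` (convex hull V)"
proof -
  obtain P r T where P: "P \<in> {tetra_verts, cube_verts, octa_verts, dodeca_verts, icosa_verts}"
    and r: "0 < r" and T: "orthogonal_transformation T" and B: "B = convex hull ((\<lambda>x. C + r *\<^sub>R T x) ` P)"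
    using assms unfolding platonic_body_def by blast
  have "\<exists>v m c a0 a1 a2. regular_solid P v m c a0 a1 a2"
    using P regular_solid_tetra regular_solid_cube regular_solid_octa
      regular_solid_icosa[OF golden_facts] regular_solid_dodeca[OF golden_facts]
    unfolding icosa_verts_eq dodeca_verts_eq by blast
  then obtain v m c a0 a1 a2 where "regular_solid P v m c a0 a1 a2" by blast
  from regular_solid_similarity[OF this T r] show ?thesis
  proof (rule that)
    have "(\<lambda>x. C + r *\<^sub>R T x) ` P = (+) C ` (\<lambda>x. r *\<^sub>R T x) ` P"
      by (simp add: image_image)
    then show "B = (+) C ` (convex hull ((\<lambda>x. r *\<^sub>R T x) ` P))"
      unfolding B by (simp only: convex_hull_translation)
  qed
qed

subsection \<open>Integrals of convex functions\<close>

text \<open>A very small value at \<open>x\<close> would, by convexity on the segment from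
  \<open>x\<close> through \<open>z\<close> to a point beyond it, force a value above M at that
  point.\<close>

lemma convex_on_bounded_below:
  fixes f :: "'a::real_normed_vector \<Rightarrow> real"
  assumes S: "bounded S" and f: "convex_on S f" and ub: "\<And>x. x \<in> S \<Longrightarrow> f x \<le> M"
    and z: "z \<in> interior S"
  obtains L where "\<And>x. x \<in> S \<Longrightarrow> L \<le> f x"
proof -
  obtain e where e: "0 < e" "cball z e \<subseteq> S"
    using z mem_interior_cball by blast
  obtain d where d: "0 < d" "\<And>x. x \<in> S \<Longrightarrow> dist z x \<le> d"
    using bounded_any_center[of S z] S by (metis less_max_iff_disj max.cobounded1 max.strict_coboundedI2 order_trans zero_less_one max_def)
  \<comment> \<open>With this weight, z = t x + (1 - t) y for the point y = z + (e/d) (z - x), which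
    stays within distance e of \<open>z\<close> because \<open>x\<close> is within distance d. The
    weight is the same for all \<open>x\<close>, and so is the bound.\<close>
  define t where "t = e / (d + e)"
  have t: "0 < t" "t < 1"
    using e d by (auto simp: t_def)
  have "(f z - (1 - t) * M) / t \<le> f x" if x: "x \<in> S" for x
  proof -
    define y where "y = z + (e/d) *\<^sub>R (z - x)"
    have "dist z y \<le> e"
      using d(2)[OF x] d(1) e(1) by (simp add: y_def dist_norm divide_le_eq mult.commute mult_left_mono)
    then have y: "y \<in> S"
      using e by auto
    have "(1 - t) * (e/d) = t"
      using e d by (simp add: t_def field_simps)
    then have "(1 - t) *\<^sub>R y = (1 - t) *\<^sub>R z + t *\<^sub>R (z - x)"
      by (simp add: y_def scaleR_add_right)
    then have "t *\<^sub>R x + (1 - t) *\<^sub>R y = z"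
      by (simp add: algebra_simps)
    then have "f z \<le> t * f x + (1 - t) * f y"
      using convex_onD[OF f, of "1 - t" x y] t x y by simp
    also have "\<dots> \<le> t * f x + (1 - t) * M"
      using ub[OF y] t by (intro add_left_mono mult_left_mono) auto
    finally show ?thesis
      using t by (simp add: divide_le_eq mult.commute)
  qed
  then show ?thesis
    using that by blast
qed

lemma convex_on_polytope_bounded:
  fixes f :: "'a::euclidean_space \<Rightarrow> real"
  assumes S: "polytope S" and f: "convex_on S f" and ne: "interior S \<noteq> {}"
  obtains M where "\<And>x. x \<in> S \<Longrightarrow> \<bar>f x\<bar> \<le> M"
proof -
  obtain X where X: "finite X" "S = convex hull X"
    using S unfolding polytope_def by blast
  obtain b where b: "\<And>x. x \<in> X \<Longrightarrow> f x \<le> b"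
    using X(1) by (metis (no_types, lifting) Max_ge finite_imageI image_eqI)
  have ub: "f x \<le> b" if "x \<in> S" for x
    using convex_on_convex_hull_bound[of X f b] f X b that by blast
  obtain z where "z \<in> interior S" using ne by blast
  then obtain L where L: "\<And>x. x \<in> S \<Longrightarrow> L \<le> f x"
    using convex_on_bounded_below[OF polytope_imp_bounded[OF S] f ub] by blast
  show ?thesis
    by (rule that[of "max \<bar>b\<bar> \<bar>L\<bar>"]) (use ub L in fastforce)
qed

lemma negligible_Diff_interior:
  fixes S :: "'a::euclidean_space set"
  assumes "convex S"
  shows "negligible (S - interior S)"
proof (rule negligible_subset)
  show "negligible (frontier S)"
    using assms by (rule negligible_convex_frontier)
  show "S - interior S \<subseteq> frontier S"
    using closure_subset by (auto simp: frontier_def)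
qed

text \<open>On the interior the function is continuous and bounded; on the boundary it may be
  irregular, but the boundary of a convex set is negligible. A polytope without interior is itself
  negligible.\<close>

lemma convex_on_polytope_absolutely_integrable:
  fixes f :: "'a::euclidean_space \<Rightarrow> real"
  assumes S: "polytope S" and f: "convex_on S f"
  shows "f absolutely_integrable_on S"
proof (cases "interior S = {}")
  case True
  then have "negligible S"
    using negligible_Diff_interior[OF polytope_imp_convex[OF S]] by simp
  then show ?thesis
    using absolutely_integrable_negligible by blast
next
  case False
  then obtain M where M: "\<And>x. x \<in> S \<Longrightarrow> \<bar>f x\<bar> \<le> M"
    using convex_on_polytope_bounded[OF S f] by blast
  let ?U = "interior S"
  have "f absolutely_integrable_on ?U"
  proof (rule measurable_bounded_by_integrable_imp_absolutely_integrable)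
    show U: "?U \<in> sets lebesgue" by simp
    have "convex_on ?U f"
      using f polytope_imp_convex[OF S] interior_subset by (metis convex_on_subset convex_interior)
    then show "f \<in> borel_measurable (lebesgue_on ?U)"
      using convex_on_continuous[OF open_interior] continuous_imp_measurable_on_sets_lebesgue U by blast
    have "?U \<in> lmeasurable"
      using polytope_imp_bounded[OF S] by (intro lmeasurable_interior)
    then show "(\<lambda>_. M) integrable_on ?U"
      by (rule integrable_on_const)
    show "norm (f x) \<le> M" if "x \<in> ?U" for x
      using M that interior_subset by fastforce
  qed
  moreover have "negligible {x \<in> S - ?U. f x \<noteq> 0}" "negligible {x \<in> ?U - S. f x \<noteq> 0}"
    using negligible_Diff_interior[OF polytope_imp_convex[OF S]] interior_subset[of S]
    by (auto intro: negligible_subset)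
  ultimately show ?thesis
    using absolutely_integrable_spike_set_eq by blast
qed

text \<open>Integrals over Cartesian powers are moved to product types, the setting of Fubini's theorem.\<close>

lemma has_integral_bounded_twiddle:
  fixes g :: "'b::euclidean_space \<Rightarrow> 'a::euclidean_space" and f :: "'a \<Rightarrow> real"
  assumes hg: "\<And>x. h (g x) = x" and gh: "\<And>x. g (h x) = x"
    and contg: "\<And>x. continuous (at x) g"
    and g: "\<And>u v. g ` cbox u v = cbox (g u) (g v)"
    and r: "\<And>u v. measure lborel (cbox (g u) (g v)) = measure lborel (cbox u v)"
    and S: "bounded S" and f: "(f has_integral i) S"
  shows "((\<lambda>x. f (g x)) has_integral i) {x. g x \<in> S}"
proof -
  have h: "h ` cbox u v = cbox (h u) (h v)" for u v
  proof -
    have "h ` cbox u v = h ` g ` cbox (h u) (h v)"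
      using g[of "h u" "h v"] gh by simp
    then show ?thesis
      by (simp add: image_comp o_def hg)
  qed
  obtain a where a: "S \<subseteq> cbox (-a) a"
    using S bounded_subset_cbox_symmetric by blast
  let ?f = "\<lambda>x. if x \<in> S then f x else 0"
  have "(?f has_integral i) (cbox (-a) a)"
    using f a by (simp add: has_integral_restrict)
  then have "((\<lambda>x. ?f (g x)) has_integral (1/1) *\<^sub>R i) (h ` cbox (-a) a)"
    using g h r by (intro has_integral_twiddle[OF _ hg gh contg]) auto
  then have "((\<lambda>x. if x \<in> {x. g x \<in> S} then f (g x) else 0) has_integral i) (h ` cbox (-a) a)"
    by simp
  moreover have "{x. g x \<in> S} \<subseteq> h ` cbox (-a) a"
    using a hg by (metis (mono_tags, lifting) image_eqI mem_Collect_eq subset_eq)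
  ultimately show ?thesis
    by (subst (asm) has_integral_restrict) auto
qed

lemma vector_triple_cbox:
  "(\<lambda>(x, y, z). vector [x, y, z] :: real^3) ` cbox u v =
    cbox (vector [fst u, fst (snd u), snd (snd u)]) (vector [fst v, fst (snd v), snd (snd v)])"
proof -
  have "y \<in> (\<lambda>(x, y, z). vector [x, y, z] :: real^3) ` cbox u v"
    if "y \<in> cbox (vector [fst u, fst (snd u), snd (snd u)]) (vector [fst v, fst (snd v), snd (snd v)])" for y :: "real^3"
    using that by (intro image_eqI[of _ _ "(y$1, y$2, y$3)"]; cases u; cases v)
      (auto simp: mem_box_cart forall_3 vec_eq_iff cbox_Pair_eq)
  then show ?thesis
    by (cases u, cases v) (auto simp: mem_box_cart forall_3 cbox_Pair_eq)
qed

lemma vector_pair_cbox: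
  "(\<lambda>(x, y). vector [x, y] :: real^2) ` cbox u v = cbox (vector [fst u, snd u]) (vector [fst v, snd v])"
proof -
  have "y \<in> (\<lambda>(x, y). vector [x, y] :: real^2) ` cbox u v"
    if "y \<in> cbox (vector [fst u, snd u]) (vector [fst v, snd v])" for y :: "real^2"
    using that by (intro image_eqI[of _ _ "(y$1, y$2)"]; cases u; cases v)
      (auto simp: mem_box_cart forall_2 vec_eq_iff cbox_Pair_eq)
  then show ?thesis
    by (cases u, cases v) (auto simp: mem_box_cart forall_2 cbox_Pair_eq)
qed

lemma content_vector_triple:
  "measure lborel (cbox (vector [fst u, fst (snd u), snd (snd u)]) (vector [fst v, fst (snd v), snd (snd v)]) :: (real^3) set)
    = measure lborel (cbox u v)"
proof (cases "cbox u v = {}")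
  case True
  then show ?thesis
    using vector_triple_cbox[of u v] by simp
next
  case False
  obtain a b c a' b' c' where uv: "u = (a, b, c)" "v = (a', b', c')"
    by (metis surj_pair)
  have ne: "cbox (vector [a, b, c]) (vector [a', b', c']) \<noteq> ({} :: (real^3) set)"
    using vector_triple_cbox[of u v] False unfolding uv by (auto simp del: cbox_Pair_eq)
  have "a \<le> a' \<and> b \<le> b' \<and> c \<le> c'"
    using False by (simp add: uv cbox_Pair_eq)
  then have "measure lborel (cbox u v) = (a' - a) * ((b' - b) * (c' - c))"
    unfolding uv content_Pair by simp
  moreover have "measure lborel (cbox (vector [a, b, c]) (vector [a', b', c']) :: (real^3) set)
      = (a' - a) * ((b' - b) * (c' - c))"
    unfolding content_cbox_cart[OF ne] UNIV_3 by simp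
  ultimately show ?thesis
    unfolding uv by simp
qed

lemma content_vector_pair:
  "measure lborel (cbox (vector [fst u, snd u]) (vector [fst v, snd v]) :: (real^2) set) = measure lborel (cbox u v)"
proof (cases "cbox u v = {}")
  case True
  then show ?thesis
    using vector_pair_cbox[of u v] by simp
next
  case False
  obtain a b a' b' where uv: "u = (a, b)" "v = (a', b')"
    by (metis surj_pair)
  have ne: "cbox (vector [a, b]) (vector [a', b']) \<noteq> ({} :: (real^2) set)"
    using vector_pair_cbox[of u v] False unfolding uv by (auto simp del: cbox_Pair_eq)
  have "a \<le> a' \<and> b \<le> b'"
    using False by (simp add: uv cbox_Pair_eq)
  then have "measure lborel (cbox u v) = (a' - a) * (b' - b)"
    unfolding uv content_Pair by simp
  moreover have "measure lborel (cbox (vector [a, b]) (vector [a', b']) :: (real^2) set)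
      = (a' - a) * (b' - b)"
    unfolding content_cbox_cart[OF ne] UNIV_2 by simp
  ultimately show ?thesis
    unfolding uv by simp
qed

lemma linear_vector_triple: "linear (\<lambda>(x, y, z). vector [x, y, z] :: real^3)"
  by (intro linearI) (auto simp: vec_eq_iff forall_3)

lemma linear_vector_pair: "linear (\<lambda>(x, y). vector [x, y] :: real^2)"
  by (intro linearI) (auto simp: vec_eq_iff forall_2)

lemma has_integral_triple:
  fixes f :: "real^3 \<Rightarrow> real"
  assumes "bounded S" "(f has_integral i) S"
  shows "((\<lambda>(x, y, z). f (vector [x, y, z])) has_integral i) {(x, y, z). vector [x, y, z] \<in> S}"
proof -
  let ?g = "\<lambda>(x, y, z). vector [x, y, z] :: real^3"
  have "((\<lambda>x. f (?g x)) has_integral i) {x. ?g x \<in> S}"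
  proof (rule has_integral_bounded_twiddle[where h = "\<lambda>x. (x$1, x$2, x$3)", OF _ _ _ _ _ assms])
    show "isCont ?g x" for x
      using linear_vector_triple by (simp add: linear_continuous_at linear_conv_bounded_linear)
    show "?g ` cbox u v = cbox (?g u) (?g v)" for u v
      using vector_triple_cbox[of u v] by (simp add: case_prod_unfold)
    show "measure lborel (cbox (?g u) (?g v)) = measure lborel (cbox u v)" for u v
      using content_vector_triple[of u v] by (simp add: case_prod_unfold)
  qed (auto simp: vec_eq_iff forall_3)
  moreover have "(\<lambda>x. f (?g x)) = (\<lambda>(x, y, z). f (vector [x, y, z]))"
    "{x. ?g x \<in> S} = {(x, y, z). vector [x, y, z] \<in> S}"
    by auto
  ultimately show ?thesis by simp
qed

lemma has_integral_pair:
  fixes f :: "real^2 \<Rightarrow> real"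
  assumes "bounded S" "(f has_integral i) S"
  shows "((\<lambda>(x, y). f (vector [x, y])) has_integral i) {(x, y). vector [x, y] \<in> S}"
proof -
  let ?g = "\<lambda>(x, y). vector [x, y] :: real^2"
  have "((\<lambda>x. f (?g x)) has_integral i) {x. ?g x \<in> S}"
  proof (rule has_integral_bounded_twiddle[where h = "\<lambda>x. (x$1, x$2)", OF _ _ _ _ _ assms])
    show "isCont ?g x" for x
      using linear_vector_pair by (simp add: linear_continuous_at linear_conv_bounded_linear)
    show "?g ` cbox u v = cbox (?g u) (?g v)" for u v
      using vector_pair_cbox[of u v] by (simp add: case_prod_unfold)
    show "measure lborel (cbox (?g u) (?g v)) = measure lborel (cbox u v)" for u v
      using content_vector_pair[of u v] by (simp add: case_prod_unfold)
  qed (auto simp: vec_eq_iff forall_2)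
  moreover have "(\<lambda>x. f (?g x)) = (\<lambda>(x, y). f (vector [x, y]))"
    "{x. ?g x \<in> S} = {(x, y). vector [x, y] \<in> S}"
    by auto
  ultimately show ?thesis by simp
qed

section \<open>Substitution and Fubini\<close>

lemma affine_change_of_variables:
  fixes f :: "real^'n::{finite,wellorder} \<Rightarrow> real" and A :: "real^'n::_ \<Rightarrow> real^'n::_"
  assumes A: "linear A" "inj A" and f: "f absolutely_integrable_on ((\<lambda>x. p + A x) ` S)"
  shows "(\<lambda>x. f (p + A x)) absolutely_integrable_on S"
    and "integral ((\<lambda>x. p + A x) ` S) f = \<bar>det (matrix A)\<bar> * integral S (\<lambda>x. f (p + A x))"
proof -
  obtain B where B: "linear B" "\<And>x. B (A x) = x"
    using linear_injective_left_inverse[OF A] by (metis comp_apply id_apply)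
  have d: "det (matrix A) \<noteq> 0"
    using A det_nz_iff_inj by blast
  \<comment> \<open>The change of variables is applied to vector-valued maps, so f is viewed as a
    map into \<open>real^1\<close> and brought back at the end.\<close>
  let ?f = "\<lambda>x. vec (f x) :: real^1"
  have "(\<lambda>x. \<bar>det (matrix A)\<bar> *\<^sub>R ?f (p + A x)) absolutely_integrable_on S \<and>
      integral S (\<lambda>x. \<bar>det (matrix A)\<bar> *\<^sub>R ?f (p + A x)) = b
     \<longleftrightarrow> ?f absolutely_integrable_on ((\<lambda>x. p + A x) ` S) \<and> integral ((\<lambda>x. p + A x) ` S) ?f = b" for b
  proof (rule has_absolute_integral_change_of_variables_invertible)
    show "((\<lambda>x. p + A x) has_derivative A) (at x within S)" for x
      using has_derivative_add_const[OF linear_imp_has_derivative[OF A(1)], of p] by (simp add: add.commute)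
    show "(\<lambda>y. B (y - p)) (p + A x) = x" for x
      using B by simp
    show "continuous_on ((\<lambda>x. p + A x) ` S) (\<lambda>y. B (y - p))"
      using B(1) by (intro continuous_on_compose2[OF linear_continuous_on[of B UNIV]] continuous_intros)
        (auto simp: linear_conv_bounded_linear)
  qed
  note this[of "integral ((\<lambda>x. p + A x) ` S) ?f"]
  moreover have "?f absolutely_integrable_on ((\<lambda>x. p + A x) ` S)"
    using f by (simp add: absolutely_integrable_on_1_iff)
  ultimately have *: "(\<lambda>x. \<bar>det (matrix A)\<bar> * f (p + A x)) absolutely_integrable_on S"
    "integral S (\<lambda>x. \<bar>det (matrix A)\<bar> * f (p + A x)) = integral ((\<lambda>x. p + A x) ` S) f"
    by (auto simp: absolutely_integrable_on_1_iff integral_on_1_eq vec_eq_iff)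
  then have "(\<lambda>x. \<bar>det (matrix A)\<bar> *\<^sub>R f (p + A x)) absolutely_integrable_on S" by simp
  then show "(\<lambda>x. f (p + A x)) absolutely_integrable_on S"
    unfolding absolutely_integrable_on_scaleR_iff using d by simp
  show "integral ((\<lambda>x. p + A x) ` S) f = \<bar>det (matrix A)\<bar> * integral S (\<lambda>x. f (p + A x))"
    using * by simp
qed

lemma integrable_bounded_support:
  fixes K :: "'a::euclidean_space \<Rightarrow> real"
  assumes K: "K \<in> borel_measurable borel" and bd: "\<And>x. \<bar>K x\<bar> \<le> M"
    and A: "bounded A" "\<And>x. K x \<noteq> 0 \<Longrightarrow> x \<in> A"
  shows "integrable lborel K"
proof -
  obtain a where a: "A \<subseteq> cbox (-a) a"
    using A(1) bounded_subset_cbox_symmetric by blast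
  show ?thesis
  proof (rule integrableI_bounded_set)
    show "cbox (-a) a \<in> sets lborel" "K \<in> borel_measurable lborel"
      using K by auto
    show "emeasure lborel (cbox (-a) a) < \<infinity>"
      by (rule emeasure_bounded_finite) auto
  qed (use bd A a in auto)
qed

lemma integral_scale_pair:
  fixes h :: "real \<times> real \<Rightarrow> real"
  assumes h: "h \<in> borel_measurable borel" and cd: "0 < c" "0 < d"
  shows "(\<integral>x. h x \<partial>lborel) = c * d * (\<integral>x. h (c * fst x, d * snd x) \<partial>lborel)"
proof -
  define k where "k j = (if j = (1::real, 0::real) then c else d)" for j
  let ?T = "\<lambda>x::real \<times> real. 0 + (\<Sum>j\<in>Basis. (k j * (x \<bullet> j)) *\<^sub>R j)"
  have B: "Basis = {(1::real, 0::real), (0, 1)}"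
    by (auto simp: Basis_prod_def)
  have T: "?T x = (c * fst x, d * snd x)" for x
    unfolding B by (cases x) (simp add: k_def)
  have "lborel = density (distr lborel borel ?T) (\<lambda>_. ennreal (\<Prod>j\<in>Basis. \<bar>k j\<bar>))"
    using cd by (intro lborel_affine_euclidean) (auto simp: k_def)
  also have "(\<Prod>j\<in>Basis. \<bar>k j\<bar>) = c * d"
    unfolding B using cd by (simp add: k_def)
  finally have "(\<integral>x. h x \<partial>lborel) = (\<integral>x. h x \<partial>density (distr lborel borel ?T) (\<lambda>_. ennreal (c * d)))"
    by simp
  also have "\<dots> = c * d * (\<integral>x. h x \<partial>distr lborel borel ?T)"
    using h cd by (subst integral_density) (auto simp: mult_nonneg_nonneg)
  also have "(\<integral>x. h x \<partial>distr lborel borel ?T) = (\<integral>x. h (?T x) \<partial>lborel)"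
    using h by (subst integral_distr) auto
  finally show ?thesis
    unfolding T .
qed

text \<open>By Fubini it suffices to rescale each slice of constant s, with Jacobian c s times d s.
  Both factors are positive and at most 1, so the rescaled integrand keeps the bound M and a support
  in the unit cube; the slices outside 0 < s < 1 vanish on both sides.\<close>

lemma fibre_scaling:
  fixes K :: "real \<times> real \<times> real \<Rightarrow> real"
  assumes K: "K \<in> borel_measurable borel" and bd: "\<And>x. \<bar>K x\<bar> \<le> M"
    and supp: "\<And>s y z. K (s, y, z) \<noteq> 0 \<Longrightarrow> 0 < s \<and> s < 1 \<and> 0 \<le> y \<and> y \<le> c s \<and> 0 \<le> z \<and> z \<le> d s"
    and c: "c \<in> borel_measurable borel" "\<And>s. 0 < s \<Longrightarrow> s < 1 \<Longrightarrow> 0 < c s \<and> c s \<le> 1"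
    and d: "d \<in> borel_measurable borel" "\<And>s. 0 < s \<Longrightarrow> s < 1 \<Longrightarrow> 0 < d s \<and> d s \<le> 1"
  defines "K' \<equiv> \<lambda>x. indicator {0<..<1} (fst x) * (c (fst x) * d (fst x) *
    K (fst x, c (fst x) * fst (snd x), d (fst x) * snd (snd x)))"
  shows "integrable lborel K'" and "(\<integral>x. K x \<partial>lborel) = (\<integral>x. K' x \<partial>lborel)"
proof -
  have [measurable]: "K \<in> borel_measurable (borel \<Otimes>\<^sub>M (borel \<Otimes>\<^sub>M borel))"
    using K by (simp add: borel_prod)
  note c(1)[measurable] d(1)[measurable]
  have "K' \<in> borel_measurable (borel \<Otimes>\<^sub>M (borel \<Otimes>\<^sub>M borel))"
    unfolding K'_def by measurable
  then have K'm: "K' \<in> borel_measurable borel"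
    by (simp add: borel_prod)
  have M: "0 \<le> M"
    using bd[of 0] by linarith
  have supp': "0 \<le> fst x \<and> fst x \<le> 1 \<and> 0 \<le> fst (snd x) \<and> fst (snd x) \<le> 1 \<and> 0 \<le> snd (snd x) \<and> snd (snd x) \<le> 1"
    if "K' x \<noteq> 0" for x
  proof -
    obtain s y z where x: "x = (s, y, z)" by (metis surj_pair)
    have s: "0 < s" "s < 1"
      using that by (auto simp: K'_def x indicator_def split: if_splits)
    have "K (s, c s * y, d s * z) \<noteq> 0"
      using that by (auto simp: K'_def x)
    from supp[OF this] show ?thesis
      using c(2)[OF s] d(2)[OF s] by (auto simp: x zero_le_mult_iff mult_le_cancel_left1)
  qed
  have supp1: "0 \<le> fst x \<and> fst x \<le> 1 \<and> 0 \<le> fst (snd x) \<and> fst (snd x) \<le> 1 \<and> 0 \<le> snd (snd x) \<and> snd (snd x) \<le> 1"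
    if "K x \<noteq> 0" for x
  proof -
    obtain s y z where x: "x = (s, y, z)" by (metis surj_pair)
    have "K (s, y, z) \<noteq> 0" using that x by simp
    from supp[OF this] show ?thesis
      using c(2)[of s] d(2)[of s] by (auto simp: x)
  qed
  let ?C = "{0..1} \<times> {0..1} \<times> {0..1::real} :: (real \<times> real \<times> real) set"
  have C: "bounded ?C"
    by (intro bounded_Times) auto
  show intK': "integrable lborel K'"
  proof (rule integrable_bounded_support[OF K'm _ C])
    show "\<bar>K' x\<bar> \<le> M" for x
    proof (cases "0 < fst x \<and> fst x < 1")
      case True
      then have cd: "0 < c (fst x)" "c (fst x) \<le> 1" "0 < d (fst x)" "d (fst x) \<le> 1"
        using c(2)[of "fst x"] d(2)[of "fst x"] by auto
      then have "c (fst x) * d (fst x) \<le> 1 * 1"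
        by (intro mult_mono) auto
      then have "c (fst x) * d (fst x) * \<bar>K y\<bar> \<le> 1 * M" for y
        using bd cd M by (intro mult_mono) auto
      then show ?thesis
        using True c(2)[of "fst x"] d(2)[of "fst x"] by (simp add: K'_def abs_mult)
    qed (use M in \<open>auto simp: K'_def\<close>)
    show "x \<in> ?C" if "K' x \<noteq> 0" for x
      using supp'[OF that] by (cases x) auto
  qed
  have intK: "integrable lborel K"
  proof (rule integrable_bounded_support[OF K bd C])
    show "x \<in> ?C" if "K x \<noteq> 0" for x
      using supp1[OF that] by (cases x) auto
  qed
  have slice: "(\<lambda>x. K (s, x)) \<in> borel_measurable borel" for s
  proof -
    have "(\<lambda>x. K (s, x)) \<in> borel_measurable (borel \<Otimes>\<^sub>M borel)"
      by measurable
    then show ?thesis by (simp add: borel_prod)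
  qed
  have inner: "(\<integral>x. K (s, x) \<partial>lborel) = (\<integral>x. K' (s, x) \<partial>lborel)" for s
  proof (cases "0 < s \<and> s < 1")
    case True
    have "(\<integral>x. K (s, x) \<partial>lborel) = c s * d s * (\<integral>x. K (s, c s * fst x, d s * snd x) \<partial>lborel)"
      using integral_scale_pair[OF slice] True c(2) d(2) by simp
    then show ?thesis
      using True by (simp add: K'_def)
  next
    case False
    then have "K (s, x) = 0" "K' (s, x) = 0" for x
      using supp[of s "fst x" "snd x"] by (auto simp: K'_def)
    then show ?thesis by simp
  qed
  have "(\<integral>x. K x \<partial>lborel) = (\<integral>s. (\<integral>x. K (s, x) \<partial>lborel) \<partial>lborel)"
    using lborel_pair.integral_fst'[of K] intK by (simp add: lborel_prod)
  also have "\<dots> = (\<integral>s. (\<integral>x. K' (s, x) \<partial>lborel) \<partial>lborel)"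
    using inner by simp
  also have "\<dots> = (\<integral>x. K' x \<partial>lborel)"
    using lborel_pair.integral_fst'[of K'] intK' by (simp add: lborel_prod)
  finally show "(\<integral>x. K x \<partial>lborel) = (\<integral>x. K' x \<partial>lborel)" .
qed

lemma integral_separate:
  fixes a :: "'a::euclidean_space \<Rightarrow> real" and b :: "'b::euclidean_space \<Rightarrow> real"
  assumes "integrable lborel a" "integrable lborel b"
  shows "integrable lborel (\<lambda>x. a (fst x) * b (snd x))"
    and "(\<integral>x. a (fst x) * b (snd x) \<partial>lborel) = (\<integral>x. a x \<partial>lborel) * (\<integral>x. b x \<partial>lborel)"
proof -
  have [measurable]: "a \<in> borel_measurable borel" "b \<in> borel_measurable borel"
    using assms by auto
  have "integrable (lborel \<Otimes>\<^sub>M lborel) (\<lambda>(x, y). a x * b y)"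
  proof (rule lborel_pair.Fubini_integrable)
    show "(\<lambda>(x, y). a x * b y) \<in> borel_measurable (lborel \<Otimes>\<^sub>M lborel)"
      by measurable
    have "integrable lborel (\<lambda>x. \<bar>a x\<bar> * (\<integral>y. \<bar>b y\<bar> \<partial>lborel))"
      using assms by (intro integrable_mult_left integrable_abs)
    then show "integrable lborel (\<lambda>x. \<integral>y. norm (case (x, y) of (x, y) \<Rightarrow> a x * b y) \<partial>lborel)"
      by (simp add: abs_mult)
    show "AE x in lborel. integrable lborel (\<lambda>y. case (x, y) of (x, y) \<Rightarrow> a x * b y)"
      using assms by simp
  qed
  then have i: "integrable (lborel \<Otimes>\<^sub>M lborel) (\<lambda>x. a (fst x) * b (snd x))"
    by (simp add: case_prod_unfold)
  then show "integrable lborel (\<lambda>x. a (fst x) * b (snd x))"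
    by (simp add: lborel_prod)
  show "(\<integral>x. a (fst x) * b (snd x) \<partial>lborel) = (\<integral>x. a x \<partial>lborel) * (\<integral>x. b x \<partial>lborel)"
    using lborel_pair.integral_fst'[OF i] by (simp add: lborel_prod)
qed

lemma set_integral_power_open:
  "(\<integral>s. indicator {0<..<1} s * (s::real) ^ n \<partial>lborel) = 1 / (real n + 1)"
  "integrable lborel (\<lambda>s. indicator {0<..<1} s * s ^ n :: real)"
proof -
  show i: "integrable lborel (\<lambda>s. indicator {0<..<1} s * s ^ n :: real)"
  proof (rule integrable_bounded_support[of _ 1 "{0<..<1}"])
    show "\<bar>indicator {0<..<1} x * x ^ n\<bar> \<le> (1::real)" for x :: real
      by (auto simp: indicator_def power_le_one abs_mult)
  qed (auto simp: indicator_def split: if_splits)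
  have "(\<integral>s. indicator {0<..<1} s * (s::real) ^ n \<partial>lborel) = (LINT s:{0<..<1}|lborel. (s::real) ^ n)"
    by (simp add: set_lebesgue_integral_def)
  also have "\<dots> = integral {0<..<1} (\<lambda>s::real. s ^ n)"
    using i by (intro set_borel_integral_eq_integral) (simp add: set_integrable_def)
  also have "\<dots> = integral {0..1} (\<lambda>s::real. s ^ n)"
    using integral_open_interval_real[of 0 1 "\<lambda>s. s ^ n"] by simp
  also have "\<dots> = 1 / (real n + 1)"
  proof (rule integral_unique)
    have "((\<lambda>s. s ^ Suc n / (real n + 1)) has_real_derivative x ^ n) (at x within {0..1})" for x :: real
      using DERIV_cdivide[OF DERIV_pow[of "Suc n" x "{0..1}"], of "real n + 1"] by (simp add: add.commute)
    then have "((\<lambda>s. s ^ n) has_integral (1 ^ Suc n / (real n + 1) - 0 ^ Suc n / (real n + 1))) {0..1::real}"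
      by (intro fundamental_theorem_of_calculus)
        (auto simp: has_real_derivative_iff_has_vector_derivative[symmetric])
    then show "((\<lambda>s::real. s ^ n) has_integral 1 / (real n + 1)) {0..1}"
      by simp
  qed
  finally show "(\<integral>s. indicator {0<..<1} s * (s::real) ^ n \<partial>lborel) = 1 / (real n + 1)" .
qed

lemma convex_on_affine_image:
  assumes f: "convex_on ((\<lambda>x. p + A x) ` S) f" and A: "linear A" and S: "convex S"
  shows "convex_on S (\<lambda>x. f (p + A x))"
proof (rule convex_onI)
  fix t :: real and x y assume t: "0 < t" "t < 1" and xy: "x \<in> S" "y \<in> S"
  have "p + A ((1 - t) *\<^sub>R x + t *\<^sub>R y) = (1 - t) *\<^sub>R (p + A x) + t *\<^sub>R (p + A y)"
    using A by (simp add: linear_add linear_scale linear_diff scaleR_add_right scaleR_diff_left)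
  then show "f (p + A ((1 - t) *\<^sub>R x + t *\<^sub>R y)) \<le> (1 - t) * f (p + A x) + t * f (p + A y)"
    using convex_onD[OF f, of t "p + A x" "p + A y"] t xy by auto
qed (fact S)

text \<open>A convex function need not be Borel on the boundary of its domain, but it is continuous inside.\<close>

lemma convex_on_interior_integral:
  fixes f :: "'a::euclidean_space \<Rightarrow> real"
  assumes S: "polytope S" and f: "convex_on S f" and U: "open U" "U \<subseteq> S" "negligible (S - U)" "U \<noteq> {}"
  obtains M where "(\<lambda>x. indicator U x * f x) \<in> borel_measurable borel"
    "\<And>x. \<bar>indicator U x * f x\<bar> \<le> M" "integrable lborel (\<lambda>x. indicator U x * f x)"
    "integral S f = (\<integral>x. indicator U x * f x \<partial>lborel)" "continuous_on U f"
    "\<And>x. x \<in> S \<Longrightarrow> \<bar>f x\<bar> \<le> M"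
proof -
  have int: "U \<subseteq> interior S"
    using U interior_maximal by blast
  have "convex_on (interior S) f"
    using f polytope_imp_convex[OF S] interior_subset by (metis convex_on_subset convex_interior)
  then have cont: "continuous_on U f"
    using convex_on_continuous[OF open_interior] int continuous_on_subset by blast
  obtain M where M: "\<And>x. x \<in> S \<Longrightarrow> \<bar>f x\<bar> \<le> M"
    using convex_on_polytope_bounded[OF S f] int U(4) by blast
  have m: "(\<lambda>x. indicator U x * f x) \<in> borel_measurable borel"
    using borel_measurable_continuous_on_indicator[OF _ cont] U(1) by simp
  have b: "\<bar>indicator U x * f x\<bar> \<le> M" for x
    using M U(2,4) M[THEN order_trans[OF abs_ge_zero]] by (auto simp: indicator_def)
  have i: "integrable lborel (\<lambda>x. indicator U x * f x)"
    by (rule integrable_bounded_support[OF m b, of S])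
      (use polytope_imp_bounded[OF S] U(2) in \<open>auto simp: indicator_def split: if_splits\<close>)
  have "(\<integral>x. indicator U x * f x \<partial>lborel) = integral U f"
    using set_borel_integral_eq_integral(2)[of U f] i by (simp add: set_integrable_def set_lebesgue_integral_def)
  also have "\<dots> = integral S f"
  proof (rule integral_spike_set)
    show "negligible {x \<in> U - S. f x \<noteq> 0}" "negligible {x \<in> S - U. f x \<noteq> 0}"
      using U by (auto intro: negligible_subset)
  qed
  finally show ?thesis
    using that m b i cont M by metis
qed

subsection \<open>Hermite-Hadamard inequalities on a tetrahedron\<close>

text \<open>In a tetrahedron \<open>p0 p1 p2 p3\<close> the triple \<open>(s, y, z)\<close> of the cone region stands for the point
  \<open>p0 + s (p1 - p0) + y (p2 - p1) + z (p3 - p1)\<close>, that of the edge region for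
  \<open>p0 + s (p2 - p0) + y (p1 - p0) + z (p3 - p2)\<close>. In both cases the sections of constant \<open>s\<close> are
  rescaled copies of each other.\<close>

definition cone_region :: "(real \<times> real \<times> real) set" where
  "cone_region = {(s, y, z). 0 \<le> y \<and> 0 \<le> z \<and> y + z \<le> s \<and> s \<le> 1}"

definition open_triangle :: "(real \<times> real) set" where
  "open_triangle = {(y, z). 0 < y \<and> 0 < z \<and> y + z < 1}"

definition std_triangle :: "(real \<times> real) set" where
  "std_triangle = {(y, z). 0 \<le> y \<and> 0 \<le> z \<and> y + z \<le> 1}"

definition open_cone :: "(real \<times> real \<times> real) set" where
  "open_cone = {(s, y, z). 0 < y \<and> 0 < z \<and> y + z < s \<and> s < 1}"

definition edge_region :: "(real \<times> real \<times> real) set" where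
  "edge_region = {(s, y, z). 0 \<le> y \<and> y \<le> 1 - s \<and> 0 \<le> z \<and> z \<le> s}"

definition open_edge :: "(real \<times> real \<times> real) set" where
  "open_edge = {(s, y, z). 0 < y \<and> y < 1 - s \<and> 0 < z \<and> z < s}"

text \<open>The four points are the parameters of p0, p1, p2, p3, in this order; the same holds for
  the edge region below.\<close>

lemma cone_region_hull: "cone_region = convex hull {0, (1,0,0), (1,1,0), (1,0,1)}"
  unfolding convex_hull_zero_3
proof (intro equalityI subsetI)
  fix x assume "x \<in> cone_region"
  then show "x \<in> {\<alpha> *\<^sub>R (1,0,0) + \<beta> *\<^sub>R (1,1,0) + \<gamma> *\<^sub>R (1,0,1) | \<alpha> \<beta> \<gamma>. 0 \<le> \<alpha> \<and> 0 \<le> \<beta> \<and> 0 \<le> \<gamma> \<and> \<alpha> + \<beta> + \<gamma> \<le> 1}"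
    unfolding cone_region_def
    by (intro CollectI exI[of _ "fst x - fst (snd x) - snd (snd x)"] exI[of _ "fst (snd x)"] exI[of _ "snd (snd x)"]) auto
qed (auto simp: cone_region_def)

lemma edge_region_hull: "edge_region = convex hull {0, (0,1,0), (1,0,0), (1,0,1)}"
  unfolding convex_hull_zero_3
proof (intro equalityI subsetI)
  fix x assume "x \<in> edge_region"
  then show "x \<in> {\<alpha> *\<^sub>R (0,1,0) + \<beta> *\<^sub>R (1,0,0) + \<gamma> *\<^sub>R (1,0,1) | \<alpha> \<beta> \<gamma>. 0 \<le> \<alpha> \<and> 0 \<le> \<beta> \<and> 0 \<le> \<gamma> \<and> \<alpha> + \<beta> + \<gamma> \<le> 1}"
    unfolding edge_region_def
    by (intro CollectI exI[of _ "fst (snd x)"] exI[of _ "fst x - snd (snd x)"] exI[of _ "snd (snd x)"]) auto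
qed (auto simp: edge_region_def)

lemma std_triangle_hull: "std_triangle = convex hull {(0,0), (1,0), (0,1)}"
  unfolding convex_hull_3
proof (intro equalityI subsetI)
  fix x assume "x \<in> std_triangle"
  then show "x \<in> {u *\<^sub>R (0,0) + v *\<^sub>R (1,0) + w *\<^sub>R (0,1) | u v w. 0 \<le> u \<and> 0 \<le> v \<and> 0 \<le> w \<and> u + v + w = 1}"
    unfolding std_triangle_def
    by (intro CollectI exI[of _ "1 - fst x - snd x"] exI[of _ "fst x"] exI[of _ "snd x"]) auto
qed (auto simp: std_triangle_def)

lemma polytope_regions: "polytope cone_region" "polytope edge_region" "polytope std_triangle"
  unfolding cone_region_hull edge_region_hull std_triangle_hull by (auto simp: polytope_convex_hull)

lemma open_regions: "open open_cone" "open open_edge" "open open_triangle"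
  unfolding open_cone_def open_edge_def open_triangle_def case_prod_unfold
  by (intro open_Collect_conj open_Collect_less continuous_intros)+

lemma regions_sub: "open_cone \<subseteq> cone_region" "open_edge \<subseteq> edge_region" "open_triangle \<subseteq> std_triangle"
  by (auto simp: open_cone_def cone_region_def open_edge_def edge_region_def open_triangle_def std_triangle_def)

lemma regions_ne: "open_cone \<noteq> {}" "open_edge \<noteq> {}" "open_triangle \<noteq> {}"
proof -
  have "(1/2, 1/8, 1/8) \<in> open_cone" "(1/2, 1/8, 1/8) \<in> open_edge" "(1/8, 1/8) \<in> open_triangle"
    by (auto simp: open_cone_def open_edge_def open_triangle_def)
  then show "open_cone \<noteq> {}" "open_edge \<noteq> {}" "open_triangle \<noteq> {}" by auto
qed

lemma negligible_regions: "negligible (cone_region - open_cone)" "negligible (edge_region - open_edge)"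
  "negligible (std_triangle - open_triangle)"
proof -
  let ?H = "\<lambda>a b. {x :: real \<times> real \<times> real. a \<bullet> x = b}"
  have "negligible (?H (0,1,0) 0 \<union> ?H (0,0,1) 0 \<union> ?H (-1,1,1) 0 \<union> ?H (1,0,0) 1)"
    by (intro negligible_Un negligible_hyperplane) (auto simp: zero_prod_def)
  then show "negligible (cone_region - open_cone)"
    by (rule negligible_subset) (auto simp: cone_region_def open_cone_def)
  have "negligible (?H (0,1,0) 0 \<union> ?H (0,0,1) 0 \<union> ?H (1,1,0) 1 \<union> ?H (1,0,-1) 0)"
    by (intro negligible_Un negligible_hyperplane) (auto simp: zero_prod_def)
  then show "negligible (edge_region - open_edge)"
    by (rule negligible_subset) (auto simp: edge_region_def open_edge_def)
  let ?H = "\<lambda>a b. {x :: real \<times> real. a \<bullet> x = b}"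
  have "negligible (?H (1,0) 0 \<union> ?H (0,1) 0 \<union> ?H (1,1) 1)"
    by (intro negligible_Un negligible_hyperplane) (auto simp: zero_prod_def)
  then show "negligible (std_triangle - open_triangle)"
    by (rule negligible_subset) (auto simp: std_triangle_def open_triangle_def)
qed

lemmas cone_interior = convex_on_interior_integral[OF polytope_regions(1) _ open_regions(1) regions_sub(1) negligible_regions(1) regions_ne(1)]
lemmas edge_interior = convex_on_interior_integral[OF polytope_regions(2) _ open_regions(2) regions_sub(2) negligible_regions(2) regions_ne(2)]
lemmas triangle_interior = convex_on_interior_integral[OF polytope_regions(3) _ open_regions(3) regions_sub(3) negligible_regions(3) regions_ne(3)]

lemma convex_std_triangle: "convex std_triangle" and convex_cone_region: "convex cone_region"
  and convex_edge_region: "convex edge_region"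
  using polytope_regions polytope_imp_convex by auto

text \<open>The area is kept symbolic: it cancels from every average, for which its positivity is
  enough.\<close>

lemma std_triangle_measure: "(\<integral>x. indicator open_triangle x \<partial>lborel) = measure lebesgue std_triangle"
  "0 < measure lebesgue std_triangle" "integrable lborel (indicator open_triangle :: real \<times> real \<Rightarrow> real)"
proof -
  have "convex_on std_triangle (\<lambda>_. 1::real)"
    using convex_std_triangle by (simp add: convex_on_const)
  then obtain M where "integral std_triangle (\<lambda>_. 1::real) = (\<integral>x. indicator open_triangle x * 1 \<partial>lborel)"
    "integrable lborel (\<lambda>x. indicator open_triangle x * 1 :: real)"
    using triangle_interior by blast
  moreover have lm: "std_triangle \<in> lmeasurable"
    using polytope_regions(3) polytope_imp_compact lmeasurable_compact by blast
  then have "measure lebesgue std_triangle = integral std_triangle (\<lambda>_. 1::real)"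
    by (rule lmeasure_integral)
  ultimately show "(\<integral>x. indicator open_triangle x \<partial>lborel) = measure lebesgue std_triangle"
    "integrable lborel (indicator open_triangle :: real \<times> real \<Rightarrow> real)"
    by auto
  have "\<not> negligible std_triangle"
    using open_not_negligible[OF open_regions(3) regions_ne(3)] regions_sub(3) negligible_subset by blast
  then show "0 < measure lebesgue std_triangle"
    using lm negligible_iff_measure zero_less_measure_iff by blast
qed

text \<open>The slice at s is the standard triangle scaled by s, so substitution makes all slices
  equal at the price of the density s^2.\<close>

lemma cone_integral:
  assumes F: "convex_on cone_region F"
  defines "K \<equiv> \<lambda>x. indicator {0<..<1} (fst x) * (fst x)^2 * (indicator open_triangle (snd x) *
    F (fst x, fst x * fst (snd x), fst x * snd (snd x)))"
  shows "integrable lborel K" "integral cone_region F = (\<integral>x. K x \<partial>lborel)"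
proof -
  obtain M where M: "(\<lambda>x. indicator open_cone x * F x) \<in> borel_measurable borel"
    "\<And>x. \<bar>indicator open_cone x * F x\<bar> \<le> M"
    "integral cone_region F = (\<integral>x. indicator open_cone x * F x \<partial>lborel)"
    by (rule cone_interior[OF F]) (rule that; assumption)
  let ?L = "\<lambda>x. indicator open_cone x * F x"
  let ?K = "\<lambda>x. indicator {0<..<1} (fst x) * (fst x * fst x * ?L (fst x, fst x * fst (snd x), fst x * snd (snd x)))"
  have supp: "0 < s \<and> s < 1 \<and> 0 \<le> y \<and> y \<le> s \<and> 0 \<le> z \<and> z \<le> s" if "?L (s, y, z) \<noteq> 0" for s y z
  proof -
    have "(s, y, z) \<in> open_cone"
      using that by (metis indicator_simps(2) mult_zero_left)
    then show ?thesis
      by (auto simp: open_cone_def)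
  qed
  have "integrable lborel ?K" "(\<integral>x. ?L x \<partial>lborel) = (\<integral>x. ?K x \<partial>lborel)"
    by (rule fibre_scaling[where c = "\<lambda>s. s" and d = "\<lambda>s. s", OF M(1,2) supp]; simp)+
  moreover have "?K = K"
  proof
    fix x :: "real \<times> real \<times> real"
    obtain s y z where x: "x = (s, y, z)" by (metis surj_pair)
    have "(s, s * y, s * z) \<in> open_cone \<longleftrightarrow> (y, z) \<in> open_triangle" if "0 < s" "s < 1"
    proof -
      have "s * y + s * z < s \<longleftrightarrow> s * (y + z) < s * 1"
        by (simp add: distrib_left)
      also have "\<dots> \<longleftrightarrow> y + z < 1"
        using that by (simp only: mult_less_cancel_left_pos)
      finally show ?thesis
        using that by (auto simp: open_cone_def open_triangle_def zero_less_mult_iff)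
    qed
    then show "?K x = K x"
      by (auto simp: K_def x indicator_def power2_eq_square)
  qed
  ultimately show "integrable lborel K" "integral cone_region F = (\<integral>x. K x \<partial>lborel)"
    using M(3) by auto
qed

text \<open>The slice at s is a rectangle with sides 1 - s and s; scaled to the unit square it
  leaves the density s (1 - s).\<close>

lemma edge_integral:
  assumes F: "convex_on edge_region F"
  defines "K \<equiv> \<lambda>x. indicator {0<..<1} (fst x) * ((1 - fst x) * fst x) * (indicator {0<..<1} (fst (snd x)) *
    indicator {0<..<1} (snd (snd x)) * F (fst x, (1 - fst x) * fst (snd x), fst x * snd (snd x)))"
  shows "integrable lborel K" "integral edge_region F = (\<integral>x. K x \<partial>lborel)"
proof -
  obtain M where M: "(\<lambda>x. indicator open_edge x * F x) \<in> borel_measurable borel"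
    "\<And>x. \<bar>indicator open_edge x * F x\<bar> \<le> M"
    "integral edge_region F = (\<integral>x. indicator open_edge x * F x \<partial>lborel)"
    by (rule edge_interior[OF F]) (rule that; assumption)
  let ?L = "\<lambda>x. indicator open_edge x * F x"
  let ?K = "\<lambda>x. indicator {0<..<1} (fst x) * ((1 - fst x) * fst x * ?L (fst x, (1 - fst x) * fst (snd x), fst x * snd (snd x)))"
  have supp: "0 < s \<and> s < 1 \<and> 0 \<le> y \<and> y \<le> 1 - s \<and> 0 \<le> z \<and> z \<le> s" if "?L (s, y, z) \<noteq> 0" for s y z
  proof -
    have "(s, y, z) \<in> open_edge"
      using that by (metis indicator_simps(2) mult_zero_left)
    then show ?thesis
      by (auto simp: open_edge_def)
  qed
  have "integrable lborel ?K" "(\<integral>x. ?L x \<partial>lborel) = (\<integral>x. ?K x \<partial>lborel)"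
    by (rule fibre_scaling[where c = "\<lambda>s. 1 - s" and d = "\<lambda>s. s", OF M(1,2) supp]; simp)+
  moreover have "?K = K"
  proof
    fix x :: "real \<times> real \<times> real"
    obtain s y z where x: "x = (s, y, z)" by (metis surj_pair)
    have "(s, (1 - s) * y, s * z) \<in> open_edge \<longleftrightarrow> 0 < y \<and> y < 1 \<and> 0 < z \<and> z < 1" if "0 < s" "s < 1"
      using that mult_less_cancel_left_pos[of "1 - s" y 1] mult_less_cancel_left_pos[of s z 1]
      by (auto simp: open_edge_def zero_less_mult_iff)
    then show "?K x = K x"
      by (auto simp: K_def x indicator_def)
  qed
  ultimately show "integrable lborel K" "integral edge_region F = (\<integral>x. K x \<partial>lborel)"
    using M(3) by auto
qed

section \<open>Inequalities in the parameter regions\<close>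

lemma convex_on_affine_comp:
  assumes "convex_on S f" "linear A" "convex T" "\<And>x. x \<in> T \<Longrightarrow> p + A x \<in> S"
  shows "convex_on T (\<lambda>x. f (p + A x))"
  using assms by (intro convex_on_affine_image) (auto intro: convex_on_subset convex_affinity
      simp: convex_translation_eq convex_linear_image image_image[symmetric, of _ _ T] image_subset_iff)

text \<open>The integral of s^2 over the unit interval is 1/3, the usual factor in the volume of a
  cone.\<close>

lemma cone_region_measure: "3 * measure lebesgue cone_region = measure lebesgue std_triangle"
proof -
  have lm: "cone_region \<in> lmeasurable"
    using polytope_regions(1) polytope_imp_compact lmeasurable_compact by blast
  have "convex_on cone_region (\<lambda>_. 1::real)"
    using convex_cone_region by (simp add: convex_on_const)
  note cone_integral(2)[OF this]
  also have "(\<lambda>x. indicator {0<..<1} (fst x) * (fst x)\<^sup>2 * (indicator open_triangle (snd x) * 1)) =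
      (\<lambda>x. (indicator {0<..<1} (fst x) * (fst x)\<^sup>2) * (indicator open_triangle (snd x) :: real))"
    by simp
  also have "(\<integral>x. (indicator {0<..<1} (fst x) * (fst x)\<^sup>2) * (indicator open_triangle (snd x) :: real) \<partial>lborel)
      = (1 / 3) * measure lebesgue std_triangle"
    using integral_separate(2)[OF set_integral_power_open(2)[of 2] std_triangle_measure(3)]
      set_integral_power_open(1)[of 2] std_triangle_measure(1) by simp
  finally show ?thesis
    using lmeasure_integral[OF lm] by simp
qed

definition triangle_avg :: "(real \<times> real \<Rightarrow> real) \<Rightarrow> real" where
  "triangle_avg H = integral std_triangle H / measure lebesgue std_triangle"

text \<open>Convexity on the segment from the tip to a point of the base gives weights 1 - s and s.
  Against the density s^2 these integrate to 1/12 and 1/4, and the volume, one third of the base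
  area, turns this into 1/4 and 3/4.\<close>

lemma cone_upper:
  assumes F: "convex_on cone_region F"
  shows "integral cone_region F / measure lebesgue cone_region \<le>
    (1/4) * F 0 + (3/4) * triangle_avg (\<lambda>(y, z). F (1, y, z))"
proof -
  let ?H = "\<lambda>x. F (1, fst x, snd x)"
  have "convex_on std_triangle (\<lambda>x. F ((1, 0, 0) + (\<lambda>x. (0, fst x, snd x)) x))"
    using F convex_std_triangle by (intro convex_on_affine_comp[where S = cone_region] linearI)
      (auto simp: std_triangle_def cone_region_def)
  then have H: "convex_on std_triangle ?H"
    by (simp add: case_prod_unfold zero_prod_def[symmetric])
  obtain M where M: "integrable lborel (\<lambda>x. indicator open_triangle x * ?H x)"
    "integral std_triangle ?H = (\<integral>x. indicator open_triangle x * ?H x \<partial>lborel)"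
    by (rule triangle_interior[OF H]) (rule that; assumption)
  let ?K = "\<lambda>x. indicator {0<..<1} (fst x) * (fst x)^2 * (indicator open_triangle (snd x) *
    F (fst x, fst x * fst (snd x), fst x * snd (snd x)))"
  let ?a1 = "\<lambda>s::real. indicator {0<..<1} s * s^2 - indicator {0<..<1} s * s^3"
  let ?b1 = "\<lambda>x. indicator open_triangle x * F 0"
  let ?a2 = "\<lambda>s::real. indicator {0<..<1} s * s^3"
  let ?b2 = "\<lambda>x. indicator open_triangle x * ?H x"
  let ?R = "\<lambda>x. ?a1 (fst x) * ?b1 (snd x) + ?a2 (fst x) * ?b2 (snd x)"
  have a1: "integrable lborel ?a1"
    using set_integral_power_open(2)[of 2] set_integral_power_open(2)[of 3] by simp
  have a1i: "(\<integral>s. ?a1 s \<partial>lborel) = 1/12"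
    using set_integral_power_open[of 2] set_integral_power_open[of 3] by simp
  have b1: "integrable lborel ?b1" "(\<integral>x. ?b1 x \<partial>lborel) = measure lebesgue std_triangle * F 0"
    using std_triangle_measure(1,3) by auto
  have i1: "integrable lborel (\<lambda>x. ?a1 (fst x) * ?b1 (snd x))"
    and i2: "integrable lborel (\<lambda>x. ?a2 (fst x) * ?b2 (snd x))"
    using integral_separate(1)[OF a1 b1(1)] integral_separate(1)[OF set_integral_power_open(2)[of 3] M(1)] by auto
  have "integral cone_region F = (\<integral>x. ?K x \<partial>lborel)"
    using cone_integral(2)[OF F] .
  also have "\<dots> \<le> (\<integral>x. ?R x \<partial>lborel)"
  proof (rule integral_mono)
    show "integrable lborel ?K"
      using cone_integral(1)[OF F] .
    show "integrable lborel ?R"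
      using i1 i2 by (rule Bochner_Integration.integrable_add)
    fix x :: "real \<times> real \<times> real"
    obtain s y z where x: "x = (s, y, z)" by (metis surj_pair)
    show "?K x \<le> ?R x"
    proof (cases "0 < s \<and> s < 1 \<and> (y, z) \<in> open_triangle")
      case True
      have "(1 - s) *\<^sub>R 0 + s *\<^sub>R (1, y, z) = (s, s * y, s * z)"
        by simp
      then have "F (s, s * y, s * z) \<le> (1 - s) * F 0 + s * F (1, y, z)"
        using convex_onD[OF F, of s 0 "(1, y, z)"] True
        by (auto simp: cone_region_def open_triangle_def zero_prod_def)
      then have "s^2 * F (s, s * y, s * z) \<le> s^2 * ((1 - s) * F 0 + s * F (1, y, z))"
        by (intro mult_left_mono) auto
      also have "\<dots> = (s^2 - s^3) * F 0 + s^3 * F (1, y, z)"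
        by (simp add: algebra_simps power2_eq_square power3_eq_cube)
      finally show ?thesis
        using True by (simp add: x)
    qed (auto simp: x)
  qed
  also have "\<dots> = 1/12 * (measure lebesgue std_triangle * F 0) + 1/4 * integral std_triangle ?H"
    unfolding Bochner_Integration.integral_add[OF i1 i2]
      integral_separate(2)[OF a1 b1(1)] integral_separate(2)[OF set_integral_power_open(2)[of 3] M(1)]
      a1i b1(2) M(2)[symmetric] set_integral_power_open(1) by simp
  finally have le: "integral cone_region F \<le> 1/12 * (measure lebesgue std_triangle * F 0) + 1/4 * integral std_triangle ?H" .
  have m: "measure lebesgue cone_region = measure lebesgue std_triangle / 3"
    using cone_region_measure by simp
  have "(\<lambda>(y, z). F (1, y, z)) = ?H" by auto
  then show ?thesis
    unfolding m triangle_avg_def using le std_triangle_measure(2) by (simp add: field_simps)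
qed

lemma cone_lower:
  assumes F: "convex_on cone_region F"
  shows "triangle_avg (\<lambda>(y, z). F (3/4, 3/4 * y, 3/4 * z)) \<le> integral cone_region F / measure lebesgue cone_region"
proof -
  let ?H = "\<lambda>x. F (3/4, 3/4 * fst x, 3/4 * snd x)"
  have "convex_on std_triangle (\<lambda>x. F ((3/4, 0, 0) + (\<lambda>x. (0, 3/4 * fst x, 3/4 * snd x)) x))"
    using F convex_std_triangle by (intro convex_on_affine_comp[where S = cone_region] linearI)
      (auto simp: std_triangle_def cone_region_def algebra_simps)
  then have H: "convex_on std_triangle ?H"
    by (simp add: case_prod_unfold)
  obtain M where M: "integrable lborel (\<lambda>x. indicator open_triangle x * ?H x)"
    "integral std_triangle ?H = (\<integral>x. indicator open_triangle x * ?H x \<partial>lborel)"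
    by (rule triangle_interior[OF H]) (rule that; assumption)
  obtain N where N: "(\<lambda>x. indicator open_cone x * F x) \<in> borel_measurable borel" "continuous_on open_cone F"
    "\<And>x. x \<in> cone_region \<Longrightarrow> \<bar>F x\<bar> \<le> N"
    by (rule cone_interior[OF F]) (rule that; assumption)
  let ?K = "\<lambda>x. indicator {0<..<1} (fst x) * (fst x)^2 * (indicator open_triangle (snd x) *
    F (fst x, fst x * fst (snd x), fst x * snd (snd x)))"
  have iK: "integrable lborel ?K"
    using cone_integral(1)[OF F] .
  then have iK': "integrable (lborel \<Otimes>\<^sub>M lborel) (case_prod (\<lambda>s x. ?K (s, x)))"
    by (simp add: lborel_prod case_prod_unfold)
  \<comment> \<open>Jensen's inequality on each ray: 3/4 is the mean of the density \<open>3 s\<^sup>2\<close> on the unit interval.\<close>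
  have ray: "(1/3) * (indicator open_triangle x * ?H x) \<le> (\<integral>s. ?K (s, x) \<partial>lborel)" for x
  proof (cases "x \<in> open_triangle")
    case True
    obtain y z where x: "x = (y, z)" by (metis surj_pair)
    let ?\<phi> = "\<lambda>s. F (s, s * y, s * z)"
    have sub: "(s, s * y, s * z) \<in> open_cone" if "0 < s" "s < 1" for s
    proof -
      have "s * (y + z) < s * 1"
        using True that by (intro mult_strict_left_mono) (auto simp: x open_triangle_def)
      then show ?thesis
        using True that by (auto simp: x open_triangle_def open_cone_def distrib_left)
    qed
    have "convex_on {0..1} (\<lambda>s. F (0 + (\<lambda>s. s *\<^sub>R (1, y, z)) s))"
    proof (rule convex_on_affine_comp[OF F])
      show "0 + s *\<^sub>R (1, y, z) \<in> cone_region" if "s \<in> {0..1}" for s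
        using that sub[of s] regions_sub(1) True
        by (cases "s = 0 \<or> s = 1") (auto simp: cone_region_def x open_triangle_def zero_prod_def)
    qed (auto intro!: linearI simp: algebra_simps)
    then have "convex_on {0..1} ?\<phi>"
      by simp
    \<comment> \<open>\<open>k\<close> is the slope of a supporting line at 3/4. Its contribution
      vanishes, since s^2 (s - 3/4) integrates to 1/4 - (3/4) (1/3) = 0.\<close>
    then obtain k where k: "\<And>s. s \<in> {0..1} \<Longrightarrow> ?\<phi> (3/4) + k * (s - 3/4) \<le> ?\<phi> s"
      using convex_le_Inf_differential[of "{0..1}" ?\<phi> "3/4"] by (simp add: interior_atLeastAtMost_real) blast
    let ?i = "indicator {0<..<1} :: real \<Rightarrow> real"
    let ?c = "?\<phi> (3/4) - k * (3/4)"
    have eq: "(\<lambda>s. ?i s * s^2 * (?\<phi> (3/4) + k * (s - 3/4))) = (\<lambda>s. ?c * (?i s * s^2) + k * (?i s * s^3))"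
      by (auto simp: algebra_simps power2_eq_square power3_eq_cube)
    have int: "integrable lborel (\<lambda>s. ?i s * s^2 * ?\<phi> s)"
    proof (rule integrable_bounded_support[of _ "\<bar>N\<bar>" "{0<..<1}"])
      have "continuous_on {0<..<1} (\<lambda>s. s^2 * ?\<phi> s)"
        by (intro continuous_intros continuous_on_compose2[OF N(2)]) (auto simp: sub)
      then show "(\<lambda>s. ?i s * s^2 * ?\<phi> s) \<in> borel_measurable borel"
        using borel_measurable_continuous_on_indicator[of "{0<..<1}" "\<lambda>s. s^2 * ?\<phi> s"] by (simp add: mult.assoc)
      show "\<bar>?i s * s^2 * ?\<phi> s\<bar> \<le> \<bar>N\<bar>" for s
      proof (cases "s \<in> {0<..<1}")
        case True
        then have "s^2 * \<bar>?\<phi> s\<bar> \<le> 1 * \<bar>N\<bar>"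
          using N(3)[of "(s, s * y, s * z)"] sub[of s] regions_sub(1)
          by (intro mult_mono) (auto simp: power_le_one)
        then show ?thesis
          using True by (simp add: abs_mult)
      qed auto
    qed (auto simp: indicator_def split: if_splits)
    have "(1/3) * ?\<phi> (3/4) = (\<integral>s. ?i s * s^2 * (?\<phi> (3/4) + k * (s - 3/4)) \<partial>lborel)"
    proof -
      note I = set_integral_power_open(2)[of 2] set_integral_power_open(2)[of 3]
      have "(\<integral>s. ?c * (?i s * s^2) + k * (?i s * s^3) \<partial>lborel)
          = ?c * (\<integral>s. ?i s * s^2 \<partial>lborel) + k * (\<integral>s. ?i s * s^3 \<partial>lborel)"
        using I by simp
      then show ?thesis
        unfolding eq set_integral_power_open(1) by (simp add: field_simps)
    qed
    also have "\<dots> \<le> (\<integral>s. ?i s * s^2 * ?\<phi> s \<partial>lborel)"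
    proof (rule integral_mono[OF _ int])
      show "integrable lborel (\<lambda>s. ?i s * s^2 * (?\<phi> (3/4) + k * (s - 3/4)))"
        unfolding eq using set_integral_power_open(2)[of 2] set_integral_power_open(2)[of 3] by simp
      show "?i s * s^2 * (?\<phi> (3/4) + k * (s - 3/4)) \<le> ?i s * s^2 * ?\<phi> s" for s
        using k[of s] by (cases "s \<in> {0<..<1}") (auto intro!: mult_left_mono)
    qed
    finally show ?thesis
      using True by (simp add: x)
  qed simp
  have "(1/3) * integral std_triangle ?H = (\<integral>x. (1/3) * (indicator open_triangle x * ?H x) \<partial>lborel)"
    using M by simp
  also have "\<dots> \<le> (\<integral>x. (\<integral>s. ?K (s, x) \<partial>lborel) \<partial>lborel)"
  proof (rule integral_mono)
    show "integrable lborel (\<lambda>x. (1/3) * (indicator open_triangle x * ?H x))"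
      using M(1) by simp
    show "integrable lborel (\<lambda>x. \<integral>s. ?K (s, x) \<partial>lborel)"
      using lborel_pair.integrable_snd[OF iK'] .
  qed (rule ray)
  also have "\<dots> = (\<integral>x. ?K x \<partial>lborel)"
    using lborel_pair.integral_snd[OF iK'] by (simp add: lborel_prod case_prod_unfold)
  also have "\<dots> = integral cone_region F"
    using cone_integral(2)[OF F] by simp
  finally have le: "(1/3) * integral std_triangle ?H \<le> integral cone_region F" .
  have m: "measure lebesgue cone_region = measure lebesgue std_triangle / 3"
    using cone_region_measure by simp
  have "(\<lambda>(y, z). F (3/4, 3/4 * y, 3/4 * z)) = ?H" by auto
  then show ?thesis
    unfolding m triangle_avg_def using le std_triangle_measure(2) by (simp add: divide_right_mono)
qed

text \<open>Convexity between a point of one edge and a point of the opposite edge gives weights 1 -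
  s and s. Against the density s (1 - s) both integrate to 1/12, half of the volume 1/6.\<close>

lemma edge_upper:
  assumes F: "convex_on edge_region F"
  shows "integral edge_region F / measure lebesgue edge_region \<le>
    (1/2) * integral {0..1} (\<lambda>y. F (0, y, 0)) + (1/2) * integral {0..1} (\<lambda>z. F (1, 0, z))"
proof -
  have lin: "linear (\<lambda>y::real. (0::real, y, 0::real))" "linear (\<lambda>z::real. (0::real, 0::real, z))"
    by (auto intro: linearI)
  have "convex_on {0..1} (\<lambda>y. F (0 + (\<lambda>y::real. (0::real, y, 0::real)) y))"
    "convex_on {0..1} (\<lambda>z. F ((1, 0, 0) + (\<lambda>z::real. (0::real, 0::real, z)) z))"
    by (rule convex_on_affine_comp[OF F lin(1)]; auto simp: edge_region_def)
       (rule convex_on_affine_comp[OF F lin(2)]; auto simp: edge_region_def)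
  then have G: "convex_on {0..1} (\<lambda>y. F (0, y, 0))" "convex_on {0..1} (\<lambda>z. F (1, 0, z))"
    by simp_all
  have poly: "polytope {0..1::real}"
    using polytope_interval[of 0 "1::real"] by simp
  have neg: "negligible ({0..1} - {0<..<1::real})"
  proof -
    have "{0..1} - {0<..<1::real} = {0, 1}" by auto
    then show ?thesis by simp
  qed
  note interval_interior = convex_on_interior_integral[OF poly _ open_greaterThanLessThan _ neg]
  let ?i = "indicator {0<..<1} :: real \<Rightarrow> real"
  have sub: "{0<..<1::real} \<subseteq> {0..1}" "{0<..<1::real} \<noteq> {}" by auto
  obtain M1 where M1: "integrable lborel (\<lambda>y. ?i y * F (0, y, 0))"
    "integral {0..1} (\<lambda>y. F (0, y, 0)) = (\<integral>y. ?i y * F (0, y, 0) \<partial>lborel)"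
    by (rule interval_interior[OF G(1) sub]) (rule that; assumption)
  obtain M2 where M2: "integrable lborel (\<lambda>y. ?i y * F (1, 0, y))"
    "integral {0..1} (\<lambda>y. F (1, 0, y)) = (\<integral>y. ?i y * F (1, 0, y) \<partial>lborel)"
    by (rule interval_interior[OF G(2) sub]) (rule that; assumption)
  have one: "integrable lborel ?i" "(\<integral>y. ?i y \<partial>lborel) = 1"
    using set_integral_power_open[of 0] by simp_all
  let ?w = "\<lambda>s::real. ?i s * s^1 - ?i s * s^2"
  \<comment> \<open>The product s (1 - s)^2 expanded into powers, so that each term is one of the
    known moments; the two neighbouring abbreviations are s (1 - s) and s^2 (1 - s) in the same
    form.\<close>
  let ?a1 = "\<lambda>s::real. ?i s * s^1 - 2 * (?i s * s^2) + ?i s * s^3"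
  let ?a2 = "\<lambda>s::real. ?i s * s^2 - ?i s * s^3"
  let ?b1 = "\<lambda>x. (?i (fst x) * F (0, fst x, 0)) * ?i (snd x)"
  let ?b2 = "\<lambda>x. ?i (fst x) * (?i (snd x) * F (1, 0, snd x))"
  have w: "integrable lborel ?w" "integrable lborel ?a1" "integrable lborel ?a2"
    "(\<integral>s. ?w s \<partial>lborel) = 1/6" "(\<integral>s. ?a1 s \<partial>lborel) = 1/12" "(\<integral>s. ?a2 s \<partial>lborel) = 1/12"
    using set_integral_power_open[of 1] set_integral_power_open[of 2] set_integral_power_open[of 3] by simp_all
  note b1 = integral_separate[OF M1(1) one(1)] and b2 = integral_separate[OF one(1) M2(1)]
    and b3 = integral_separate[OF one(1) one(1)]
  let ?R = "\<lambda>x. ?a1 (fst x) * ?b1 (snd x) + ?a2 (fst x) * ?b2 (snd x)"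
  note i1 = integral_separate[OF w(2) b1(1)] and i2 = integral_separate[OF w(3) b2(1)]
    and i3 = integral_separate[OF w(1) b3(1)]
  let ?K = "\<lambda>x. ?i (fst x) * ((1 - fst x) * fst x) * (?i (fst (snd x)) *
    ?i (snd (snd x)) * F (fst x, (1 - fst x) * fst (snd x), fst x * snd (snd x)))"
  have lm: "edge_region \<in> lmeasurable"
    using polytope_regions(2) polytope_imp_compact lmeasurable_compact by blast
  have "convex_on edge_region (\<lambda>_. 1::real)"
    using convex_edge_region by (simp add: convex_on_const)
  note edge_integral(2)[OF this]
  also have "(\<lambda>x. ?i (fst x) * ((1 - fst x) * fst x) * (?i (fst (snd x)) * ?i (snd (snd x)) * 1))
      = (\<lambda>x. ?w (fst x) * (?i (fst (snd x)) * ?i (snd (snd x))))"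
    by (auto simp: algebra_simps power2_eq_square)
  also have "(\<integral>x. ?w (fst x) * (?i (fst (snd x)) * ?i (snd (snd x))) \<partial>lborel) = 1/6"
    unfolding i3(2) b3(2) one(2) w(4) by simp
  finally have meas: "measure lebesgue edge_region = 1/6"
    using lmeasure_integral[OF lm] by simp
  have "integral edge_region F = (\<integral>x. ?K x \<partial>lborel)"
    using edge_integral(2)[OF F] .
  also have "\<dots> \<le> (\<integral>x. ?R x \<partial>lborel)"
  proof (rule integral_mono)
    show "integrable lborel ?K"
      using edge_integral(1)[OF F] .
    show "integrable lborel ?R"
      using i1(1) i2(1) by (rule Bochner_Integration.integrable_add)
    fix x :: "real \<times> real \<times> real"
    obtain s y z where x: "x = (s, y, z)" by (metis surj_pair)
    show "?K x \<le> ?R x"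
    proof (cases "s \<in> {0<..<1} \<and> y \<in> {0<..<1} \<and> z \<in> {0<..<1}")
      case True
      have "(1 - s) *\<^sub>R (0, y, 0) + s *\<^sub>R (1, 0, z) = (s, (1 - s) * y, s * z)"
        by simp
      then have "F (s, (1 - s) * y, s * z) \<le> (1 - s) * F (0, y, 0) + s * F (1, 0, z)"
        using convex_onD[OF F, of s "(0, y, 0)" "(1, 0, z)"] True by (auto simp: edge_region_def)
      then have "(1 - s) * s * F (s, (1 - s) * y, s * z) \<le> (1 - s) * s * ((1 - s) * F (0, y, 0) + s * F (1, 0, z))"
        using True by (intro mult_left_mono) auto
      also have "\<dots> = (s^1 - 2 * s^2 + s^3) * F (0, y, 0) + (s^2 - s^3) * F (1, 0, z)"
        by (simp add: algebra_simps power2_eq_square power3_eq_cube)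
      finally show ?thesis
        using True by (simp add: x)
    qed (auto simp: x)
  qed
  also have "\<dots> = 1/12 * integral {0..1} (\<lambda>y. F (0, y, 0)) + 1/12 * integral {0..1} (\<lambda>z. F (1, 0, z))"
    unfolding Bochner_Integration.integral_add[OF i1(1) i2(1)] i1(2) i2(2) b1(2) b2(2) w one(2) M1(2) M2(2) by simp
  finally show ?thesis
    unfolding meas by simp
qed

text \<open>The Jacobian appears only as a positive constant d, chosen before the integrand: it
  cancels when the integral of f is divided by that of 1.\<close>

lemma integral_param3:
  fixes p u1 u2 u3 :: "real^3"
  assumes ind: "\<And>s y z. s *\<^sub>R u1 + y *\<^sub>R u2 + z *\<^sub>R u3 = 0 \<Longrightarrow> s = 0 \<and> y = 0 \<and> z = 0"
    and P: "bounded P"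
  obtains d where "0 < d" "\<And>f :: real^3 \<Rightarrow> real.
    f absolutely_integrable_on ((\<lambda>t. p + (fst t *\<^sub>R u1 + fst (snd t) *\<^sub>R u2 + snd (snd t) *\<^sub>R u3)) ` P) \<Longrightarrow>
    integral ((\<lambda>t. p + (fst t *\<^sub>R u1 + fst (snd t) *\<^sub>R u2 + snd (snd t) *\<^sub>R u3)) ` P) f =
    d * integral P (\<lambda>t. f (p + (fst t *\<^sub>R u1 + fst (snd t) *\<^sub>R u2 + snd (snd t) *\<^sub>R u3)))"
proof -
  define A where "A x = x$1 *\<^sub>R u1 + x$2 *\<^sub>R u2 + x$3 *\<^sub>R u3" for x :: "real^3"
  define \<phi> where "\<phi> = (\<lambda>(x, y, z). vector [x, y, z] :: real^3)"
  have A: "linear A"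
  proof (intro linearI)
    show "A (x + y) = A x + A y" for x y
      unfolding A_def vector_add_component scaleR_add_left by (simp only: add_ac)
    show "A (r *\<^sub>R x) = r *\<^sub>R A x" for r x
      unfolding A_def vector_scaleR_component scaleR_add_right scaleR_scaleR real_scaleR_def ..
  qed
  have inj: "inj A"
    unfolding linear_injective_0[OF A]
  proof (intro allI impI)
    fix x assume "A x = 0"
    then have "x $ 1 = 0 \<and> x $ 2 = 0 \<and> x $ 3 = 0"
      unfolding A_def by (rule ind)
    then show "x = 0"
      by (simp only: vec_eq_iff forall_3 zero_index)
  qed
  have A\<phi>: "p + (fst t *\<^sub>R u1 + fst (snd t) *\<^sub>R u2 + snd (snd t) *\<^sub>R u3) = p + A (\<phi> t)" for t
    by (simp add: A_def \<phi>_def case_prod_unfold)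
  have lin: "linear \<phi>"
    unfolding \<phi>_def by (rule linear_vector_triple)
  have "bounded (\<phi> ` P)"
    using P lin bounded_linear_image linear_conv_bounded_linear by blast
  show ?thesis
  proof (rule that)
    show "0 < \<bar>det (matrix A)\<bar>"
      using A inj det_nz_iff_inj by auto
    fix f :: "real^3 \<Rightarrow> real"
    assume "f absolutely_integrable_on ((\<lambda>t. p + (fst t *\<^sub>R u1 + fst (snd t) *\<^sub>R u2 + snd (snd t) *\<^sub>R u3)) ` P)"
    then have f: "f absolutely_integrable_on ((\<lambda>x. p + A x) ` \<phi> ` P)"
      by (simp add: A\<phi> image_image)
    note cv = affine_change_of_variables[OF A inj f]
    have "((\<lambda>x. f (p + A x)) has_integral integral (\<phi> ` P) (\<lambda>x. f (p + A x))) (\<phi> ` P)"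
      using cv(1) by (intro integrable_integral) (auto simp: absolutely_integrable_on_def)
    from has_integral_triple[OF \<open>bounded (\<phi> ` P)\<close> this]
    have "((\<lambda>t. f (p + A (\<phi> t))) has_integral integral (\<phi> ` P) (\<lambda>x. f (p + A x))) {t. \<phi> t \<in> \<phi> ` P}"
      by (simp add: \<phi>_def case_prod_unfold)
    moreover have "{t. \<phi> t \<in> \<phi> ` P} = P"
      by (force simp: \<phi>_def vec_eq_iff forall_3)
    ultimately have "integral P (\<lambda>t. f (p + A (\<phi> t))) = integral (\<phi> ` P) (\<lambda>x. f (p + A x))"
      by (simp add: integral_unique)
    then show "integral ((\<lambda>t. p + (fst t *\<^sub>R u1 + fst (snd t) *\<^sub>R u2 + snd (snd t) *\<^sub>R u3)) ` P) f =
      \<bar>det (matrix A)\<bar> * integral P (\<lambda>t. f (p + (fst t *\<^sub>R u1 + fst (snd t) *\<^sub>R u2 + snd (snd t) *\<^sub>R u3)))"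
      using cv(2) by (simp add: A\<phi> image_image)
  qed
qed

lemma avg_vol_param3:
  fixes p u1 u2 u3 :: "real^3" and f :: "real^3 \<Rightarrow> real"
  assumes ind: "\<And>s y z. s *\<^sub>R u1 + y *\<^sub>R u2 + z *\<^sub>R u3 = 0 \<Longrightarrow> s = 0 \<and> y = 0 \<and> z = 0"
    and P: "polytope P"
  defines "x \<equiv> \<lambda>t. p + (fst t *\<^sub>R u1 + fst (snd t) *\<^sub>R u2 + snd (snd t) *\<^sub>R u3)"
  assumes f: "convex_on (x ` P) f"
  shows "convex_on P (\<lambda>t. f (x t))" "avg_vol f (x ` P) = integral P (\<lambda>t. f (x t)) / measure lebesgue P"
proof -
  let ?A = "\<lambda>t. fst t *\<^sub>R u1 + fst (snd t) *\<^sub>R u2 + snd (snd t) *\<^sub>R u3"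
  have A: "linear ?A"
    by (intro linearI) (auto simp: algebra_simps)
  show "convex_on P (\<lambda>t. f (x t))"
    using convex_on_affine_image[OF _ A, of p P f] f polytope_imp_convex[OF P] by (simp add: x_def)
  have X: "polytope (x ` P)"
    using polytope_linear_image[OF A P] polytope_translation_eq[of p "?A ` P"] by (simp add: x_def image_image)
  obtain d where d: "0 < d" "\<And>f :: real^3 \<Rightarrow> real. f absolutely_integrable_on (x ` P) \<Longrightarrow> integral (x ` P) f = d * integral P (\<lambda>t. f (x t))"
  proof (rule integral_param3[of u1 u2 u3 P p])
    show "bounded P"
      using P by (rule polytope_imp_bounded)
  next
    fix d :: real assume d: "0 < d" "\<And>f :: real^3 \<Rightarrow> real. f absolutely_integrable_on
        ((\<lambda>t. p + (fst t *\<^sub>R u1 + fst (snd t) *\<^sub>R u2 + snd (snd t) *\<^sub>R u3)) ` P) \<Longrightarrow>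
      integral ((\<lambda>t. p + (fst t *\<^sub>R u1 + fst (snd t) *\<^sub>R u2 + snd (snd t) *\<^sub>R u3)) ` P) f =
      d * integral P (\<lambda>t. f (p + (fst t *\<^sub>R u1 + fst (snd t) *\<^sub>R u2 + snd (snd t) *\<^sub>R u3)))"
    show thesis
      by (rule that[OF d(1)]) (use d(2) in \<open>simp add: x_def\<close>)
  qed (erule ind)
  have lm: "x ` P \<in> lmeasurable" "P \<in> lmeasurable"
    using X P polytope_imp_compact lmeasurable_compact by blast+
  have "convex_on (x ` P) (\<lambda>_. 1::real)"
    using polytope_imp_convex[OF X] by (simp add: convex_on_const)
  then have "measure lebesgue (x ` P) = d * measure lebesgue P"
    using d(2)[OF convex_on_polytope_absolutely_integrable[OF X]] lmeasure_integral[OF lm(1)]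
      lmeasure_integral[OF lm(2)] by simp
  moreover have "integral (x ` P) f = d * integral P (\<lambda>t. f (x t))"
    using d(2)[OF convex_on_polytope_absolutely_integrable[OF X f]] .
  ultimately show "avg_vol f (x ` P) = integral P (\<lambda>t. f (x t)) / measure lebesgue P"
    using d(1) by (simp add: avg_vol_def)
qed

lemma param3_convex_hull:
  fixes p u1 u2 u3 :: "'a::euclidean_space"
  shows "(\<lambda>t. p + (fst t *\<^sub>R u1 + fst (snd t) *\<^sub>R u2 + snd (snd t) *\<^sub>R u3)) ` (convex hull S) =
    convex hull ((\<lambda>t. p + (fst t *\<^sub>R u1 + fst (snd t) *\<^sub>R u2 + snd (snd t) *\<^sub>R u3)) ` S)"
proof -
  let ?A = "\<lambda>t. fst t *\<^sub>R u1 + fst (snd t) *\<^sub>R u2 + snd (snd t) *\<^sub>R u3"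
  have A: "linear ?A"
    by (intro linearI) (auto simp: algebra_simps)
  have "(\<lambda>t. p + ?A t) ` (convex hull S) = (+) p ` ?A ` (convex hull S)"
    by (simp add: image_image)
  also have "\<dots> = convex hull ((+) p ` ?A ` S)"
    using convex_hull_linear_image[OF A] convex_hull_translation[of p "?A ` S"] by simp
  finally show ?thesis
    by (simp add: image_image)
qed

section \<open>Tetrahedra and segments in space\<close>

definition tri_avg :: "(real^3 \<Rightarrow> real) \<Rightarrow> real^3 \<Rightarrow> real^3 \<Rightarrow> real^3 \<Rightarrow> real" where
  "tri_avg f p q r = triangle_avg (\<lambda>(y, z). f (p + y *\<^sub>R (q - p) + z *\<^sub>R (r - p)))"

definition seg_avg :: "(real^3 \<Rightarrow> real) \<Rightarrow> real^3 \<Rightarrow> real^3 \<Rightarrow> real" where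
  "seg_avg f p q = integral {0..1} (\<lambda>t. f (p + t *\<^sub>R (q - p)))"

context
  fixes p0 p1 p2 p3 :: "real^3" and f :: "real^3 \<Rightarrow> real"
  assumes ind: "\<And>\<alpha> \<beta> \<gamma>. \<alpha> *\<^sub>R (p1 - p0) + \<beta> *\<^sub>R (p2 - p0) + \<gamma> *\<^sub>R (p3 - p0) = 0 \<Longrightarrow> \<alpha> = 0 \<and> \<beta> = 0 \<and> \<gamma> = 0"
    and f: "convex_on (convex hull {p0, p1, p2, p3}) f"
begin

text \<open>In the cone parametrisation the slice s = 1 is the triangle opposite to p0, and the
  slice s = 3/4 is its image under the homothety with centre p0 and ratio 3/4.\<close>

lemma tetrahedron_cone:
  "avg_vol f (convex hull {p0, p1, p2, p3}) \<le> (1/4) * f p0 + (3/4) * tri_avg f p1 p2 p3"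
  "tri_avg f (homothety p0 (3/4) p1) (homothety p0 (3/4) p2) (homothety p0 (3/4) p3)
    \<le> avg_vol f (convex hull {p0, p1, p2, p3})"
proof -
  let ?x = "\<lambda>t. p0 + (fst t *\<^sub>R (p1 - p0) + fst (snd t) *\<^sub>R (p2 - p1) + snd (snd t) *\<^sub>R (p3 - p1))"
  have i: "s = 0 \<and> y = 0 \<and> z = 0" if "s *\<^sub>R (p1 - p0) + y *\<^sub>R (p2 - p1) + z *\<^sub>R (p3 - p1) = 0" for s y z
  proof -
    have "(s - y - z) *\<^sub>R (p1 - p0) + y *\<^sub>R (p2 - p0) + z *\<^sub>R (p3 - p0) = 0"
      using that by (simp add: algebra_simps)
    from ind[OF this] show ?thesis by simp
  qed
  have X: "?x ` cone_region = convex hull {p0, p1, p2, p3}"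
    unfolding cone_region_hull param3_convex_hull by (simp add: algebra_simps)
  have fX: "convex_on (?x ` cone_region) f"
    using f X by simp
  note par = avg_vol_param3[OF i polytope_regions(1) fX]
  have "(\<lambda>(y, z). f (?x (1, y, z))) = (\<lambda>(y, z). f (p1 + y *\<^sub>R (p2 - p1) + z *\<^sub>R (p3 - p1)))"
    by (simp add: algebra_simps)
  then show "avg_vol f (convex hull {p0, p1, p2, p3}) \<le> (1/4) * f p0 + (3/4) * tri_avg f p1 p2 p3"
    using cone_upper[OF par(1)] par(2) X by (simp add: tri_avg_def)
  let ?h = "homothety p0 (3/4)"
  have "?x (3/4, 3/4 * y, 3/4 * z) = ?h p1 + y *\<^sub>R (?h p2 - ?h p1) + z *\<^sub>R (?h p3 - ?h p1)" for y z
    by (simp add: homothety_def algebra_simps)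
  then have "(\<lambda>(y, z). f (?x (3/4, 3/4 * y, 3/4 * z))) =
      (\<lambda>(y, z). f (?h p1 + y *\<^sub>R (?h p2 - ?h p1) + z *\<^sub>R (?h p3 - ?h p1)))"
    by simp
  then show "tri_avg f (?h p1) (?h p2) (?h p3) \<le> avg_vol f (convex hull {p0, p1, p2, p3})"
    using cone_lower[OF par(1)] par(2) X by (simp add: tri_avg_def)
qed

text \<open>In the edge parametrisation the slices s = 0 and s = 1 degenerate to the opposite edges
  p0 p1 and p2 p3.\<close>

lemma tetrahedron_edges:
  "avg_vol f (convex hull {p0, p1, p2, p3}) \<le> (1/2) * seg_avg f p0 p1 + (1/2) * seg_avg f p2 p3"
proof -
  let ?x = "\<lambda>t. p0 + (fst t *\<^sub>R (p2 - p0) + fst (snd t) *\<^sub>R (p1 - p0) + snd (snd t) *\<^sub>R (p3 - p2))"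
  have i: "s = 0 \<and> y = 0 \<and> z = 0" if "s *\<^sub>R (p2 - p0) + y *\<^sub>R (p1 - p0) + z *\<^sub>R (p3 - p2) = 0" for s y z
  proof -
    have "y *\<^sub>R (p1 - p0) + (s - z) *\<^sub>R (p2 - p0) + z *\<^sub>R (p3 - p0) = 0"
      using that by (simp add: algebra_simps)
    from ind[OF this] show ?thesis by simp
  qed
  have X: "?x ` edge_region = convex hull {p0, p1, p2, p3}"
    unfolding edge_region_hull param3_convex_hull by (simp add: algebra_simps)
  have fX: "convex_on (?x ` edge_region) f"
    using f X by simp
  note par = avg_vol_param3[OF i polytope_regions(2) fX]
  have "(\<lambda>y. f (?x (0, y, 0))) = (\<lambda>y. f (p0 + y *\<^sub>R (p1 - p0)))"
    "(\<lambda>z. f (?x (1, 0, z))) = (\<lambda>z. f (p2 + z *\<^sub>R (p3 - p2)))"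
    by (simp_all add: algebra_simps)
  then show ?thesis
    using edge_upper[OF par(1)] par(2) X by (simp add: seg_avg_def)
qed

end

text \<open>\<open>seg_ends\<close> returns the two ends in an unknown order; if they are exchanged,
  the substitution of 1 - t for t restores the orientation.\<close>

lemma seg_integral_closed_segment: "seg_integral f (closed_segment a b) = dist a b * seg_avg f a b"
proof -
  have "\<exists>ab. closed_segment a b = closed_segment (fst ab) (snd ab)"
    by (rule exI[of _ "(a, b)"]) simp
  from someI_ex[OF this] have "{a, b} = {fst (seg_ends (closed_segment a b)), snd (seg_ends (closed_segment a b))}"
    unfolding seg_ends_def by simp
  then consider "seg_ends (closed_segment a b) = (a, b)" | "seg_ends (closed_segment a b) = (b, a)"
    by (metis doubleton_eq_iff prod.collapse)
  then show ?thesis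
  proof cases
    case 2
    have "integral {0..1} (\<lambda>t. f (b + t *\<^sub>R (a - b))) = integral {-1..0} (\<lambda>t. f (b + (-t) *\<^sub>R (a - b)))"
      using Henstock_Kurzweil_Integration.integral_reflect_real[of 1 0 "\<lambda>t. f (b + t *\<^sub>R (a - b))"] by simp
    also have "\<dots> = integral {0..1} (\<lambda>t. f (a + t *\<^sub>R (b - a)))"
      using integral_shift_Icc_real[of 0 1 "\<lambda>t. f (b + (-t) *\<^sub>R (a - b))" "-1"]
      by (simp add: o_def algebra_simps)
    finally show ?thesis
      using 2 by (simp add: seg_integral_def seg_avg_def dist_commute)
  qed (simp add: seg_integral_def seg_avg_def)
qed

subsection \<open>Surface integrals\<close>

definition noncollinear :: "real^3 \<Rightarrow> real^3 \<Rightarrow> real^3 \<Rightarrow> bool" where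
  "noncollinear p q r \<longleftrightarrow> (\<forall>y z. y *\<^sub>R (q - p) + z *\<^sub>R (r - p) = 0 \<longrightarrow> y = 0 \<and> z = 0)"

text \<open>The area of the parallelogram spanned by the two vectors. Being expressed by inner
  products alone, it is unchanged by the symmetries and by the choice of chart.\<close>

definition gram_area :: "real^3 \<Rightarrow> real^3 \<Rightarrow> real" where
  "gram_area a b = sqrt ((a \<bullet> a) * (b \<bullet> b) - (a \<bullet> b)^2)"

lemma affine_hull_3_alt:
  fixes p q r :: "'a::real_vector"
  shows "affine hull {p, q, r} = {p + y *\<^sub>R (q - p) + z *\<^sub>R (r - p) | y z. True}"
proof (intro equalityI subsetI)
  fix x assume "x \<in> affine hull {p, q, r}"
  then obtain u y z where "u + y + z = 1" "x = u *\<^sub>R p + y *\<^sub>R q + z *\<^sub>R r"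
    unfolding affine_hull_3 by auto
  moreover from this have "u = 1 - y - z" by simp
  ultimately have "x = p + y *\<^sub>R (q - p) + z *\<^sub>R (r - p)"
    by (simp add: algebra_simps)
  then show "x \<in> {p + y *\<^sub>R (q - p) + z *\<^sub>R (r - p) | y z. True}" by blast
next
  fix x assume "x \<in> {p + y *\<^sub>R (q - p) + z *\<^sub>R (r - p) | y z. True}"
  then obtain y z where "x = p + y *\<^sub>R (q - p) + z *\<^sub>R (r - p)" by blast
  then have "x = (1 - y - z) *\<^sub>R p + y *\<^sub>R q + z *\<^sub>R r"
    by (simp add: algebra_simps)
  then show "x \<in> affine hull {p, q, r}"
    unfolding affine_hull_3 by (intro CollectI exI[of _ "1 - y - z"] exI[of _ y] exI[of _ z]) simp
qed

text \<open>Gram-Schmidt applied to the two spanning directions q - p and r - p yields the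
  orthonormal pair that \<open>is_plane\<close> asks for.\<close>

lemma is_plane_affine_hull:
  assumes "noncollinear p q r"
  shows "is_plane (affine hull {p, q, r})"
proof -
  define a b where "a = q - p" and "b = r - p"
  have ind: "y = 0 \<and> z = 0" if "y *\<^sub>R a + z *\<^sub>R b = 0" for y z
    using assms that unfolding noncollinear_def a_def b_def by blast
  have a: "a \<noteq> 0"
    using ind[of 1 0] by auto
  define u where "u = (1 / norm a) *\<^sub>R a"
  define b' where "b' = b - (u \<bullet> b) *\<^sub>R u"
  have au: "a = norm a *\<^sub>R u"
    using a by (simp add: u_def)
  have "b' = (- (u \<bullet> b) / norm a) *\<^sub>R a + 1 *\<^sub>R b"
    by (simp add: b'_def u_def)
  then have b': "b' \<noteq> 0"
    using ind[of "- (u \<bullet> b) / norm a" 1] by auto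
  define v where "v = (1 / norm b') *\<^sub>R b'"
  have bv: "b = (u \<bullet> b) *\<^sub>R u + norm b' *\<^sub>R v"
    using b' by (simp add: v_def b'_def)
  have nu: "norm u = 1" and nv: "norm v = 1"
    using a b' by (simp_all add: u_def v_def)
  have "u \<bullet> u = 1"
    using nu by (simp add: norm_eq_1)
  then have "u \<bullet> b' = 0"
    by (simp add: b'_def inner_simps)
  then have uv: "u \<bullet> v = 0"
    by (simp add: v_def)
  have "affine hull {p, q, r} = range (plane_param p u v)"
  proof (intro equalityI subsetI)
    fix x assume "x \<in> affine hull {p, q, r}"
    then obtain y z where x: "x = p + y *\<^sub>R a + z *\<^sub>R b"
      unfolding affine_hull_3_alt a_def b_def by blast
    have "x = p + (y * norm a + z * (u \<bullet> b)) *\<^sub>R u + (z * norm b') *\<^sub>R v"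
      unfolding x by (subst au, subst bv) (simp add: algebra_simps)
    then have "x = plane_param p u v (vector [y * norm a + z * (u \<bullet> b), z * norm b'])"
      by (simp add: plane_param_def)
    then show "x \<in> range (plane_param p u v)" by blast
  next
    fix x assume "x \<in> range (plane_param p u v)"
    then obtain z :: "real^2" where "x = p + z$1 *\<^sub>R u + z$2 *\<^sub>R v"
      by (auto simp: plane_param_def)
    moreover have "v = (1 / norm b') *\<^sub>R b - ((u \<bullet> b) / norm b' / norm a) *\<^sub>R a"
      by (simp add: v_def b'_def u_def scaleR_diff_right mult.commute)
    moreover have "u = (1 / norm a) *\<^sub>R a"
      by (rule u_def)
    ultimately have "x = p + (z$1 * (1 / norm a) - z$2 * ((u \<bullet> b) / norm b' / norm a)) *\<^sub>R a
        + (z$2 * (1 / norm b')) *\<^sub>R b"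
      by (simp only: scaleR_diff_right scaleR_diff_left scaleR_scaleR) simp
    then show "x \<in> affine hull {p, q, r}"
      unfolding affine_hull_3_alt a_def b_def by blast
  qed
  then show ?thesis
    unfolding is_plane_def using nu nv uv by blast
qed

lemma plane_chart_obtain:
  assumes "is_plane P"
  obtains p u v where "u \<bullet> u = 1" "v \<bullet> v = 1" "u \<bullet> v = 0" "plane_chart P = plane_param p u v"
    "P = range (plane_param p u v)"
proof -
  have "\<exists>g p u v. norm u = 1 \<and> norm v = 1 \<and> u \<bullet> v = 0 \<and> g = plane_param p u v \<and> P = range g"
    using assms unfolding is_plane_def by blast
  from someI_ex[OF this] show ?thesis
    unfolding plane_chart_def[symmetric] using that by (metis norm_eq_1)
qed

lemma plane_param_affine:
  "plane_param p u v = (\<lambda>z. p + (\<lambda>z. z$1 *\<^sub>R u + z$2 *\<^sub>R v) z)"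
  by (simp add: plane_param_def fun_eq_iff add.assoc)

lemma linear_plane_param: "linear (\<lambda>z::real^2. z$1 *\<^sub>R u + z$2 *\<^sub>R v)"
  by (intro linearI) (simp_all add: scaleR_add_left scaleR_add_right add_ac)

lemma plane_param_inj:
  assumes "u \<bullet> u = 1" "v \<bullet> v = 1" "u \<bullet> v = 0" "plane_param p u v z = plane_param p u v z'"
  shows "z = z'"
proof -
  have "z$1 *\<^sub>R u + z$2 *\<^sub>R v = z'$1 *\<^sub>R u + z'$2 *\<^sub>R v"
    using assms(4) by (simp add: plane_param_def add.assoc)
  then have "(z$1 *\<^sub>R u + z$2 *\<^sub>R v) \<bullet> x = (z'$1 *\<^sub>R u + z'$2 *\<^sub>R v) \<bullet> x" for x
    by simp
  from this[of u] this[of v] show ?thesis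
    using assms by (simp add: inner_add_left inner_commute[of v u] vec_eq_iff forall_2)
qed

text \<open>The Jacobian of the barycentric parametrisation is the square root of a Gram determinant, hence
  independent of the arbitrarily chosen isometric chart.\<close>

lemma chart_triangle:
  assumes nc: "noncollinear p q r" and P: "P = affine hull {p, q, r}"
    and f: "convex_on (convex hull {p, q, r}) f"
  shows "(\<lambda>z. f (plane_chart P z)) integrable_on {z. plane_chart P z \<in> convex hull {p, q, r}}"
    and "planar_integral (convex hull {p, q, r}) P f =
      gram_area (q - p) (r - p) * integral std_triangle (\<lambda>(y, z). f (p + y *\<^sub>R (q - p) + z *\<^sub>R (r - p)))"
    and "0 < gram_area (q - p) (r - p)"
proof -
  let ?D = "convex hull {p, q, r}"
  define a b where "a = q - p" and "b = r - p"
  obtain o' u v where uv: "u \<bullet> u = 1" "v \<bullet> v = 1" "u \<bullet> v = 0" and ch: "plane_chart P = plane_param o' u v"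
    and PR: "P = range (plane_param o' u v)"
    using plane_chart_obtain[OF is_plane_affine_hull[OF nc]] P by metis
  let ?g = "plane_param o' u v"
  have in_P: "p + y *\<^sub>R a + z *\<^sub>R b \<in> P" for y z
    unfolding P affine_hull_3_alt a_def b_def by blast
  have "p \<in> P" "p + a \<in> P" "p + b \<in> P"
    using in_P[of 0 0] in_P[of 1 0] in_P[of 0 1] by simp_all
  then obtain c0 ca cb where c: "p = ?g c0" "p + a = ?g ca" "p + b = ?g cb"
    using PR by blast
  define \<alpha> \<beta> where "\<alpha> = ca - c0" and "\<beta> = cb - c0"
  have a: "a = \<alpha>$1 *\<^sub>R u + \<alpha>$2 *\<^sub>R v"
  proof -
    have "a = ?g ca - ?g c0" using c by (metis add_diff_cancel_left')
    then show ?thesis by (simp add: plane_param_def \<alpha>_def scaleR_diff_left)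
  qed
  have b: "b = \<beta>$1 *\<^sub>R u + \<beta>$2 *\<^sub>R v"
  proof -
    have "b = ?g cb - ?g c0" using c by (metis add_diff_cancel_left')
    then show ?thesis by (simp add: plane_param_def \<beta>_def scaleR_diff_left)
  qed
  define A where "A x = x$1 *\<^sub>R \<alpha> + x$2 *\<^sub>R \<beta>" for x :: "real^2"
  have A: "linear A"
  proof (intro linearI)
    show "A (x + y) = A x + A y" for x y
      unfolding A_def vector_add_component scaleR_add_left by (simp only: add_ac)
    show "A (r *\<^sub>R x) = r *\<^sub>R A x" for r x
      unfolding A_def vector_scaleR_component scaleR_add_right scaleR_scaleR real_scaleR_def ..
  qed
  have gA: "?g (c0 + A x) = p + x$1 *\<^sub>R a + x$2 *\<^sub>R b" for x
    unfolding c(1) a b by (simp add: plane_param_def A_def scaleR_add_left scaleR_add_right add_ac)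
  have inj: "inj A"
    unfolding linear_injective_0[OF A]
  proof (intro allI impI)
    fix x assume "A x = 0"
    then have "p + x$1 *\<^sub>R a + x$2 *\<^sub>R b = p"
      using gA[of x] c(1) by simp
    then have "x$1 *\<^sub>R a + x$2 *\<^sub>R b = 0"
      by (simp add: add.assoc)
    then have "x$1 = 0 \<and> x$2 = 0"
      using nc unfolding noncollinear_def a_def b_def by blast
    then show "x = 0"
      by (simp only: vec_eq_iff forall_2 zero_index)
  qed
  \<comment> \<open>Lagrange's identity: in orthonormal coordinates the Gram determinant of two
    plane vectors is the square of their determinant.\<close>
  have det: "\<bar>det (matrix A)\<bar> = gram_area a b"
  proof -
    have m: "det (matrix A) = \<alpha>$1 * \<beta>$2 - \<beta>$1 * \<alpha>$2"
      by (simp add: det_2 matrix_def A_def axis_def)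
    have "a \<bullet> a = \<alpha>$1^2 + \<alpha>$2^2" "b \<bullet> b = \<beta>$1^2 + \<beta>$2^2" "a \<bullet> b = \<alpha>$1 * \<beta>$1 + \<alpha>$2 * \<beta>$2"
      unfolding a b using uv by (simp_all add: inner_add_left inner_add_right inner_commute[of v u] power2_eq_square)
    then have "(a \<bullet> a) * (b \<bullet> b) - (a \<bullet> b)^2 = (det (matrix A))^2"
      unfolding m by (simp add: power2_eq_square algebra_simps)
    then show ?thesis
      by (simp add: gram_area_def)
  qed
  show "0 < gram_area (q - p) (r - p)"
    using det A inj det_nz_iff_inj unfolding a_def b_def by (metis zero_less_abs_iff)
  define \<phi> where "\<phi> = (\<lambda>(x, y). vector [x, y] :: real^2)"
  have lin: "linear \<phi>"
    unfolding \<phi>_def by (rule linear_vector_pair)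
  have D: "?D = (\<lambda>t. p + fst t *\<^sub>R a + snd t *\<^sub>R b) ` std_triangle"
  proof (intro equalityI subsetI)
    fix x assume "x \<in> ?D"
    then obtain k y z where "0 \<le> k" "0 \<le> y" "0 \<le> z" "k + y + z = 1" "x = k *\<^sub>R p + y *\<^sub>R q + z *\<^sub>R r"
      unfolding convex_hull_3 by auto
    moreover from this have "k = 1 - y - z" by simp
    ultimately have "x = p + y *\<^sub>R a + z *\<^sub>R b" "(y, z) \<in> std_triangle"
      by (simp_all add: a_def b_def algebra_simps std_triangle_def)
    then show "x \<in> (\<lambda>t. p + fst t *\<^sub>R a + snd t *\<^sub>R b) ` std_triangle"
      by (intro image_eqI[of _ _ "(y, z)"]) auto
  next
    fix x assume "x \<in> (\<lambda>t. p + fst t *\<^sub>R a + snd t *\<^sub>R b) ` std_triangle"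
    then obtain y z where "(y, z) \<in> std_triangle" and x: "x = p + y *\<^sub>R a + z *\<^sub>R b" by auto
    then have "0 \<le> 1 - y - z" "0 \<le> y" "0 \<le> z" "(1 - y - z) + y + z = 1"
      by (auto simp: std_triangle_def)
    moreover have "x = (1 - y - z) *\<^sub>R p + y *\<^sub>R q + z *\<^sub>R r"
      unfolding x a_def b_def by (simp add: algebra_simps)
    ultimately show "x \<in> ?D"
      unfolding convex_hull_3 by blast
  qed
  have pre: "{z. ?g z \<in> ?D} = (\<lambda>x. c0 + A x) ` \<phi> ` std_triangle"
  proof (intro equalityI subsetI)
    fix z assume "z \<in> {z. ?g z \<in> ?D}"
    then obtain t where t: "t \<in> std_triangle" "?g z = p + fst t *\<^sub>R a + snd t *\<^sub>R b"
      using D by auto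
    have "?g z = ?g (c0 + A (\<phi> t))"
      unfolding t(2) gA by (simp add: \<phi>_def case_prod_unfold)
    then have "z = c0 + A (\<phi> t)"
      using plane_param_inj[OF uv] by blast
    then show "z \<in> (\<lambda>x. c0 + A x) ` \<phi> ` std_triangle"
      using t(1) by blast
  next
    fix z assume "z \<in> (\<lambda>x. c0 + A x) ` \<phi> ` std_triangle"
    then obtain t where t: "t \<in> std_triangle" "z = c0 + A (\<phi> t)" by blast
    have "?g z = p + fst t *\<^sub>R a + snd t *\<^sub>R b"
      unfolding t(2) gA by (simp add: \<phi>_def case_prod_unfold)
    then show "z \<in> {z. ?g z \<in> ?D}"
      using D t(1) by auto
  qed
  have poly: "polytope ((\<lambda>x. c0 + A x) ` \<phi> ` std_triangle)"
    using polytope_linear_image[OF A polytope_linear_image[OF lin polytope_regions(3)]]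
      polytope_translation_eq[of c0 "A ` \<phi> ` std_triangle"] by (simp add: image_image)
  have "convex_on ((\<lambda>x. c0 + A x) ` \<phi> ` std_triangle) (\<lambda>z. f (o' + (z$1 *\<^sub>R u + z$2 *\<^sub>R v)))"
  proof (rule convex_on_affine_comp[OF f linear_plane_param polytope_imp_convex[OF poly]])
    show "o' + (z$1 *\<^sub>R u + z$2 *\<^sub>R v) \<in> ?D" if "z \<in> (\<lambda>x. c0 + A x) ` \<phi> ` std_triangle" for z
      using that unfolding pre[symmetric] by (simp add: plane_param_def add.assoc)
  qed
  then have abs: "(\<lambda>z. f (?g z)) absolutely_integrable_on ((\<lambda>x. c0 + A x) ` \<phi> ` std_triangle)"
    using convex_on_polytope_absolutely_integrable[OF poly] by (simp add: plane_param_def add.assoc)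
  then show "(\<lambda>z. f (plane_chart P z)) integrable_on {z. plane_chart P z \<in> ?D}"
    unfolding ch pre by (simp add: absolutely_integrable_on_def)
  note cv = affine_change_of_variables[OF A inj abs]
  have "bounded (\<phi> ` std_triangle)"
    using polytope_linear_image[OF lin polytope_regions(3)] polytope_imp_bounded by blast
  moreover have "((\<lambda>x. f (?g (c0 + A x))) has_integral integral (\<phi> ` std_triangle) (\<lambda>x. f (?g (c0 + A x)))) (\<phi> ` std_triangle)"
    using cv(1) by (intro integrable_integral) (auto simp: absolutely_integrable_on_def)
  ultimately have "((\<lambda>t. f (?g (c0 + A (\<phi> t)))) has_integral integral (\<phi> ` std_triangle) (\<lambda>x. f (?g (c0 + A x))))
      {t. \<phi> t \<in> \<phi> ` std_triangle}"
    using has_integral_pair by (simp add: \<phi>_def case_prod_unfold)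
  moreover have "{t. \<phi> t \<in> \<phi> ` std_triangle} = std_triangle"
    by (force simp: \<phi>_def vec_eq_iff forall_2)
  ultimately have "integral std_triangle (\<lambda>t. f (?g (c0 + A (\<phi> t)))) = integral (\<phi> ` std_triangle) (\<lambda>x. f (?g (c0 + A x)))"
    by (simp add: integral_unique)
  moreover have "(\<lambda>t. f (?g (c0 + A (\<phi> t)))) = (\<lambda>(y, z). f (p + y *\<^sub>R a + z *\<^sub>R b))"
    unfolding gA by (simp add: \<phi>_def case_prod_unfold)
  ultimately show "planar_integral ?D P f = gram_area (q - p) (r - p) *
      integral std_triangle (\<lambda>(y, z). f (p + y *\<^sub>R (q - p) + z *\<^sub>R (r - p)))"
    unfolding planar_integral_def ch pre cv(2) det a_def b_def by simp
qed

text \<open>The triangles may be coplanar and several may lie in one plane; all that is required is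
  that distinct ones meet only along relative boundaries.\<close>

locale triangulated_surface =
  fixes \<D> :: "(real^3) set set"
  assumes finite_\<D>: "finite \<D>"
    and triangle: "\<And>D. D \<in> \<D> \<Longrightarrow> \<exists>p q r. noncollinear p q r \<and> D = convex hull {p, q, r}"
    and non_overlap: "\<And>D D'. D \<in> \<D> \<Longrightarrow> D' \<in> \<D> \<Longrightarrow> rel_interior D \<inter> D' \<noteq> {} \<Longrightarrow> D = D'"
begin

section \<open>Planar integrals over a triangulated surface\<close>

lemma triangleE:
  assumes "D \<in> \<D>"
  obtains p q r where "noncollinear p q r" "D = convex hull {p, q, r}" "affine hull D = affine hull {p, q, r}"
  using triangle[OF assms] affine_hull_convex_hull by metis

lemma is_plane_hull: "D \<in> \<D> \<Longrightarrow> is_plane (affine hull D)"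
  using triangleE is_plane_affine_hull by metis

lemma preimage_convex_compact:
  assumes P: "is_plane P" and D: "D \<in> \<D>"
  shows "convex {z. plane_chart P z \<in> D}" "compact {z. plane_chart P z \<in> D}"
proof -
  obtain o' u v where uv: "u \<bullet> u = 1" "v \<bullet> v = 1" "u \<bullet> v = 0" and ch: "plane_chart P = plane_param o' u v"
    using plane_chart_obtain[OF P] by metis
  let ?l = "\<lambda>z::real^2. z$1 *\<^sub>R u + z$2 *\<^sub>R v"
  have cD: "convex D" "compact D"
    by (rule triangleE[OF D]; simp add: finite_imp_compact_convex_hull)+
  have eq: "{z. plane_chart P z \<in> D} = ?l -` ((+) (- o') ` D)"
  proof -
    have "o' + ?l z \<in> D \<longleftrightarrow> ?l z \<in> (+) (- o') ` D" for z
      by (force simp: image_iff)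
    then show ?thesis
      by (auto simp: ch plane_param_affine)
  qed
  show "convex {z. plane_chart P z \<in> D}"
    unfolding eq using cD by (intro convex_linear_vimage linear_plane_param) (simp add: convex_translation_eq)
  have lin_bd: "bounded_linear ?l"
    by (rule linear_conv_bounded_linear[THEN iffD1, OF linear_plane_param])
  have "closed (?l -` ((+) (- o') ` D))"
    using cD by (intro closed_vimage linear_continuous_on[OF lin_bd] compact_imp_closed compact_translation)
  moreover have "bounded (?l -` ((+) (- o') ` D))"
  proof -
    obtain M where M: "\<And>x. x \<in> (+) (- o') ` D \<Longrightarrow> norm x \<le> M"
      using compact_imp_bounded[OF compact_translation[OF cD(2)]] unfolding bounded_iff by blast
    have "norm z \<le> M + M" if "z \<in> ?l -` ((+) (- o') ` D)" for z
    proof -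
      have "norm (?l z) \<le> M"
        using M that by blast
      moreover have "z$1 = u \<bullet> ?l z" "z$2 = v \<bullet> ?l z"
        using uv by (simp_all add: inner_add_right inner_commute[of v u])
      moreover have "norm u = 1" "norm v = 1"
        using uv by (simp_all add: norm_eq_1)
      ultimately have "\<bar>z$1\<bar> \<le> M" "\<bar>z$2\<bar> \<le> M"
        using Cauchy_Schwarz_ineq2[of u "?l z"] Cauchy_Schwarz_ineq2[of v "?l z"] by auto
      then show ?thesis
        using norm_le_l1_cart[of z] by (simp add: UNIV_2)
    qed
    then show ?thesis
      unfolding bounded_iff by blast
  qed
  ultimately show "compact {z. plane_chart P z \<in> D}"
    unfolding eq by (simp add: compact_eq_bounded_closed)
qed

text \<open>Both planes have dimension two, so if they differ, neither contains the other. The part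
  of P inside the plane of D is then, in the chart, a proper affine subset of the coordinate plane
  and has no interior.\<close>

lemma preimage_negligible:
  assumes P: "is_plane P" and D: "D \<in> \<D>" and ne: "affine hull D \<noteq> P"
  shows "negligible {z. plane_chart P z \<in> D}"
proof -
  obtain o' u v where uv: "u \<bullet> u = 1" "v \<bullet> v = 1" "u \<bullet> v = 0" and ch: "plane_chart P = plane_param o' u v"
    and PR: "P = range (plane_param o' u v)"
    using plane_chart_obtain[OF P] by metis
  let ?l = "\<lambda>z::real^2. z$1 *\<^sub>R u + z$2 *\<^sub>R v"
  have injl: "inj ?l"
    using plane_param_inj[OF uv, of o'] by (auto simp: inj_def plane_param_affine)
  obtain p q r where nc: "noncollinear p q r" and hull: "affine hull D = affine hull {p, q, r}"
    using triangleE[OF D] by metis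
  have P': "P = (+) o' ` range ?l"
    unfolding PR plane_param_affine by auto
  have "aff_dim P = 2"
    unfolding P' aff_dim_translation_eq using aff_dim_injective_linear_image[OF linear_plane_param injl, of UNIV] by simp
  moreover obtain o2 u2 v2 where uv2: "u2 \<bullet> u2 = 1" "v2 \<bullet> v2 = 1" "u2 \<bullet> v2 = 0"
    and PR2: "affine hull D = range (plane_param o2 u2 v2)"
    using plane_chart_obtain[OF is_plane_hull[OF D]] by metis
  have injl2: "inj (\<lambda>z::real^2. z$1 *\<^sub>R u2 + z$2 *\<^sub>R v2)"
    using plane_param_inj[OF uv2, of o2] by (auto simp: inj_def plane_param_affine)
  have "affine hull D = (+) o2 ` range (\<lambda>z::real^2. z$1 *\<^sub>R u2 + z$2 *\<^sub>R v2)"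
    unfolding PR2 plane_param_affine by auto
  then have "aff_dim (affine hull D) = 2"
    using aff_dim_injective_linear_image[OF linear_plane_param injl2, of UNIV] by (simp add: aff_dim_translation_eq)
  moreover have "affine P"
    unfolding P' affine_translation[symmetric] by (intro subspace_imp_affine linear_subspace_image linear_plane_param) auto
  ultimately have "\<not> P \<subseteq> affine hull D"
    using ne affine_dim_equal[of P "affine hull D"] PR by auto
  then obtain z0 where z0: "plane_param o' u v z0 \<notin> affine hull D"
    using PR by auto
  let ?Z = "{z. plane_param o' u v z \<in> affine hull D}"
  have aff: "affine ?Z"
  proof (rule affine_def[THEN iffD2], intro ballI allI impI)
    fix x y and s t :: real
    assume xy: "x \<in> ?Z" "y \<in> ?Z" and st: "s + t = 1"
    have "(s + t) *\<^sub>R o' = o'"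
      using st by simp
    then have "plane_param o' u v (s *\<^sub>R x + t *\<^sub>R y) = s *\<^sub>R plane_param o' u v x + t *\<^sub>R plane_param o' u v y"
      by (simp add: plane_param_def algebra_simps)
    then show "s *\<^sub>R x + t *\<^sub>R y \<in> ?Z"
      using xy st mem_affine[OF affine_affine_hull] by auto
  qed
  have "interior ?Z = {}"
  proof (rule ccontr)
    assume "interior ?Z \<noteq> {}"
    then have "affine hull ?Z = UNIV"
      by (rule affine_hull_nonempty_interior)
    then have "?Z = UNIV"
      using aff by (simp add: hull_same)
    then show False
      using z0 by blast
  qed
  then have "negligible ?Z"
    using negligible_convex_interior affine_imp_convex[OF aff] by blast
  then show ?thesis
    by (rule negligible_subset) (auto simp: ch hull_inc)
qed

text \<open>The chart is an injective affine map onto the plane of D, so it carries relative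
  interiors to relative interiors.\<close>

lemma interior_preimage:
  assumes P: "is_plane P" and D: "D \<in> \<D>" "affine hull D = P" and z: "z \<in> interior {z. plane_chart P z \<in> D}"
  shows "plane_chart P z \<in> rel_interior D"
proof -
  obtain o' u v where uv: "u \<bullet> u = 1" "v \<bullet> v = 1" "u \<bullet> v = 0" and ch: "plane_chart P = plane_param o' u v"
    and PR: "P = range (plane_param o' u v)"
    using plane_chart_obtain[OF P] by metis
  let ?l = "\<lambda>z::real^2. z$1 *\<^sub>R u + z$2 *\<^sub>R v"
  let ?T = "{z. plane_chart P z \<in> D}"
  have injl: "inj ?l"
    using plane_param_inj[OF uv, of o'] by (auto simp: inj_def plane_param_affine)
  have "D \<subseteq> P"
    using D hull_subset[of D affine] by simp
  then have DR: "D \<subseteq> range (\<lambda>z. o' + ?l z)"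
    using PR by (simp add: plane_param_affine)
  have "?T = {z. o' + ?l z \<in> D}"
    by (simp add: ch plane_param_affine)
  then have im: "D = (+) o' ` ?l ` ?T"
    using DR by auto
  have "z \<in> rel_interior ?T"
    using z by (metis empty_iff interior_rel_interior_gen rel_interior_interior affine_hull_nonempty_interior)
  then have "?l z \<in> rel_interior (?l ` ?T)"
    using rel_interior_injective_linear_image[OF linear_conv_bounded_linear[THEN iffD1, OF linear_plane_param] injl, of ?T]
    by blast
  then have "o' + ?l z \<in> rel_interior ((+) o' ` ?l ` ?T)"
    using rel_interior_translation[of o' "?l ` ?T"] by auto
  then show ?thesis
    using im by (simp add: ch plane_param_affine)
qed

lemma planar_has_integral:
  assumes P: "is_plane P" and D: "D \<in> \<D>" and f: "convex_on D f"
  shows "((\<lambda>z. f (plane_chart P z)) has_integral planar_integral D P f) {z. plane_chart P z \<in> D}"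
proof (cases "affine hull D = P")
  case True
  obtain p q r where "noncollinear p q r" "D = convex hull {p, q, r}" "affine hull D = affine hull {p, q, r}"
    using triangleE[OF D] by metis
  then show ?thesis
    using chart_triangle(1)[of p q r P f] f True integrable_integral unfolding planar_integral_def by blast
next
  case False
  then have "negligible {z. plane_chart P z \<in> D}"
    using preimage_negligible[OF P D] by blast
  then show ?thesis
    unfolding planar_integral_def by (intro integrable_integral integrable_negligible)
qed

lemma planar_integral_other:
  assumes "is_plane P" "D \<in> \<D>" "affine hull D \<noteq> P"
  shows "planar_integral D P f = 0"
  using preimage_negligible[OF assms] unfolding planar_integral_def by (rule integral_negligible)

text \<open>Triangles lying in P overlap there only in their boundaries, and every other triangle
  meets P in a negligible set; either way the pairwise intersections do not contribute.\<close>

lemma planar_integral_Union: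
  assumes P: "is_plane P" and f: "\<And>D. D \<in> \<D> \<Longrightarrow> convex_on D f"
  shows "planar_integral (\<Union>\<D>) P f = (\<Sum>D\<in>\<D>. planar_integral D P f)"
proof -
  let ?T = "\<lambda>D. {z. plane_chart P z \<in> D}"
  have "((\<lambda>z. f (plane_chart P z)) has_integral (\<Sum>D\<in>\<D>. planar_integral D P f)) (\<Union>D\<in>\<D>. ?T D)"
  proof (rule has_integral_UN[OF finite_\<D>])
    show "((\<lambda>z. f (plane_chart P z)) has_integral planar_integral D P f) (?T D)" if "D \<in> \<D>" for D
      using planar_has_integral[OF P that f[OF that]] .
    show "pairwise (\<lambda>D D'. negligible (?T D \<inter> ?T D')) \<D>"
    proof (rule pairwiseI)
      fix D D' assume D: "D \<in> \<D>" "D' \<in> \<D>" "D \<noteq> D'"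
      show "negligible (?T D \<inter> ?T D')"
      proof (cases "affine hull D = P")
        case True
        have "?T D \<inter> ?T D' \<subseteq> ?T D - interior (?T D)"
          using interior_preimage[OF P D(1) True] non_overlap[OF D(1,2)] D(3) by blast
        moreover have "negligible (?T D - interior (?T D))"
          using negligible_Diff_interior[OF preimage_convex_compact(1)[OF P D(1)]] .
        ultimately show ?thesis
          using negligible_subset by blast
      next
        case False
        then show ?thesis
          using negligible_subset[OF preimage_negligible[OF P D(1) False] Int_lower1] by simp
      qed
    qed
  qed
  moreover have "(\<Union>D\<in>\<D>. ?T D) = {z. plane_chart P z \<in> \<Union>\<D>}" by blast
  ultimately show ?thesis
    unfolding planar_integral_def by (simp add: integral_unique)
qed

lemma convex_on_one: "D \<in> \<D> \<Longrightarrow> convex_on D (\<lambda>_. 1::real)"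
  using triangleE by (metis convex_convex_hull convex_on_const)

lemma planar_area_eq:
  assumes P: "is_plane P"
  shows "planar_area (\<Union>\<D>) P = planar_integral (\<Union>\<D>) P (\<lambda>_. 1)"
proof -
  have "compact (\<Union>D\<in>\<D>. {z. plane_chart P z \<in> D})"
    using finite_\<D> preimage_convex_compact(2)[OF P] by blast
  moreover have "(\<Union>D\<in>\<D>. {z. plane_chart P z \<in> D}) = {z. plane_chart P z \<in> \<Union>\<D>}" by blast
  ultimately have "{z. plane_chart P z \<in> \<Union>\<D>} \<in> lmeasurable"
    using lmeasurable_compact by simp
  then show ?thesis
    unfolding planar_area_def planar_integral_def by (rule lmeasure_integral)
qed

lemma planar_integral_one:
  assumes "D \<in> \<D>"
  shows "0 < planar_integral D (affine hull D) (\<lambda>_. 1)"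
proof -
  obtain p q r where pqr: "noncollinear p q r" "D = convex hull {p, q, r}" "affine hull D = affine hull {p, q, r}"
    using triangleE[OF assms] by metis
  have lm: "std_triangle \<in> lmeasurable"
    using polytope_regions(3) polytope_imp_compact lmeasurable_compact by blast
  have "planar_integral D (affine hull D) (\<lambda>_. 1) = gram_area (q - p) (r - p) * measure lebesgue std_triangle"
    using chart_triangle(2)[OF pqr(1) pqr(3)] convex_on_one[OF assms] pqr(2) lmeasure_integral[OF lm] by (simp add: case_prod_unfold)
  then show ?thesis
    using chart_triangle(3)[OF pqr(1) refl] convex_on_one[OF assms] pqr(2) std_triangle_measure(2) by simp
qed

text \<open>This identifies the index set of the sums defining \<open>surface_integral\<close> and
  \<open>surface_area\<close>, and shows it to be finite; over an infinite set these sums would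
  default to 0.\<close>

lemma area_planes_eq: "area_planes (\<Union>\<D>) = (\<lambda>D. affine hull D) ` \<D>"
proof (intro equalityI subsetI)
  fix P assume "P \<in> area_planes (\<Union>\<D>)"
  then have P: "is_plane P" "0 < planar_area (\<Union>\<D>) P"
    unfolding area_planes_def by auto
  then have "0 < (\<Sum>D\<in>\<D>. planar_integral D P (\<lambda>_. 1))"
    using planar_area_eq planar_integral_Union convex_on_one by simp
  then obtain D where "D \<in> \<D>" "planar_integral D P (\<lambda>_. 1) \<noteq> 0"
    by (metis less_irrefl sum.neutral)
  then show "P \<in> (\<lambda>D. affine hull D) ` \<D>"
    using planar_integral_other[OF P(1)] by blast
next
  fix P assume "P \<in> (\<lambda>D. affine hull D) ` \<D>"
  then obtain D where D: "D \<in> \<D>" "P = affine hull D" by blast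
  then have P: "is_plane P"
    using is_plane_hull by blast
  have "0 \<le> planar_integral D' P (\<lambda>_. 1)" if "D' \<in> \<D>" for D'
    using planar_integral_one[OF that] planar_integral_other[OF P that, of "\<lambda>_. 1"] by fastforce
  then have "0 < (\<Sum>D\<in>\<D>. planar_integral D P (\<lambda>_. 1))"
    using planar_integral_one[OF D(1)] D finite_\<D> by (intro sum_pos2[of _ D]) auto
  then show "P \<in> area_planes (\<Union>\<D>)"
    unfolding area_planes_def using P planar_area_eq planar_integral_Union convex_on_one by simp
qed

lemma surface_integral_eq:
  assumes f: "\<And>D. D \<in> \<D> \<Longrightarrow> convex_on D f"
  shows "surface_integral f (\<Union>\<D>) = (\<Sum>D\<in>\<D>. planar_integral D (affine hull D) f)"
proof -
  let ?\<P> = "(\<lambda>D. affine hull D) ` \<D>"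
  have "surface_integral f (\<Union>\<D>) = (\<Sum>P\<in>?\<P>. \<Sum>D\<in>\<D>. planar_integral D P f)"
    unfolding surface_integral_def area_planes_eq
    using planar_integral_Union is_plane_hull f by (intro sum.cong) auto
  also have "\<dots> = (\<Sum>D\<in>\<D>. \<Sum>P\<in>?\<P>. planar_integral D P f)"
    by (rule sum.swap)
  also have "\<dots> = (\<Sum>D\<in>\<D>. planar_integral D (affine hull D) f)"
  proof (rule sum.cong[OF refl])
    fix D assume D: "D \<in> \<D>"
    have "(\<Sum>P\<in>?\<P>. planar_integral D P f) = (\<Sum>P\<in>{affine hull D}. planar_integral D P f)"
      using D finite_\<D> planar_integral_other is_plane_hull by (intro sum.mono_neutral_right) auto
    then show "(\<Sum>P\<in>?\<P>. planar_integral D P f) = planar_integral D (affine hull D) f"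
      by simp
  qed
  finally show ?thesis .
qed

lemma surface_area_eq: "surface_area (\<Union>\<D>) = (\<Sum>D\<in>\<D>. planar_integral D (affine hull D) (\<lambda>_. 1))"
proof -
  have "surface_area (\<Union>\<D>) = surface_integral (\<lambda>_. 1) (\<Union>\<D>)"
    unfolding surface_area_def surface_integral_def
    using planar_area_eq by (intro sum.cong) (auto simp: area_planes_def)
  then show ?thesis
    using surface_integral_eq convex_on_one by simp
qed

end

subsection \<open>Averages over orbits\<close>

context regular_solid
begin

text \<open>A set of sets rather than a family indexed by the group: coinciding images occur once,
  as they do in the sums defining the averages.\<close>

definition orbit :: "real^3 \<Rightarrow> (real^3) set \<Rightarrow> (real^3) set set" where
  "orbit C X = (\<lambda>g. (+) C ` g ` X) ` G"

lemma finite_orbit: "finite (orbit C X)"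
  unfolding orbit_def using finite_G by simp

text \<open>The elements sending X to a given image form a coset of the stabiliser of X, so every
  fibre has the same size. This size is the constant n, and it does not depend on the
  summand.\<close>

lemma orbit_sum:
  obtains n where "0 < n" "\<And>\<phi> :: (real^3) set \<Rightarrow> real. (\<Sum>g\<in>G. \<phi> ((+) C ` g ` X)) = n * (\<Sum>Y\<in>orbit C X. \<phi> Y)"
proof -
  let ?S = "{g \<in> G. g ` X = X}"
  have fin: "finite ?S"
    using finite_G by simp
  have "id \<in> ?S"
    using id_in_G by simp
  then have "0 < card ?S"
    using fin card_gt_0_iff by blast
  have card: "card {h \<in> G. (+) C ` h ` X = (+) C ` g ` X} = card ?S" if g: "g \<in> G" for g
  proof -
    have "inv g ` g ` X = X"
      using G_inj[OF g] by (simp add: image_inv_f_f)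
    have "bij_betw (\<lambda>h. g \<circ> h) ?S {h \<in> G. h ` X = g ` X}"
    proof (rule bij_betw_byWitness[where f' = "\<lambda>h. inv g \<circ> h"])
      show "\<forall>h\<in>?S. inv g \<circ> (g \<circ> h) = h" "\<forall>h\<in>{h \<in> G. h ` X = g ` X}. g \<circ> (inv g \<circ> h) = h"
        using g by (auto simp: fun_eq_iff)
      show "(\<lambda>h. g \<circ> h) ` ?S \<subseteq> {h \<in> G. h ` X = g ` X}"
      proof (rule image_subsetI)
        fix h assume "h \<in> ?S"
        then show "g \<circ> h \<in> {h \<in> G. h ` X = g ` X}"
          using G_comp[OF g, of h] image_comp[of g h X] by simp
      qed
      show "(\<lambda>h. inv g \<circ> h) ` {h \<in> G. h ` X = g ` X} \<subseteq> ?S"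
      proof (intro image_subsetI)
        fix h assume "h \<in> {h \<in> G. h ` X = g ` X}"
        then show "inv g \<circ> h \<in> ?S"
          using G_comp[OF G_inv[OF g], of h] image_comp[of "inv g" h X] \<open>inv g ` g ` X = X\<close> by simp
      qed
    qed
    from bij_betw_same_card[OF this] show ?thesis
      by (simp add: translation_eq_iff)
  qed
  show ?thesis
  proof (rule that)
    show "0 < real (card ?S)"
      using \<open>0 < card ?S\<close> by simp
    fix \<phi> :: "(real^3) set \<Rightarrow> real"
    have "(\<Sum>g\<in>G. \<phi> ((+) C ` g ` X)) =
        (\<Sum>Y\<in>orbit C X. \<Sum>g\<in>{g \<in> G. (+) C ` g ` X = Y}. \<phi> ((+) C ` g ` X))"
      unfolding orbit_def by (rule sum.image_gen[OF finite_G])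
    also have "\<dots> = (\<Sum>Y\<in>orbit C X. real (card ?S) * \<phi> Y)"
    proof (rule sum.cong[OF refl])
      fix Y assume "Y \<in> orbit C X"
      then obtain g where g: "g \<in> G" "Y = (+) C ` g ` X"
        unfolding orbit_def by blast
      have "(\<Sum>g\<in>{g \<in> G. (+) C ` g ` X = Y}. \<phi> ((+) C ` g ` X)) = (\<Sum>g\<in>{g \<in> G. (+) C ` g ` X = Y}. \<phi> Y)"
        by (rule sum.cong) auto
      also have "\<dots> = real (card ?S) * \<phi> Y"
        using card[OF g(1)] g(2) by simp
      finally show "(\<Sum>g\<in>{g \<in> G. (+) C ` g ` X = Y}. \<phi> ((+) C ` g ` X)) = real (card ?S) * \<phi> Y" .
    qed
    finally show "(\<Sum>g\<in>G. \<phi> ((+) C ` g ` X)) = real (card ?S) * (\<Sum>Y\<in>orbit C X. \<phi> Y)"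
      by (simp add: sum_distrib_left)
  qed
qed

text \<open>Numerator and denominator both acquire the order of the stabiliser when written as sums
  over the group, and so the quotient becomes a plain mean.\<close>

lemma orbit_average:
  assumes \<psi>: "\<And>g. g \<in> G \<Longrightarrow> \<psi> ((+) C ` g ` X) = (k::real)" "0 < k"
    and \<phi>: "\<And>g. g \<in> G \<Longrightarrow> \<phi> ((+) C ` g ` X) = k * a g"
  shows "(\<Sum>Y\<in>orbit C X. \<phi> Y) / (\<Sum>Y\<in>orbit C X. \<psi> Y) = (\<Sum>g\<in>G. a g) / real (card G)"
proof -
  obtain n where n: "0 < n" "\<And>\<phi> :: (real^3) set \<Rightarrow> real. (\<Sum>g\<in>G. \<phi> ((+) C ` g ` X)) = n * (\<Sum>Y\<in>orbit C X. \<phi> Y)"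
    using orbit_sum by metis
  have "(\<Sum>Y\<in>orbit C X. \<phi> Y) / (\<Sum>Y\<in>orbit C X. \<psi> Y) =
      (n * (\<Sum>Y\<in>orbit C X. \<phi> Y)) / (n * (\<Sum>Y\<in>orbit C X. \<psi> Y))"
    using n(1) by simp
  also have "\<dots> = (\<Sum>g\<in>G. k * a g) / (\<Sum>g\<in>G. k)"
    unfolding n(2)[symmetric] using \<psi>(1) \<phi> by simp
  also have "\<dots> = (\<Sum>g\<in>G. a g) / real (card G)"
    using \<psi>(2) by (simp add: sum_distrib_left[symmetric] mult.commute)
  finally show ?thesis .
qed

text \<open>Undoing the translation and the first symmetry turns an overlap of two images into an
  overlap of X with one of its images.\<close>

lemma orbit_non_overlap:
  assumes ovl: "\<And>g x. g \<in> G \<Longrightarrow> x \<in> rel_interior X \<Longrightarrow> x \<in> g ` X \<Longrightarrow> g ` X = X"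
    and Y: "Y \<in> orbit C X" "Y' \<in> orbit C X" "rel_interior Y \<inter> Y' \<noteq> {}"
  shows "Y = Y'"
proof -
  obtain g h where g: "g \<in> G" "Y = (+) C ` g ` X" and h: "h \<in> G" "Y' = (+) C ` h ` X"
    using Y unfolding orbit_def by blast
  have "rel_interior Y = (+) C ` rel_interior (g ` X)"
    unfolding g(2) using rel_interior_translation[of C "g ` X"] by simp
  also have "rel_interior (g ` X) = g ` rel_interior X"
    using rel_interior_injective_linear_image[OF linear_conv_bounded_linear[THEN iffD1, OF G_linear[OF g(1)]] G_inj[OF g(1)]] .
  finally have "(+) C ` g ` rel_interior X \<inter> (+) C ` h ` X \<noteq> {}"
    using Y(3) h(2) by simp
  then obtain x y where x: "x \<in> rel_interior X" and y: "y \<in> X" and eq: "C + g x = C + h y"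
    by fast
  have "x = (inv g \<circ> h) y"
    using eq g(1) by (metis G_inv_f(1) add_left_imp_eq comp_apply)
  then have "(inv g \<circ> h) ` X = X"
    using ovl[OF G_comp[OF G_inv[OF g(1)] h(1)] x] y by blast
  then have "g ` inv g ` h ` X = g ` X"
    using image_comp[of "inv g" h X] by simp
  then have "h ` X = g ` X"
    using G_surj[OF g(1)] by (simp add: image_f_inv_f)
  then show ?thesis
    using g h by simp
qed

section \<open>Averages over orbits of segments, tetrahedra and triangles\<close>

lemma translated_hull: "g \<in> G \<Longrightarrow> (+) C ` g ` (convex hull S) = convex hull ((\<lambda>x. C + g x) ` S)"
  using convex_hull_linear_image[OF G_linear] convex_hull_translation[of C "g ` S"] by (simp add: image_image)

lemma translated_segment: "g \<in> G \<Longrightarrow> (+) C ` g ` closed_segment a b = closed_segment (C + g a) (C + g b)"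
  using translated_hull[of g C "{a, b}"] by (simp add: segment_convex_hull)

lemma avg_segs_orbit:
  assumes "a \<noteq> b"
  shows "avg_segs f (orbit C (closed_segment a b)) = (\<Sum>g\<in>G. seg_avg f (C + g a) (C + g b)) / real (card G)"
  unfolding avg_segs_def
proof (rule orbit_average)
  show "0 < dist a b" using assms by simp
  fix g assume g: "g \<in> G"
  have d: "dist (C + g a) (C + g b) = dist a b"
    using G_orth[OF g] G_linear[OF g] by (simp add: dist_norm orthogonal_transformation_norm linear_diff[symmetric])
  show "seg_integral (\<lambda>_. 1) ((+) C ` g ` closed_segment a b) = dist a b"
    unfolding translated_segment[OF g] seg_integral_closed_segment d by (simp add: seg_avg_def)
  show "seg_integral f ((+) C ` g ` closed_segment a b) = dist a b * seg_avg f (C + g a) (C + g b)"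
    unfolding translated_segment[OF g] seg_integral_closed_segment d by simp
qed

lemma independent_images:
  assumes "g \<in> G" "0 < \<kappa>" "\<alpha> *\<^sub>R g (\<kappa> *\<^sub>R c) + \<beta> *\<^sub>R g v + \<gamma> *\<^sub>R g w = 0"
  shows "\<alpha> = 0 \<and> \<beta> = 0 \<and> \<gamma> = 0"
proof -
  have "g (\<alpha> *\<^sub>R \<kappa> *\<^sub>R c + \<beta> *\<^sub>R v + \<gamma> *\<^sub>R w) = \<alpha> *\<^sub>R g (\<kappa> *\<^sub>R c) + \<beta> *\<^sub>R g v + \<gamma> *\<^sub>R g w"
    using G_linear[OF assms(1)] by (simp add: linear_add linear_scale)
  then have 0: "\<alpha> *\<^sub>R \<kappa> *\<^sub>R c + \<beta> *\<^sub>R v + \<gamma> *\<^sub>R w = 0"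
    using assms G_inj[OF assms(1)] G_linear[OF assms(1)] linear_injective_0 by metis
  have ne: "\<kappa> *\<^sub>R c \<noteq> v" "\<kappa> *\<^sub>R c \<noteq> w" "v \<noteq> w"
    using independent_cvw(2)[OF assms(2)] by (auto simp: card_insert_if split: if_splits)
  define u where "u x = (if x = \<kappa> *\<^sub>R c then \<alpha> else if x = v then \<beta> else \<gamma>)" for x
  have "(\<Sum>x\<in>{\<kappa> *\<^sub>R c, v, w}. u x *\<^sub>R x) = 0"
    using 0 ne by (simp add: u_def add.assoc)
  then have "\<forall>x\<in>{\<kappa> *\<^sub>R c, v, w}. u x = 0"
    using independent_cvw(1)[OF assms(2)] dependent_finite[of "{\<kappa> *\<^sub>R c, v, w}"] by blast
  then show ?thesis
    using ne by (auto simp: u_def)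
qed

lemma translated_tet: "g \<in> G \<Longrightarrow> (+) C ` g ` tet \<kappa> = convex hull {C, C + g (\<kappa> *\<^sub>R c), C + g v, C + g w}"
  unfolding tet_def by (simp add: translated_hull linear_0[OF G_linear])

lemma polytope_tet: "g \<in> G \<Longrightarrow> polytope ((+) C ` g ` tet \<kappa>)"
  by (simp only: translated_tet) (simp add: polytope_convex_hull)

text \<open>Distinct tetrahedra meet in negligible sets and all have the same volume, so the
  integral and the volume of the union are both sums over the orbit.\<close>

lemma avg_vol_orbit:
  assumes \<kappa>: "0 < \<kappa>" and f: "\<And>g. g \<in> G \<Longrightarrow> convex_on ((+) C ` g ` tet \<kappa>) f"
  shows "avg_vol f (\<Union>(orbit C (tet \<kappa>))) =
    (\<Sum>g\<in>G. avg_vol f (convex hull {C, C + g (\<kappa> *\<^sub>R c), C + g v, C + g w})) / real (card G)"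
proof -
  have pw: "pairwise (\<lambda>T T'. negligible (T \<inter> T')) (orbit C (tet \<kappa>))"
  proof (rule pairwiseI)
    fix T T' assume T: "T \<in> orbit C (tet \<kappa>)" "T' \<in> orbit C (tet \<kappa>)" "T \<noteq> T'"
    have "rel_interior T \<inter> T' = {}"
      using orbit_non_overlap[of "tet \<kappa>" T C T'] tet_overlap[OF \<kappa>] T by blast
    then have "T \<inter> T' \<subseteq> T - interior T"
      using interior_subset_rel_interior by blast
    moreover have "convex T"
      using T(1) polytope_tet polytope_imp_convex unfolding orbit_def by blast
    ultimately show "negligible (T \<inter> T')"
      using negligible_Diff_interior negligible_subset by metis
  qed
  have hasint: "(f has_integral (\<Sum>T\<in>orbit C (tet \<kappa>). integral T f)) (\<Union>(orbit C (tet \<kappa>)))"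
    if f: "\<And>g. g \<in> G \<Longrightarrow> convex_on ((+) C ` g ` tet \<kappa>) f" for f
  proof (rule has_integral_Union[OF finite_orbit _ pw])
    show "(f has_integral integral T f) T" if T: "T \<in> orbit C (tet \<kappa>)" for T
    proof -
      have "polytope T" "convex_on T f"
        using T f polytope_tet unfolding orbit_def by blast+
      then have "f absolutely_integrable_on T"
        by (rule convex_on_polytope_absolutely_integrable)
      then show ?thesis
        by (intro integrable_integral) (simp add: absolutely_integrable_on_def)
    qed
  qed
  have lm: "T \<in> lmeasurable" if "T \<in> orbit C (tet \<kappa>)" for T
    using that polytope_tet polytope_imp_compact lmeasurable_compact unfolding orbit_def by blast
  have lmU: "\<Union>(orbit C (tet \<kappa>)) \<in> lmeasurable"
    using lm finite_orbit by (intro fmeasurable.finite_Union) auto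
  have "measure lebesgue (\<Union>(orbit C (tet \<kappa>))) = integral (\<Union>(orbit C (tet \<kappa>))) (\<lambda>_. 1)"
    using lmU by (rule lmeasure_integral)
  also have "\<dots> = (\<Sum>T\<in>orbit C (tet \<kappa>). integral T (\<lambda>_. 1))"
    by (intro integral_unique hasint convex_on_const[THEN iffD2] polytope_imp_convex polytope_tet)
  also have "\<dots> = (\<Sum>T\<in>orbit C (tet \<kappa>). measure lebesgue T)"
    using lmeasure_integral[OF lm] by simp
  finally have den: "measure lebesgue (\<Union>(orbit C (tet \<kappa>))) = (\<Sum>T\<in>orbit C (tet \<kappa>). measure lebesgue T)" .
  have num: "integral (\<Union>(orbit C (tet \<kappa>))) f = (\<Sum>T\<in>orbit C (tet \<kappa>). integral T f)"
    using f by (intro integral_unique hasint)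
  have tlm: "tet \<kappa> \<in> lmeasurable"
    unfolding tet_def by (intro lmeasurable_compact finite_imp_compact_convex_hull) simp
  have "\<not> negligible (tet \<kappa>)"
  proof -
    have "0 \<notin> {\<kappa> *\<^sub>R c, v, w}"
      using independent_cvw(1)[OF \<kappa>] dependent_zero[of "{\<kappa> *\<^sub>R c, v, w}"] by meson
    then have nd: "\<not> affine_dependent {0, \<kappa> *\<^sub>R c, v, w}" and card: "card {0, \<kappa> *\<^sub>R c, v, w} = 4"
      using affine_dependent_iff_dependent[of 0 "{\<kappa> *\<^sub>R c, v, w}"] independent_cvw[OF \<kappa>] by auto
    have "interior (tet \<kappa>) \<noteq> {}"
      unfolding tet_def using interior_convex_hull_eq_empty[of "{0, \<kappa> *\<^sub>R c, v, w}"] nd card by simp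
    then show ?thesis
      using negligible_convex_interior[of "tet \<kappa>"] unfolding tet_def by simp
  qed
  then have pos: "0 < measure lebesgue (tet \<kappa>)"
    using tlm negligible_iff_measure zero_less_measure_iff by blast
  have meas: "measure lebesgue ((+) C ` g ` tet \<kappa>) = measure lebesgue (tet \<kappa>)" if "g \<in> G" for g
    using measure_translation[of C "g ` tet \<kappa>"] measure_orthogonal_image[OF G_orth[OF that] tlm] by simp
  have "avg_vol f (\<Union>(orbit C (tet \<kappa>))) = (\<Sum>T\<in>orbit C (tet \<kappa>). integral T f) / (\<Sum>T\<in>orbit C (tet \<kappa>). measure lebesgue T)"
    unfolding avg_vol_def den num ..
  also have "\<dots> = (\<Sum>g\<in>G. avg_vol f ((+) C ` g ` tet \<kappa>)) / real (card G)"
  proof (rule orbit_average[where \<psi> = "measure lebesgue", OF _ pos])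
    show "measure lebesgue ((+) C ` g ` tet \<kappa>) = measure lebesgue (tet \<kappa>)" if "g \<in> G" for g
      using meas[OF that] .
    show "integral ((+) C ` g ` tet \<kappa>) f = measure lebesgue (tet \<kappa>) * avg_vol f ((+) C ` g ` tet \<kappa>)" if "g \<in> G" for g
      unfolding avg_vol_def meas[OF that] using pos by simp
  qed
  finally show ?thesis
    using translated_tet by simp
qed

lemma translated_tri:
  "g \<in> G \<Longrightarrow> (+) C ` g ` tri \<kappa> t = convex hull {C + g (t *\<^sub>R \<kappa> *\<^sub>R c), C + g (t *\<^sub>R v), C + g (t *\<^sub>R w)}"
  unfolding tri_def by (simp only: translated_hull image_insert image_empty)

lemma tri_subset_tet:
  assumes "0 \<le> t" "t \<le> 1"
  shows "tri \<kappa> t \<subseteq> tet \<kappa>"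
proof -
  have "t *\<^sub>R x \<in> tet \<kappa>" if "x \<in> {\<kappa> *\<^sub>R c, v, w}" for x
  proof -
    have "x \<in> tet \<kappa>" "0 \<in> tet \<kappa>"
      using that unfolding tet_def by (auto intro: hull_inc)
    then show ?thesis
      using convexD_alt[of "tet \<kappa>" 0 x t] assms unfolding tet_def by simp
  qed
  then show ?thesis
    unfolding tri_def by (intro hull_minimal) (auto simp: tet_def simp del: scaleR_scaleR)
qed

text \<open>The value t = 1 gives the boundary of the star body and t = 3/4 that of its homothetic
  copy. The bound t \<le> 1 keeps the triangles inside the tetrahedra on which f is convex.\<close>

lemma avg_surf_orbit:
  assumes \<kappa>: "0 < \<kappa>" and t: "0 < t" "t \<le> 1" and f: "\<And>g. g \<in> G \<Longrightarrow> convex_on ((+) C ` g ` tet \<kappa>) f"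
  shows "avg_surf f (\<Union>(orbit C (tri \<kappa> t))) =
    (\<Sum>g\<in>G. tri_avg f (C + g (t *\<^sub>R \<kappa> *\<^sub>R c)) (C + g (t *\<^sub>R v)) (C + g (t *\<^sub>R w))) / real (card G)"
proof -
  let ?p = "\<lambda>g. C + g (t *\<^sub>R \<kappa> *\<^sub>R c)" and ?q = "\<lambda>g. C + g (t *\<^sub>R v)" and ?r = "\<lambda>g. C + g (t *\<^sub>R w)"
  have nc: "noncollinear (?p g) (?q g) (?r g)" if g: "g \<in> G" for g
    unfolding noncollinear_def
  proof (intro allI impI)
    fix y z assume 0: "y *\<^sub>R (?q g - ?p g) + z *\<^sub>R (?r g - ?p g) = 0"
    have "(- (y + z) * t) *\<^sub>R g (\<kappa> *\<^sub>R c) + (y * t) *\<^sub>R g v + (z * t) *\<^sub>R g w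
        = y *\<^sub>R (?q g - ?p g) + z *\<^sub>R (?r g - ?p g)"
      using G_linear[OF g] by (simp add: linear_scale algebra_simps)
    then have "y * t = 0 \<and> z * t = 0"
      using independent_images[OF g \<kappa>] 0 by metis
    then show "y = 0 \<and> z = 0"
      using t by simp
  qed
  interpret S: triangulated_surface "orbit C (tri \<kappa> t)"
  proof
    show "finite (orbit C (tri \<kappa> t))"
      by (rule finite_orbit)
    show "\<exists>p q r. noncollinear p q r \<and> D = convex hull {p, q, r}" if "D \<in> orbit C (tri \<kappa> t)" for D
    proof -
      from that obtain g where g: "g \<in> G" "D = (+) C ` g ` tri \<kappa> t"
        unfolding orbit_def by blast
      then show ?thesis
        using nc[OF g(1)] translated_tri[OF g(1)] by blast
    qed
    show "D = D'" if "D \<in> orbit C (tri \<kappa> t)" "D' \<in> orbit C (tri \<kappa> t)" "rel_interior D \<inter> D' \<noteq> {}" for D D'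
      using orbit_non_overlap[OF _ that] tri_overlap[OF \<kappa> t(1)] by blast
  qed
  have ft: "convex_on ((+) C ` g ` tri \<kappa> t) f" if g: "g \<in> G" for g
  proof (rule convex_on_subset[OF f[OF g]])
    show "(+) C ` g ` tri \<kappa> t \<subseteq> (+) C ` g ` tet \<kappa>"
      using tri_subset_tet[of t \<kappa>] t by (intro image_mono) auto
    show "convex ((+) C ` g ` tri \<kappa> t)"
      unfolding translated_tri[OF g] by simp
  qed
  have fD: "convex_on D f" if "D \<in> orbit C (tri \<kappa> t)" for D
    using ft that unfolding orbit_def by blast
  define \<gamma> where "\<gamma> = gram_area (t *\<^sub>R v - t *\<^sub>R \<kappa> *\<^sub>R c) (t *\<^sub>R w - t *\<^sub>R \<kappa> *\<^sub>R c)"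
  have \<gamma>: "gram_area (?q g - ?p g) (?r g - ?p g) = \<gamma>" if g: "g \<in> G" for g
  proof -
    have "?q g - ?p g = g (t *\<^sub>R v - t *\<^sub>R \<kappa> *\<^sub>R c)" "?r g - ?p g = g (t *\<^sub>R w - t *\<^sub>R \<kappa> *\<^sub>R c)"
      using G_linear[OF g] by (simp_all add: linear_diff)
    then show ?thesis
      unfolding gram_area_def \<gamma>_def using G_inner[OF g] by simp
  qed
  have hull: "affine hull ((+) C ` g ` tri \<kappa> t) = affine hull {?p g, ?q g, ?r g}" if g: "g \<in> G" for g
    unfolding translated_tri[OF g] by (rule affine_hull_convex_hull)
  have plan: "planar_integral ((+) C ` g ` tri \<kappa> t) (affine hull ((+) C ` g ` tri \<kappa> t)) f' =
      (\<gamma> * measure lebesgue std_triangle) * tri_avg f' (?p g) (?q g) (?r g)"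
    if g: "g \<in> G" and f': "convex_on ((+) C ` g ` tri \<kappa> t) f'" for g f'
    using chart_triangle(2)[OF nc[OF g] hull[OF g], of f'] f' std_triangle_measure(2)
    unfolding translated_tri[OF g, symmetric] \<gamma>[OF g] by (simp add: tri_avg_def triangle_avg_def)
  have "0 < \<gamma>"
    using chart_triangle(3)[OF nc[OF id_in_G] refl, of "\<lambda>_. 0"] \<gamma>[OF id_in_G] by (simp add: convex_on_const)
  then have pos: "0 < \<gamma> * measure lebesgue std_triangle"
    using std_triangle_measure(2) by simp
  have "avg_surf f (\<Union>(orbit C (tri \<kappa> t))) =
      (\<Sum>D\<in>orbit C (tri \<kappa> t). planar_integral D (affine hull D) f) /
      (\<Sum>D\<in>orbit C (tri \<kappa> t). planar_integral D (affine hull D) (\<lambda>_. 1))"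
    unfolding avg_surf_def using S.surface_integral_eq[OF fD] S.surface_area_eq by simp
  also have "\<dots> = (\<Sum>g\<in>G. tri_avg f (?p g) (?q g) (?r g)) / real (card G)"
  proof (rule orbit_average[OF _ pos])
    fix g assume g: "g \<in> G"
    have lm: "std_triangle \<in> lmeasurable"
      using polytope_regions(3) polytope_imp_compact lmeasurable_compact by blast
    have "convex_on ((+) C ` g ` tri \<kappa> t) (\<lambda>_. 1::real)"
      unfolding translated_tri[OF g] by (simp add: convex_on_const)
    moreover have "tri_avg (\<lambda>_. 1) (?p g) (?q g) (?r g) = 1"
      using lmeasure_integral[OF lm] std_triangle_measure(2) by (simp add: tri_avg_def triangle_avg_def case_prod_unfold)
    ultimately show "planar_integral ((+) C ` g ` tri \<kappa> t) (affine hull ((+) C ` g ` tri \<kappa> t)) (\<lambda>_. 1) =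
        \<gamma> * measure lebesgue std_triangle"
      using plan[OF g] by simp
    show "planar_integral ((+) C ` g ` tri \<kappa> t) (affine hull ((+) C ` g ` tri \<kappa> t)) f =
        \<gamma> * measure lebesgue std_triangle * tri_avg f (?p g) (?q g) (?r g)"
      using plan[OF g ft[OF g]] .
  qed
  finally show ?thesis .
qed

text \<open>Each inequality is the mean over the group of one on a single tetrahedron. The pairs of
  opposite edges used are centre-apex with v-w and centre-v with apex-w; the third pair is the
  mirror image of the second in \<open>a0\<close> and has the same orbits.\<close>

lemma orbit_inequalities:
  assumes \<kappa>: "0 < \<kappa>" and f: "\<And>g. g \<in> G \<Longrightarrow> convex_on ((+) C ` g ` tet \<kappa>) f"
  defines "A \<equiv> avg_vol f (\<Union>(orbit C (tet \<kappa>)))"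
  shows "A \<le> (1/4) * f C + (3/4) * avg_surf f (\<Union>(orbit C (tri \<kappa> 1)))"
    "A \<le> (1/2) * avg_segs f (orbit C (closed_segment 0 (\<kappa> *\<^sub>R c))) + (1/2) * avg_segs f (orbit C (closed_segment v w))"
    "A \<le> (1/2) * avg_segs f (orbit C (closed_segment 0 v)) + (1/2) * avg_segs f (orbit C (closed_segment (\<kappa> *\<^sub>R c) w))"
    "avg_surf f (\<Union>(orbit C (tri \<kappa> (3/4)))) \<le> A"
proof -
  let ?a = "\<kappa> *\<^sub>R c"
  let ?n = "real (card G)"
  have n: "0 < ?n"
    using finite_G id_in_G card_gt_0_iff by auto
  have ne: "0 \<noteq> ?a" "v \<noteq> w" "0 \<noteq> v" "?a \<noteq> w"
    using independent_cvw(2)[OF \<kappa>] \<kappa> c_pos v_neq_w dual0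
    by (auto simp: card_insert_if split: if_splits)
  have A: "A = (\<Sum>g\<in>G. avg_vol f (convex hull {C, C + g ?a, C + g v, C + g w})) / ?n"
    unfolding A_def using avg_vol_orbit[OF \<kappa> f] .
  have ind: "\<alpha> = 0 \<and> \<beta> = 0 \<and> \<gamma> = 0"
    if "g \<in> G" "\<alpha> *\<^sub>R (C + g ?a - C) + \<beta> *\<^sub>R (C + g v - C) + \<gamma> *\<^sub>R (C + g w - C) = 0" for g \<alpha> \<beta> \<gamma>
    using independent_images[OF that(1) \<kappa>] that(2) by simp
  have fT: "convex_on (convex hull {C, C + g ?a, C + g v, C + g w}) f" if "g \<in> G" for g
    using f[OF that] translated_tet[OF that] by simp
  have "(\<Sum>g\<in>G. avg_vol f (convex hull {C, C + g ?a, C + g v, C + g w}))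
      \<le> (\<Sum>g\<in>G. (1/4) * f C + (3/4) * tri_avg f (C + g ?a) (C + g v) (C + g w))"
  proof (rule sum_mono)
    fix g assume g: "g \<in> G"
    show "avg_vol f (convex hull {C, C + g ?a, C + g v, C + g w})
        \<le> (1/4) * f C + (3/4) * tri_avg f (C + g ?a) (C + g v) (C + g w)"
      by (rule tetrahedron_cone(1)[OF ind[OF g] fT[OF g]])
  qed
  also have "\<dots> = ?n * ((1/4) * f C) + (3/4) * (\<Sum>g\<in>G. tri_avg f (C + g ?a) (C + g v) (C + g w))"
    by (simp add: sum.distrib sum_distrib_left)
  finally show "A \<le> (1/4) * f C + (3/4) * avg_surf f (\<Union>(orbit C (tri \<kappa> 1)))"
    using avg_surf_orbit[of \<kappa> 1 C f] \<kappa> f n unfolding A by (simp add: field_simps)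
  have "(\<Sum>g\<in>G. avg_vol f (convex hull {C, C + g ?a, C + g v, C + g w}))
      \<le> (\<Sum>g\<in>G. (1/2) * seg_avg f (C + g 0) (C + g ?a) + (1/2) * seg_avg f (C + g v) (C + g w))"
  proof (rule sum_mono)
    fix g assume g: "g \<in> G"
    show "avg_vol f (convex hull {C, C + g ?a, C + g v, C + g w})
        \<le> (1/2) * seg_avg f (C + g 0) (C + g ?a) + (1/2) * seg_avg f (C + g v) (C + g w)"
      using tetrahedron_edges[OF ind[OF g] fT[OF g]] by (simp add: linear_0[OF G_linear[OF g]])
  qed
  also have "\<dots> = (1/2) * (\<Sum>g\<in>G. seg_avg f (C + g 0) (C + g ?a)) + (1/2) * (\<Sum>g\<in>G. seg_avg f (C + g v) (C + g w))"
    by (simp add: sum.distrib sum_distrib_left)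
  finally show "A \<le> (1/2) * avg_segs f (orbit C (closed_segment 0 ?a)) + (1/2) * avg_segs f (orbit C (closed_segment v w))"
    unfolding A avg_segs_orbit[OF ne(1)] avg_segs_orbit[OF ne(2)] using n by (simp add: field_simps)
  have "(\<Sum>g\<in>G. avg_vol f (convex hull {C, C + g ?a, C + g v, C + g w}))
      \<le> (\<Sum>g\<in>G. (1/2) * seg_avg f (C + g 0) (C + g v) + (1/2) * seg_avg f (C + g ?a) (C + g w))"
  proof (rule sum_mono)
    fix g assume g: "g \<in> G"
    \<comment> \<open>Exchanging the apex with the image of \<open>v\<close> changes which edges
      count as opposite: now centre-v and apex-w.\<close>
    have eq: "{C, C + g ?a, C + g v, C + g w} = {C, C + g v, C + g ?a, C + g w}"
      by blast
    have ind': "\<alpha> = 0 \<and> \<beta> = 0 \<and> \<gamma> = 0"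
      if "\<alpha> *\<^sub>R (C + g v - C) + \<beta> *\<^sub>R (C + g ?a - C) + \<gamma> *\<^sub>R (C + g w - C) = 0" for \<alpha> \<beta> \<gamma>
      using ind[OF g, of \<beta> \<alpha> \<gamma>] that by (simp add: add_ac)
    have "convex_on (convex hull {C, C + g v, C + g ?a, C + g w}) f"
      using fT[OF g] unfolding eq .
    from tetrahedron_edges[OF ind' this] show
      "avg_vol f (convex hull {C, C + g ?a, C + g v, C + g w})
        \<le> (1/2) * seg_avg f (C + g 0) (C + g v) + (1/2) * seg_avg f (C + g ?a) (C + g w)"
      unfolding eq linear_0[OF G_linear[OF g]] by simp
  qed
  also have "\<dots> = (1/2) * (\<Sum>g\<in>G. seg_avg f (C + g 0) (C + g v)) + (1/2) * (\<Sum>g\<in>G. seg_avg f (C + g ?a) (C + g w))"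
    by (simp add: sum.distrib sum_distrib_left)
  finally show "A \<le> (1/2) * avg_segs f (orbit C (closed_segment 0 v)) + (1/2) * avg_segs f (orbit C (closed_segment ?a w))"
    unfolding A avg_segs_orbit[OF ne(3)] avg_segs_orbit[OF ne(4)] using n by (simp add: field_simps)
  have "(\<Sum>g\<in>G. tri_avg f (C + g ((3/4) *\<^sub>R ?a)) (C + g ((3/4) *\<^sub>R v)) (C + g ((3/4) *\<^sub>R w)))
      \<le> (\<Sum>g\<in>G. avg_vol f (convex hull {C, C + g ?a, C + g v, C + g w}))"
  proof (rule sum_mono)
    fix g assume g: "g \<in> G"
    have "homothety C (3/4) (C + g x) = C + g ((3/4) *\<^sub>R x)" for x
      using G_linear[OF g] by (simp add: homothety_def linear_scale)
    then show "tri_avg f (C + g ((3/4) *\<^sub>R ?a)) (C + g ((3/4) *\<^sub>R v)) (C + g ((3/4) *\<^sub>R w))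
        \<le> avg_vol f (convex hull {C, C + g ?a, C + g v, C + g w})"
      using tetrahedron_cone(2)[OF ind[OF g] fT[OF g]] by (simp del: scaleR_scaleR)
  qed
  then show "avg_surf f (\<Union>(orbit C (tri \<kappa> (3/4)))) \<le> A"
    using avg_surf_orbit[of \<kappa> "3/4" C f] \<kappa> f n unfolding A by (simp add: divide_right_mono del: scaleR_scaleR)
qed

end

subsection \<open>The inequalities for the star body\<close>

lemma face_center_translation:
  assumes "finite (vertices_of S)" "vertices_of S \<noteq> {}"
  shows "face_center ((+) C ` S) = C + face_center S"
proof -
  have v: "vertices_of ((+) C ` S) = (+) C ` vertices_of S"
    unfolding vertices_of_def using extreme_points_of_translation[of C S] by simp
  have inj: "inj_on ((+) C) (vertices_of S)"
    by simp
  have "(\<Sum>x\<in>(+) C ` vertices_of S. x) = (\<Sum>x\<in>vertices_of S. C + x)"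
    using sum.reindex[OF inj, of "\<lambda>x. x"] by simp
  also have "\<dots> = real (card (vertices_of S)) *\<^sub>R C + (\<Sum>x\<in>vertices_of S. x)"
    by (simp add: sum.distrib sum_constant_scaleR del: sum_constant)
  finally show ?thesis
    unfolding face_center_def v using assms by (simp add: card_image scaleR_add_right)
qed

lemma translated_facet_of: "(+) C ` K facet_of (+) C ` S \<longleftrightarrow> K facet_of S"
  unfolding facet_of_def by (simp add: aff_dim_translation_eq)

lemma translated_subset_cases:
  fixes C :: "real^3"
  assumes "K \<subseteq> (+) C ` S"
  obtains K' where "K = (+) C ` K'"
  using assms subset_imageE by metis

context regular_solid
begin

section \<open>Facets, edges and vertices of the translated body\<close>

lemma facets_translated: "K facet_of (+) C ` B \<longleftrightarrow> (\<exists>g\<in>G. K = (+) C ` g ` F)"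
proof
  assume K: "K facet_of (+) C ` B"
  then obtain K' where K': "K = (+) C ` K'"
    using translated_subset_cases[OF facet_of_imp_subset[OF K]] by blast
  then show "\<exists>g\<in>G. K = (+) C ` g ` F"
    using K facets_orbit[of K'] translated_facet_of[of C K' B] by auto
next
  assume "\<exists>g\<in>G. K = (+) C ` g ` F"
  then obtain g where "g \<in> G" "K = (+) C ` g ` F" by blast
  then show "K facet_of (+) C ` B"
    using G_facet[of g] translated_facet_of[of C "g ` F" B] by simp
qed

lemma edges_translated:
  "{K. K face_of (+) C ` B \<and> aff_dim K = 1} = orbit C (closed_segment v w)"
proof (intro equalityI subsetI)
  fix K assume K: "K \<in> {K. K face_of (+) C ` B \<and> aff_dim K = 1}"
  then have "K \<subseteq> (+) C ` B"
    using face_of_imp_subset by blast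
  then obtain K' where K': "K = (+) C ` K'"
    by (rule translated_subset_cases)
  then have "K' face_of B \<and> aff_dim K' = 1"
    using K by (simp add: aff_dim_translation_eq)
  then obtain g where "g \<in> G" "K' = g ` closed_segment v w"
    using edges_orbit[of K'] by auto
  then show "K \<in> orbit C (closed_segment v w)"
    unfolding orbit_def K' by simp
next
  fix K assume "K \<in> orbit C (closed_segment v w)"
  then obtain g where "g \<in> G" "K = (+) C ` g ` closed_segment v w"
    unfolding orbit_def by blast
  moreover from this have "g ` closed_segment v w face_of B \<and> aff_dim (g ` closed_segment v w) = 1"
    using edges_orbit[of "g ` closed_segment v w"] by blast
  ultimately show "K \<in> {K. K face_of (+) C ` B \<and> aff_dim K = 1}"
    by (simp add: aff_dim_translation_eq)
qed

lemma vertices_translated: "x extreme_point_of (+) C ` B \<longleftrightarrow> (\<exists>g\<in>G. x = C + g v)"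
proof -
  have "x extreme_point_of (+) C ` B \<longleftrightarrow> x - C extreme_point_of B"
    using extreme_point_of_translation_eq[of C "x - C" B] by simp
  also have "\<dots> \<longleftrightarrow> (\<exists>g\<in>G. x - C = g v)"
    by (rule vertices_orbit)
  finally show ?thesis
    by (simp add: diff_eq_eq add.commute)
qed

lemma facet_vertices_translated:
  assumes "g \<in> G"
  shows "x extreme_point_of (+) C ` g ` F \<longleftrightarrow> (\<exists>h\<in>G. h c = c \<and> x = C + g (h w))"
proof
  assume x: "x extreme_point_of (+) C ` g ` F"
  then have "x - C extreme_point_of g ` F"
    using extreme_point_of_translation_eq[of C "x - C" "g ` F"] by simp
  then obtain y where y: "y extreme_point_of F" "x - C = g y"
    using linear_image_extreme_points[OF G_linear[OF assms] G_inj[OF assms], of F] by blast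
  then obtain h where "h \<in> G" "h c = c" "y = h w"
    using vertex_of_F by blast
  then show "\<exists>h\<in>G. h c = c \<and> x = C + g (h w)"
    using y(2) by (auto simp: diff_eq_eq add.commute)
next
  assume "\<exists>h\<in>G. h c = c \<and> x = C + g (h w)"
  then obtain h where h: "h \<in> G" "h c = c" "x = C + g (h w)" by blast
  have "w extreme_point_of F"
    using extreme_point_of_F w_in_F ends_extreme by blast
  then have "h w extreme_point_of F"
    using linear_extreme_point_of_image[OF G_linear[OF h(1)] G_inj[OF h(1)], of w F] G_fix_c_F[OF h(1,2)] by simp
  then have "g (h w) extreme_point_of g ` F"
    using linear_extreme_point_of_image[OF G_linear[OF assms] G_inj[OF assms]] by blast
  then show "x extreme_point_of (+) C ` g ` F"
    unfolding h(3) by (simp add: extreme_point_of_translation_eq)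
qed

lemma face_center_facet:
  assumes "g \<in> G"
  shows "face_center ((+) C ` g ` F) = C + g c"
proof -
  have ne: "vertices_of F \<noteq> {}"
    using F_hull v_in_F by auto
  have vg: "vertices_of (g ` F) = g ` vertices_of F"
    using G_vertices_of[OF assms] .
  have inj: "inj_on g (vertices_of F)"
    using G_inj[OF assms] inj_on_subset by blast
  have "face_center (g ` F) = g (face_center F)"
    unfolding face_center_def vg card_image[OF inj]
    using G_linear[OF assms] sum.reindex[OF inj, of "\<lambda>x. x"] by (simp add: linear_scale linear_sum)
  then show ?thesis
    using face_center_translation[of "g ` F" C] vg ne finite_extreme_F face_center_F by simp
qed

text \<open>The offset of the apex from the face centre is orthogonal to the facet, hence a multiple
  of \<open>g c\<close>; its length is h and \<open>build\<close> decides its direction, so the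
  factor is 1 plus or minus h / norm c. When excavating, positivity holds because h is less than the
  distance from the centre to the facet, which is at most norm c since \<open>c\<close> lies in
  \<open>F\<close>.\<close>

lemma apex_formula:
  assumes pyr: "regular_pyramids ((+) C ` B) C build h apex"
  defines "\<kappa> \<equiv> if build then 1 + h / norm c else 1 - h / norm c"
  shows "0 < \<kappa>" "build \<Longrightarrow> 1 < \<kappa>" "\<not> build \<Longrightarrow> \<kappa> < 1"
    and "\<And>g. g \<in> G \<Longrightarrow> apex ((+) C ` g ` F) = C + g (\<kappa> *\<^sub>R c)"
proof -
  have h: "0 < h"
    using pyr unfolding regular_pyramids_def by blast
  have nc: "0 < norm c"
    using c_pos by auto
  have P: "(\<forall>x\<in>(+) C ` g ` F. \<forall>y\<in>(+) C ` g ` F. (apex ((+) C ` g ` F) - (C + g c)) \<bullet> (x - y) = 0) \<and>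
      norm (apex ((+) C ` g ` F) - (C + g c)) = h \<and>
      (if build then (apex ((+) C ` g ` F) - (C + g c)) \<bullet> g c > 0
       else (apex ((+) C ` g ` F) - (C + g c)) \<bullet> g c < 0 \<and> h < infdist C ((+) C ` g ` F))" if "g \<in> G" for g
  proof -
    have "(+) C ` g ` F facet_of (+) C ` B"
      using facets_translated that by blast
    then show ?thesis
      using pyr face_center_facet[OF that, of C] unfolding regular_pyramids_def by auto
  qed
  show "build \<Longrightarrow> 1 < \<kappa>" "\<not> build \<Longrightarrow> \<kappa> < 1"
    using h nc by (auto simp: \<kappa>_def)
  show "0 < \<kappa>"
  proof (cases build)
    case False
    have "h < infdist C ((+) C ` id ` F)"
      using P[OF id_in_G] False by simp
    also have "\<dots> \<le> dist C (C + c)"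
      using c_in_F by (intro infdist_le) auto
    finally show ?thesis
      using nc False by (simp add: \<kappa>_def dist_norm)
  qed (use h nc in \<open>auto simp: \<kappa>_def add_pos_nonneg\<close>)
  show "apex ((+) C ` g ` F) = C + g (\<kappa> *\<^sub>R c)" if g: "g \<in> G" for g
  proof -
    define z where "z = inv g (apex ((+) C ` g ` F) - (C + g c))"
    have gz: "g z = apex ((+) C ` g ` F) - (C + g c)"
      using g by (simp add: z_def)
    have orth: "z \<bullet> (x - y) = 0" if "x \<in> F" "y \<in> F" for x y
    proof -
      have "g z \<bullet> ((C + g x) - (C + g y)) = 0"
        using P[OF g, THEN conjunct1, THEN bspec, of "C + g x", THEN bspec, of "C + g y"] that
        unfolding gz by simp
      then have "g z \<bullet> g (x - y) = 0"
        using G_linear[OF g] by (simp add: linear_diff)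
      then show ?thesis
        using G_inner[OF g] by simp
    qed
    \<comment> \<open>\<mu> c is the projection of z onto the line of \<open>c\<close>. The
      remainder is orthogonal to \<open>c\<close> and to the directions v - c and m - c of the
      facet, hence to the spanning vectors \<open>v\<close>, \<open>m\<close>, \<open>c\<close>, and
      so it is zero.\<close>
    define \<mu> where "\<mu> = (z \<bullet> c) / (c \<bullet> c)"
    have "(z - \<mu> *\<^sub>R c) \<bullet> c = 0"
      using c_pos by (simp add: \<mu>_def inner_simps)
    moreover have "c \<bullet> (v - c) = 0" "c \<bullet> (m - c) = 0"
      using cc_eq_cv c_m by (simp_all add: inner_simps)
    then have "(z - \<mu> *\<^sub>R c) \<bullet> (v - c) = 0" "(z - \<mu> *\<^sub>R c) \<bullet> (m - c) = 0"
      using orth[OF v_in_F c_in_F] orth[OF m_in_F c_in_F] by (simp_all add: inner_diff_left)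
    ultimately have "(z - \<mu> *\<^sub>R c) \<bullet> v = 0" "(z - \<mu> *\<^sub>R c) \<bullet> m = 0" "(z - \<mu> *\<^sub>R c) \<bullet> c = 0"
      by (simp_all add: inner_diff_right)
    then have "(z - \<mu> *\<^sub>R c) \<bullet> (\<alpha> *\<^sub>R v + \<beta> *\<^sub>R m + \<gamma> *\<^sub>R c) = 0" for \<alpha> \<beta> \<gamma>
      by (simp add: inner_add_right)
    then have "(z - \<mu> *\<^sub>R c) \<bullet> (z - \<mu> *\<^sub>R c) = 0"
      using coords[of "z - \<mu> *\<^sub>R c"] by metis
    then have z: "z = \<mu> *\<^sub>R c"
      by simp
    have "norm z = h"
      using P[OF g] gz orthogonal_transformation_norm[OF G_orth[OF g]] by metis
    then have abs: "\<bar>\<mu>\<bar> = h / norm c"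
      using nc by (simp add: z field_simps)
    have sgn: "g z \<bullet> g c = \<mu> * (c \<bullet> c)"
      using G_inner[OF g] z by simp
    have "if build then 0 < \<mu> else \<mu> < 0"
    proof (cases build)
      case True
      then have "0 < \<mu> * (c \<bullet> c)"
        using P[OF g] unfolding gz[symmetric] sgn by simp
      from zero_less_mult_pos2[OF this c_pos] show ?thesis
        using True by simp
    next
      case False
      then have "\<mu> * (c \<bullet> c) < 0"
        using P[OF g] unfolding gz[symmetric] sgn by simp
      then show ?thesis
        using False c_pos by (metis mult_less_cancel_right_pos mult_zero_left)
    qed
    then have "\<kappa> = 1 + \<mu>"
      using abs by (auto simp: \<kappa>_def split: if_splits)
    moreover have "apex ((+) C ` g ` F) = C + (g c + g (\<mu> *\<^sub>R c))"
      using gz z by (simp add: algebra_simps)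
    ultimately show ?thesis
      using G_linear[OF g] by (simp add: linear_scale linear_add scaleR_add_left)
  qed
qed

lemma star_body_eq:
  assumes pyr: "regular_pyramids ((+) C ` B) C build h apex"
    and \<kappa>: "0 < \<kappa>" "build \<Longrightarrow> 1 < \<kappa>" "\<not> build \<Longrightarrow> \<kappa> < 1"
    and apex: "\<And>g. g \<in> G \<Longrightarrow> apex ((+) C ` g ` F) = C + g (\<kappa> *\<^sub>R c)"
  shows "star_body ((+) C ` B) build apex = (+) C ` {x. star_gauge \<kappa> x \<le> 1}"
proof -
  have "pyramid apex ((+) C ` g ` F) = (+) C ` g ` pyr \<kappa>" if "g \<in> G" for g
    unfolding pyramid_def pyr_def apex[OF that] translated_hull[OF that] by (simp add: image_image)
  then have U: "\<Union>{pyramid apex K | K. K facet_of (+) C ` B} = (+) C ` (\<Union>g\<in>G. g ` pyr \<kappa>)"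
    unfolding facets_translated by (auto simp: image_UN) (metis image_eqI)+
  show ?thesis
  proof (cases build)
    case True
    then show ?thesis
      unfolding star_body_def U using star_build[of \<kappa>] \<kappa>(2) by (simp flip: image_Un)
  next
    case False
    have "(+) C ` B - (+) C ` (\<Union>g\<in>G. g ` pyr \<kappa>) = (+) C ` (B - (\<Union>g\<in>G. g ` pyr \<kappa>))"
      by (rule image_set_diff[symmetric]) simp
    then show ?thesis
      unfolding star_body_def U using star_excavate[OF \<kappa>(1)] \<kappa>(3) False
      by (simp add: closure_translation)
  qed
qed

lemma Union_orbit: "\<Union>(orbit C X) = (+) C ` (\<Union>g\<in>G. g ` X)"
  unfolding orbit_def by auto

text \<open>Each set in the statement is recognised as an orbit: the body and its boundary through
  the gauge, the families of segments through transitivity. The convexity hypothesis covers all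
  tetrahedra of the orbit because the images of \<open>v\<close> and \<open>w\<close> under g are
  the ends of an edge of the image of \<open>F\<close>.\<close>

lemma platonic_inequalities:
  assumes pyr: "regular_pyramids ((+) C ` B) C build h apex"
    and f: "\<And>K x y. K facet_of (+) C ` B \<Longrightarrow> x extreme_point_of K \<Longrightarrow> y extreme_point_of K \<Longrightarrow>
      x \<noteq> y \<Longrightarrow> closed_segment x y face_of K \<Longrightarrow> convex_on (convex hull {C, apex K, x, y}) f"
  defines "Bs \<equiv> star_body ((+) C ` B) build apex"
  shows "avg_vol f Bs \<le> (1/4) * f C + (3/4) * avg_surf f (frontier Bs)"
    "avg_vol f Bs \<le> (1/2) * avg_segs f {closed_segment C (apex K) | K. K facet_of (+) C ` B}
      + (1/2) * avg_segs f {E. E face_of (+) C ` B \<and> aff_dim E = 1}"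
    "avg_vol f Bs \<le> (1/2) * avg_segs f {closed_segment C x | x. x extreme_point_of (+) C ` B}
      + (1/2) * avg_segs f {closed_segment (apex K) x | K x. K facet_of (+) C ` B \<and> x extreme_point_of K}"
    "avg_surf f (frontier (homothety C (3/4) ` Bs)) \<le> avg_vol f Bs"
proof -
  define \<kappa> where "\<kappa> = (if build then 1 + h / norm c else 1 - h / norm c)"
  note \<kappa> = apex_formula(1-3)[OF pyr, folded \<kappa>_def] and apex = apex_formula(4)[OF pyr, folded \<kappa>_def]
  have Bs: "Bs = (+) C ` {x. star_gauge \<kappa> x \<le> 1}"
    unfolding Bs_def by (rule star_body_eq[OF pyr \<kappa> apex])
  have vol: "Bs = \<Union>(orbit C (tet \<kappa>))"
    unfolding Bs Union_orbit gauge_le_eq_Union_tet[OF \<kappa>(1)] ..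
  have surf: "frontier Bs = \<Union>(orbit C (tri \<kappa> 1))"
    unfolding Bs frontier_translation frontier_gauge_le[OF zero_less_one] Union_orbit
      gauge_eq_eq_Union_tri[OF \<kappa>(1) zero_less_one] ..
  have "homothety C (3/4) ` Bs = (+) C ` ((\<lambda>x. (3/4) *\<^sub>R x) ` {x. star_gauge \<kappa> x \<le> 1})"
    unfolding Bs by (simp add: image_image homothety_def)
  \<comment> \<open>Homogeneity of the gauge turns the homothetic copy into the sublevel set at 3/4,
    whose frontier is already known.\<close>
  also have "(\<lambda>x. (3/4) *\<^sub>R x) ` {x. star_gauge \<kappa> x \<le> 1} = {x. star_gauge \<kappa> x \<le> 3/4}"
  proof (intro equalityI subsetI)
    fix x assume "x \<in> {x. star_gauge \<kappa> x \<le> 3/4}"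
    then have "star_gauge \<kappa> ((4/3) *\<^sub>R x) \<le> 1"
      by (subst gauge_scaleR) auto
    then show "x \<in> (\<lambda>x. (3/4) *\<^sub>R x) ` {x. star_gauge \<kappa> x \<le> 1}"
      by (intro image_eqI[of _ _ "(4/3) *\<^sub>R x"]) auto
  qed (auto simp: gauge_scaleR)
  finally have surf2: "frontier (homothety C (3/4) ` Bs) = \<Union>(orbit C (tri \<kappa> (3/4)))"
    using frontier_translation[of C "{x. star_gauge \<kappa> x \<le> 3/4}"] frontier_gauge_le[of "3/4" \<kappa>]
      gauge_eq_eq_Union_tri[OF \<kappa>(1), of "3/4"] by (simp add: Union_orbit)
  have fT: "convex_on ((+) C ` g ` tet \<kappa>) f" if g: "g \<in> G" for g
  proof -
    let ?K = "(+) C ` g ` F"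
    have "closed_segment v w face_of F"
      using E_face F_face v_in_F w_in_F convex_F
      by (metis closed_segment_subset face_of_imp_subset face_of_subset)
    then have "g ` closed_segment v w face_of g ` F"
      using face_of_linear_image[OF G_linear[OF g] G_inj[OF g]] by blast
    then have "closed_segment (C + g v) (C + g w) face_of ?K"
      using translated_segment[OF g, of C v w] face_of_translation_eq by metis
    moreover have "C + g v \<noteq> C + g w"
      using v_neq_w G_inj[OF g] by (simp add: inj_eq)
    moreover have "v extreme_point_of F" "w extreme_point_of F"
      using extreme_point_of_F v_in_F w_in_F ends_extreme by auto
    then have "C + g v extreme_point_of ?K" "C + g w extreme_point_of ?K"
      using linear_extreme_point_of_image[OF G_linear[OF g] G_inj[OF g]] extreme_point_of_translation_eq by metis+
    moreover have "?K facet_of (+) C ` B"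
      using facets_translated g by blast
    ultimately have "convex_on (convex hull {C, apex ?K, C + g v, C + g w}) f"
      using f by blast
    then show ?thesis
      unfolding translated_tet[OF g] apex[OF g] .
  qed
  have Os: "{closed_segment C (apex K) | K. K facet_of (+) C ` B} = orbit C (closed_segment 0 (\<kappa> *\<^sub>R c))"
  proof -
    have "closed_segment C (apex ((+) C ` g ` F)) = (+) C ` g ` closed_segment 0 (\<kappa> *\<^sub>R c)" if "g \<in> G" for g
      unfolding translated_segment[OF that] apex[OF that] linear_0[OF G_linear[OF that]] by simp
    then show ?thesis
      unfolding facets_translated orbit_def by (auto simp: image_iff) (metis)+
  qed
  have Ss: "{closed_segment C x | x. x extreme_point_of (+) C ` B} = orbit C (closed_segment 0 v)"
  proof -
    have "closed_segment C (C + g v) = (+) C ` g ` closed_segment 0 v" if "g \<in> G" for g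
      unfolding translated_segment[OF that] linear_0[OF G_linear[OF that]] by simp
    then show ?thesis
      unfolding vertices_translated orbit_def by (auto simp: image_iff) (metis)+
  qed
  have Ds: "{closed_segment (apex K) x | K x. K facet_of (+) C ` B \<and> x extreme_point_of K} =
      orbit C (closed_segment (\<kappa> *\<^sub>R c) w)"
  proof (intro equalityI subsetI)
    fix s assume "s \<in> {closed_segment (apex K) x | K x. K facet_of (+) C ` B \<and> x extreme_point_of K}"
    then obtain g x where g: "g \<in> G" "x extreme_point_of (+) C ` g ` F" "s = closed_segment (apex ((+) C ` g ` F)) x"
      unfolding facets_translated by blast
    \<comment> \<open>The facet is reached by \<open>g\<close> and its vertex by an element
      \<open>k\<close> fixing \<open>c\<close>. Since \<open>k\<close> then also fixes the apex, the
      composition \<open>g \<circ> k\<close> carries the model segment onto this one.\<close>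
    then obtain k where k: "k \<in> G" "k c = c" "x = C + g (k w)"
      using facet_vertices_translated[OF g(1)] by blast
    have gk: "g \<circ> k \<in> G"
      using g k G_comp by blast
    have "k (\<kappa> *\<^sub>R c) = \<kappa> *\<^sub>R c"
      using k G_linear[OF k(1)] by (simp add: linear_scale)
    then have "s = (+) C ` (g \<circ> k) ` closed_segment (\<kappa> *\<^sub>R c) w"
      unfolding translated_segment[OF gk] g(3) apex[OF g(1)] k(3) by simp
    then show "s \<in> orbit C (closed_segment (\<kappa> *\<^sub>R c) w)"
      unfolding orbit_def using gk by blast
  next
    fix s assume "s \<in> orbit C (closed_segment (\<kappa> *\<^sub>R c) w)"
    then obtain g where g: "g \<in> G" "s = (+) C ` g ` closed_segment (\<kappa> *\<^sub>R c) w"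
      unfolding orbit_def by blast
    have "s = closed_segment (apex ((+) C ` g ` F)) (C + g w)"
      unfolding g(2) translated_segment[OF g(1)] apex[OF g(1)] ..
    moreover have "C + g w extreme_point_of (+) C ` g ` F"
      using facet_vertices_translated[OF g(1)] id_in_G by (metis id_apply)
    moreover have "(+) C ` g ` F facet_of (+) C ` B"
      using facets_translated g(1) by blast
    ultimately show "s \<in> {closed_segment (apex K) x | K x. K facet_of (+) C ` B \<and> x extreme_point_of K}"
      by blast
  qed
  note ineq = orbit_inequalities[OF \<kappa>(1) fT, folded vol]
  show "avg_vol f Bs \<le> (1/4) * f C + (3/4) * avg_surf f (frontier Bs)"
    unfolding surf by (rule ineq(1))
  show "avg_vol f Bs \<le> (1/2) * avg_segs f {closed_segment C (apex K) | K. K facet_of (+) C ` B}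
      + (1/2) * avg_segs f {E. E face_of (+) C ` B \<and> aff_dim E = 1}"
    unfolding Os edges_translated by (rule ineq(2))
  show "avg_vol f Bs \<le> (1/2) * avg_segs f {closed_segment C x | x. x extreme_point_of (+) C ` B}
      + (1/2) * avg_segs f {closed_segment (apex K) x | K x. K facet_of (+) C ` B \<and> x extreme_point_of K}"
    unfolding Ss Ds by (rule ineq(3))
  show "avg_surf f (frontier (homothety C (3/4) ` Bs)) \<le> avg_vol f Bs"
    unfolding surf2 by (rule ineq(4))
qed

end

theorem theorem6p2:
  fixes B :: "(real^3) set" and C :: "real^3" and build :: bool and h :: real
    and apex :: "(real^3) set \<Rightarrow> real^3" and f :: "real^3 \<Rightarrow> real"
  assumes platonic: "platonic_body B C"
    and pyramids: "regular_pyramids B C build h apex"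
    and convex: "\<And>F v w. F facet_of B \<Longrightarrow> v extreme_point_of F \<Longrightarrow> w extreme_point_of F \<Longrightarrow>
                   v \<noteq> w \<Longrightarrow> closed_segment v w face_of F \<Longrightarrow>
                   convex_on (convex hull {C, apex F, v, w}) f"
  defines "Bs \<equiv> star_body B build apex"
    and "Ss \<equiv> {closed_segment C v | v. v extreme_point_of B}"
    and "Os \<equiv> {closed_segment C (apex F) | F. F facet_of B}"
    and "Es \<equiv> {E. E face_of B \<and> aff_dim E = 1}"
    and "Ds \<equiv> {closed_segment (apex F) v | F v. F facet_of B \<and> v extreme_point_of F}"
  shows "avg_vol f Bs \<le> (1/4) * f C + (3/4) * avg_surf f (frontier Bs) \<and>
         avg_vol f Bs \<le> (1/2) * avg_segs f Os + (1/2) * avg_segs f Es \<and>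
         avg_vol f Bs \<le> (1/2) * avg_segs f Ss + (1/2) * avg_segs f Ds \<and>
         avg_surf f (frontier (homothety C (3/4) ` Bs)) \<le> avg_vol f Bs"
proof -
  obtain V v m c a0 a1 a2 where solid: "regular_solid V v m c a0 a1 a2" and B: "B = (+) C ` (convex hull V)"
    using platonic_body_regular_solid[OF platonic] by blast
  interpret regular_solid V v m c a0 a1 a2
    by (rule solid)
  have B: "B = (+) C ` regular_solid.B V"
    using B local.B_def by simp
  show ?thesis
    using platonic_inequalities[OF pyramids[unfolded B], of f] convex[unfolded B]
    unfolding Bs_def Ss_def Os_def Es_def Ds_def B by blast
qed

end
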